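(* Let $d\ge 1$ and $0\le k\le d$ be integers. As $\rho\to\infty$, the error term $R(\rho;\mathbf k_1;d,k)$ satisfies $$R(\rho;\mathbf k_1;d,k)=\begin{cases} O\left(\rho^{(d-1)/2}\right) & \text{if } k<(d+1)/2,\\ O\left(\rho^{(d-1)/2}\log\rho\right) & \text{if } k=(d+1)/2,\\ O\left(\rho^{d-\frac{2k}{1-d+2k}}\right) & \text{if } k>(d+1)/2,\end{cases}$$ uniformly in $\mathbf k_1\in\mathbb R^k$ (the implied constants depend only on $d$ and $k$).
   Context: Put $l=d-k$ and let $\omega_n=\pi^{n/2}/\Gamma(1+n/2)$ be the volume of the unit ball in $\mathbb R^n$ (so $\omega_0=1$). For $\rho>0$ and $\mathbf k_1\in\mathbb R^k$, $S(\rho;\mathbf k_1;d,k)$ is the $l$-dimensional volume of the intersection of $\mathbb Z^k\times\mathbb R^{d-k}\subset\mathbb R^d$ with a ball of radius $\rho$ in $\mathbb R^d$ centred at $(\mathbf k_1,\mathbf k_2)$ (independent of $\mathbf k_2\in\mathbb R^l$); explicitly $$S(\rho;\mathbf k_1;d,k)=\omega_l\sum_{\gamma\in\mathbb Z^k,\ |\gamma-\mathbf k_1|<\rho}(\rho^2-|\gamma-\mathbf k_1|^2)^{l/2}.$$ (When $l=0$ this is the number of $\gamma\in\mathbb Z^d$ with $|\gamma-\mathbf k_1|<\rho$; when $k=0$, $\mathbb Z^0=\mathbb R^0=\{0\}$ and $S=\omega_d\rho^d$.) The error term is $R(\rho;\mathbf k_1;d,k)=S(\rho;\mathbf k_1;d,k)-\omega_d\rho^d$.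 *)

theory Defs
  imports "HOL-Analysis.Analysis"
begin

text \<open>
  The dimension \<open>k\<close> is an arbitrary natural number and may be 0, so points of \<open>R^k\<close> and \<open>Z^k\<close> are
  extensional functions on \<open>{..<k}\<close>; for \<open>k = 0\<close> each of these sets has exactly one element.
\<close>

definition real_space :: "nat \<Rightarrow> (nat \<Rightarrow> real) set" where
  "real_space k = {..<k} \<rightarrow>\<^sub>E UNIV"

definition int_lattice :: "nat \<Rightarrow> (nat \<Rightarrow> int) set" where
  "int_lattice k = {..<k} \<rightarrow>\<^sub>E UNIV"

definition lattice_dist :: "nat \<Rightarrow> (nat \<Rightarrow> int) \<Rightarrow> (nat \<Rightarrow> real) \<Rightarrow> real" where
  "lattice_dist k \<gamma> \<kappa> = L2_set (\<lambda>i. real_of_int (\<gamma> i) - \<kappa> i) {..<k}"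

text \<open>
  The library's \<open>unit_ball_vol n\<close> is \<open>pi powr (n/2) / Gamma (n/2 + 1)\<close>, i.e. \<open>\<omega>\<^sub>n\<close>. The base of
  \<open>powr\<close> is positive for every term of the sum, so each term equals 1 if \<open>k = d\<close>. That this is
  the volume of the intersection of \<open>Z^k \<times> R^(d - k)\<close> with a ball is the content of
  \<open>S_eq_volume\<close> (for \<open>k < d\<close>) and \<open>S_eq_card\<close> (for \<open>k = d\<close>) below.
\<close>

definition S :: "nat \<Rightarrow> nat \<Rightarrow> real \<Rightarrow> (nat \<Rightarrow> real) \<Rightarrow> real" where
  "S d k \<rho> \<kappa> = unit_ball_vol (real (d - k)) *
     (\<Sum>\<gamma> \<in> {\<gamma> \<in> int_lattice k. lattice_dist k \<gamma> \<kappa> < \<rho>}.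
        (\<rho>\<^sup>2 - (lattice_dist k \<gamma> \<kappa>)\<^sup>2) powr (real (d - k) / 2))"

definition R :: "nat \<Rightarrow> nat \<Rightarrow> real \<Rightarrow> (nat \<Rightarrow> real) \<Rightarrow> real" where
  "R d k \<rho> \<kappa> = S d k \<rho> \<kappa> - unit_ball_vol (real d) * \<rho> ^ d"

lemma lattice_dist_nonneg [simp]: "lattice_dist k \<gamma> \<kappa> \<ge> 0"
  by (simp add: lattice_dist_def)

lemma finite_lattice_ball: "finite {\<gamma> \<in> int_lattice k. lattice_dist k \<gamma> \<kappa> < \<rho>}"
proof (rule finite_subset)
  show "{\<gamma> \<in> int_lattice k. lattice_dist k \<gamma> \<kappa> < \<rho>} \<subseteq>
          (\<Pi>\<^sub>E i\<in>{..<k}. {\<lfloor>\<kappa> i - \<rho>\<rfloor>..\<lceil>\<kappa> i + \<rho>\<rceil>})"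
  proof (rule subsetI)
    fix \<gamma> assume "\<gamma> \<in> {\<gamma> \<in> int_lattice k. lattice_dist k \<gamma> \<kappa> < \<rho>}"
    hence \<gamma>: "\<gamma> \<in> int_lattice k" "lattice_dist k \<gamma> \<kappa> < \<rho>" by auto
    have "\<gamma> i \<in> {\<lfloor>\<kappa> i - \<rho>\<rfloor>..\<lceil>\<kappa> i + \<rho>\<rceil>}" if "i < k" for i
    proof -
      have "\<bar>real_of_int (\<gamma> i) - \<kappa> i\<bar> \<le> L2_set (\<lambda>i. \<bar>real_of_int (\<gamma> i) - \<kappa> i\<bar>) {..<k}"
        using that by (intro member_le_L2_set) auto
      also have "\<dots> = lattice_dist k \<gamma> \<kappa>"
        by (simp add: lattice_dist_def L2_set_def)
      finally have "\<bar>real_of_int (\<gamma> i) - \<kappa> i\<bar> < \<rho>"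
        using \<gamma> by linarith
      thus ?thesis by (simp add: abs_less_iff; linarith)
    qed
    with \<gamma> show "\<gamma> \<in> (\<Pi>\<^sub>E i\<in>{..<k}. {\<lfloor>\<kappa> i - \<rho>\<rfloor>..\<lceil>\<kappa> i + \<rho>\<rceil>})"
      by (auto simp: int_lattice_def PiE_iff)
  qed
qed (intro finite_PiE; simp)

lemma S_eq_card: "S d d \<rho> \<kappa> = real (card {\<gamma> \<in> int_lattice d. lattice_dist d \<gamma> \<kappa> < \<rho>})"
proof -
  have "(\<rho>\<^sup>2 - (lattice_dist d \<gamma> \<kappa>)\<^sup>2) powr 0 = 1" if "lattice_dist d \<gamma> \<kappa> < \<rho>" for \<gamma>
  proof -
    have "(lattice_dist d \<gamma> \<kappa>)\<^sup>2 < \<rho>\<^sup>2"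
      using that by (intro power_strict_mono) auto
    thus ?thesis by simp
  qed
  thus ?thesis by (simp add: S_def unit_ball_vol_def)
qed

text \<open>
  The measure on \<open>Z^k \<times> R^l\<close> is the product of counting measure and Lebesgue measure; here \<open>R^l\<close> is
  any Euclidean space of dimension \<open>l = d - k\<close>, and \<open>(\<kappa>, \<kappa>\<^sub>2)\<close> is the centre of the ball.
\<close>

lemma S_eq_volume:
  fixes \<kappa>\<^sub>2 :: "'a :: euclidean_space"
  assumes "\<rho> > 0" and dim: "DIM('a) = d - k"
  shows "S d k \<rho> \<kappa> = measure (count_space (int_lattice k) \<Otimes>\<^sub>M (lborel :: 'a measure))
     {(\<gamma>, y). \<gamma> \<in> int_lattice k \<and> sqrt ((lattice_dist k \<gamma> \<kappa>)\<^sup>2 + (dist y \<kappa>\<^sub>2)\<^sup>2) < \<rho>}"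
    (is "_ = measure ?M ?X")
proof -
  define r where "r = (\<lambda>\<gamma>. sqrt (\<rho>\<^sup>2 - (lattice_dist k \<gamma> \<kappa>)\<^sup>2))"
  define F where "F = {\<gamma> \<in> int_lattice k. lattice_dist k \<gamma> \<kappa> < \<rho>}"
  have fin: "finite F" unfolding F_def by (rule finite_lattice_ball)
  have F_pos: "\<rho>\<^sup>2 - (lattice_dist k \<gamma> \<kappa>)\<^sup>2 > 0" if "\<gamma> \<in> F" for \<gamma>
    using that power_strict_mono[of "lattice_dist k \<gamma> \<kappa>" \<rho> 2] by (auto simp: F_def)
  have less_iff: "sqrt ((lattice_dist k \<gamma> \<kappa>)\<^sup>2 + (dist y \<kappa>\<^sub>2)\<^sup>2) < \<rho> \<longleftrightarrow>
                    (lattice_dist k \<gamma> \<kappa>)\<^sup>2 + (dist y \<kappa>\<^sub>2)\<^sup>2 < \<rho>\<^sup>2" for \<gamma> and y :: 'a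
    using \<open>\<rho> > 0\<close> real_sqrt_less_iff[of "(lattice_dist k \<gamma> \<kappa>)\<^sup>2 + (dist y \<kappa>\<^sub>2)\<^sup>2" "\<rho>\<^sup>2"] by simp
  have slice: "Pair \<gamma> -` ?X = (if \<gamma> \<in> F then ball \<kappa>\<^sub>2 (r \<gamma>) else {})" for \<gamma>
  proof (cases "\<gamma> \<in> F")
    case True
    have "y \<in> Pair \<gamma> -` ?X \<longleftrightarrow> y \<in> ball \<kappa>\<^sub>2 (r \<gamma>)" for y
    proof -
      have "y \<in> Pair \<gamma> -` ?X \<longleftrightarrow> (dist y \<kappa>\<^sub>2)\<^sup>2 < \<rho>\<^sup>2 - (lattice_dist k \<gamma> \<kappa>)\<^sup>2"
        using True by (auto simp: less_iff F_def)
      also have "\<dots> \<longleftrightarrow> dist y \<kappa>\<^sub>2 < r \<gamma>"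
        using real_sqrt_less_iff[of "(dist y \<kappa>\<^sub>2)\<^sup>2" "\<rho>\<^sup>2 - (lattice_dist k \<gamma> \<kappa>)\<^sup>2"]
        by (simp add: r_def)
      finally show ?thesis by (simp add: dist_commute)
    qed
    thus ?thesis using True by (simp only: if_True set_eq_iff) blast
  next
    case False
    have "lattice_dist k \<gamma> \<kappa> < \<rho>"
      if "sqrt ((lattice_dist k \<gamma> \<kappa>)\<^sup>2 + (dist y \<kappa>\<^sub>2)\<^sup>2) < \<rho>" for y
    proof -
      have "lattice_dist k \<gamma> \<kappa> \<le> sqrt ((lattice_dist k \<gamma> \<kappa>)\<^sup>2 + (dist y \<kappa>\<^sub>2)\<^sup>2)"
        by (rule real_sqrt_sum_squares_ge1)
      with that show ?thesis by linarith
    qed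
    with False show ?thesis by (auto simp: F_def)
  qed
  have X_eq: "?X = (\<Union>\<gamma>\<in>F. {\<gamma>} \<times> ball \<kappa>\<^sub>2 (r \<gamma>))"
  proof (rule set_eqI)
    fix z show "z \<in> ?X \<longleftrightarrow> z \<in> (\<Union>\<gamma>\<in>F. {\<gamma>} \<times> ball \<kappa>\<^sub>2 (r \<gamma>))"
      using slice[of "fst z"] by (cases z) (auto simp: set_eq_iff split: if_splits)
  qed
  have X_sets: "?X \<in> sets ?M"
    unfolding X_eq using fin
    by (intro sets.finite_UN pair_measureI) (auto simp: F_def)
  have ball_vol: "emeasure lborel (ball \<kappa>\<^sub>2 (r \<gamma>)) = ennreal (unit_ball_vol (real (d - k)) * r \<gamma> ^ (d - k))"
    if "\<gamma> \<in> F" for \<gamma>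
    using F_pos[OF that] by (subst emeasure_ball) (auto simp: r_def dim)
  have r_pow: "r \<gamma> ^ (d - k) = (\<rho>\<^sup>2 - (lattice_dist k \<gamma> \<kappa>)\<^sup>2) powr (real (d - k) / 2)" if "\<gamma> \<in> F" for \<gamma>
    using F_pos[OF that]
    by (simp add: r_def powr_half_sqrt [symmetric] powr_realpow [symmetric] powr_powr)
  have "emeasure ?M ?X = (\<integral>\<^sup>+\<gamma>. emeasure lborel (Pair \<gamma> -` ?X) \<partial>count_space (int_lattice k))"
    by (rule sigma_finite_measure.emeasure_pair_measure_alt)
       (use X_sets in \<open>auto simp: sigma_finite_lborel\<close>)
  also have "\<dots> = (\<Sum>\<gamma>\<in>F. emeasure lborel (Pair \<gamma> -` ?X))"
    unfolding slice using fin by (intro nn_integral_count_space') (auto simp: F_def)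
  also have "\<dots> = (\<Sum>\<gamma>\<in>F. ennreal (unit_ball_vol (real (d - k)) * r \<gamma> ^ (d - k)))"
    by (intro sum.cong refl) (simp only: slice if_True ball_vol)
  also have "\<dots> = ennreal (\<Sum>\<gamma>\<in>F. unit_ball_vol (real (d - k)) * r \<gamma> ^ (d - k))"
    using F_pos by (intro sum_ennreal) (auto simp: r_def intro!: mult_nonneg_nonneg less_imp_le)
  also have "(\<Sum>\<gamma>\<in>F. unit_ball_vol (real (d - k)) * r \<gamma> ^ (d - k)) = S d k \<rho> \<kappa>"
    by (simp add: S_def F_def [symmetric] sum_distrib_left r_pow)
  finally have "emeasure ?M ?X = ennreal (S d k \<rho> \<kappa>)" .
  moreover have "S d k \<rho> \<kappa> \<ge> 0"
    by (auto simp: S_def intro!: mult_nonneg_nonneg sum_nonneg)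
  ultimately show ?thesis by (simp add: measure_def)
qed

end

theory Submission
  imports Defs "HOL-Complex_Analysis.Complex_Analysis"
begin

text \<open>
  Let \<open>V\<^sub>n(s)\<close> (below \<open>ball_vol n s\<close>) be the volume of the \<open>n\<close>-ball of radius \<open>sqrt s\<close>. With
  \<open>l = d - k\<close> and \<open>s = \<rho>\<^sup>2\<close>, the quantity to be estimated is the lattice sum of the function
  \<open>x \<mapsto> V\<^sub>l(s - |x|\<^sup>2)\<close> on \<open>R^k\<close>. This function arises from the indicator function of the
  \<open>d\<close>-ball by integrating out \<open>l\<close> coordinates, so its Fourier transform at a frequency \<open>m\<close> is the
  (radial) Fourier transform of the \<open>d\<close>-ball at \<open>|m|\<close>, which has size at most a constant times
  \<open>\<rho>^((d-1)/2) |m|^(-(d+1)/2)\<close> (\<open>ball_ft_decay\<close>). Poisson summation gives \<open>\<omega>\<^sub>d \<rho>^d\<close> as the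
  contribution of \<open>m = 0\<close> and expresses the error term as the sum over \<open>m \<noteq> 0\<close>. The condition
  \<open>k < (d+1)/2\<close> is exactly the condition for the sum of \<open>|m|^(-(d+1)/2)\<close> over \<open>m \<noteq> 0\<close> in
  \<open>Z^k\<close> to converge; in the other cases the sum has to be truncated.

  The truncation is done in the variable \<open>s\<close>. The volumes satisfy \<open>V\<^sub>n\<^sub>+\<^sub>2' = \<pi> V\<^sub>n\<close>, and so do
  the lattice sums and the Fourier transforms derived from them. Since the lattice sum for \<open>l\<close> is
  increasing in \<open>s\<close>, it is enclosed between \<open>N\<close>-th differences with step \<open>h\<close>, divided by
  \<open>(\<pi> h)^N\<close>, of the lattice sum for \<open>l + 2N\<close> (\<open>fdiff_bounds\<close>). For the latter, Poisson summation
  converges absolutely (\<open>lattice_ball_vol_poisson\<close>). The \<open>N\<close>-th difference of its term at \<open>m\<close>,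
  divided by \<open>(\<pi> h)^N\<close>, is bounded in two ways: by the size of the transform of the \<open>d\<close>-ball, and
  trivially by the size of the transform of the \<open>(d + 2N)\<close>-ball. If \<open>h\<close> is of order \<open>\<rho> / M\<close>, the
  second bound gains the factor \<open>(M / |m|)^N\<close> over the first (\<open>ball_ft_fdiff_bound\<close>), so
  that effectively only the frequencies \<open>|m| \<le> M\<close> count. The shift of \<open>s\<close> by \<open>N h\<close> changes
  the volume of the \<open>d\<close>-ball by \<open>O(\<rho>^(d-1) / M)\<close>. This gives an estimate with a free parameter
  \<open>M\<close> (\<open>error_bound_parameter\<close>), and the three cases of the theorem come from the best choice
  of \<open>M\<close> and the three possible growth rates of the truncated lattice sum (\<open>lattice_sum_bound\<close>).
  The centre of the ball enters only through products of cosines that multiply the terms of the Poisson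
  sum, whence the uniformity.

  All Fourier analysis takes place on the real line. Integrating a slice of a ball against
  a cosine in one coordinate yields, by rotation invariance in the plane, the transform of a ball of
  one dimension more at the frequency \<open>sqrt (\<xi>\<^sup>2 + \<eta>\<^sup>2)\<close> (\<open>ball_ft_rotation\<close>). Hence
  Poisson summation over \<open>Z^k\<close> follows from Poisson summation over \<open>Z\<close>, one coordinate at a
  time (\<open>ball_ft_lattice_poisson\<close>).
\<close>

section \<open>Volumes of balls and their Fourier transforms\<close>

text \<open>
  The argument is the squared radius, so that slices of balls are obtained by subtracting squares and
  differentiation in it lowers the dimension by two. The value 0 at \<open>s = 0\<close>, also for \<open>n = 0\<close>,
  matches the strict inequality in the definition of the lattice sum.
\<close>

definition ball_vol :: "nat \<Rightarrow> real \<Rightarrow> real" where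
  "ball_vol n s = (if s > 0 then unit_ball_vol (real n) * sqrt s ^ n else 0)"

text \<open>
  The Fourier transform of the indicator function of the \<open>n\<close>-ball of radius \<open>sqrt s\<close> (for
  \<open>n \<ge> 1\<close>) at any vector of length \<open>\<bar>\<xi>\<bar>\<close>: rotate the vector onto a coordinate axis and integrate
  out the remaining \<open>n - 1\<close> coordinates.
\<close>

definition ball_ft :: "nat \<Rightarrow> real \<Rightarrow> real \<Rightarrow> real" where
  "ball_ft n s \<xi> = (\<integral>t. ball_vol (n - 1) (s - t\<^sup>2) * cos (2 * pi * \<xi> * t) \<partial>lborel)"

lemma ball_vol_nonpos [simp]: "s \<le> 0 \<Longrightarrow> ball_vol n s = 0"
  by (simp add: ball_vol_def)

lemma ball_vol_nonneg [simp]: "ball_vol n s \<ge> 0"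
  by (simp add: ball_vol_def)

lemma ball_vol_mono: "s \<le> t \<Longrightarrow> ball_vol n s \<le> ball_vol n t"
  by (auto simp: ball_vol_def intro!: mult_left_mono power_mono)

lemma ball_vol_scale: "c > 0 \<Longrightarrow> ball_vol n (c * s) = sqrt c ^ n * ball_vol n s"
  by (simp add: ball_vol_def zero_less_mult_iff real_sqrt_mult power_mult_distrib)

lemma ball_vol_measurable [measurable]: "ball_vol n \<in> borel_measurable borel"
  unfolding ball_vol_def by measurable

lemma ball_vol_continuous: 
  assumes "n \<ge> 1" shows "continuous_on A (ball_vol n)"
proof -
  have "ball_vol n = (\<lambda>s. unit_ball_vol (real n) * sqrt (max s 0) ^ n)"
    using assms by (auto simp: ball_vol_def fun_eq_iff max_def)
  thus ?thesis by (auto intro!: continuous_intros)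
qed

text \<open>
  Slices outside the ball are empty; the compact supports and finite sums below come from this.
\<close>

lemma ball_vol_slice_support: "\<lbrakk>s \<le> a\<^sup>2; 0 \<le> a; t \<notin> {-a..a}\<rbrakk> \<Longrightarrow> ball_vol n (s - t\<^sup>2) = 0"
  by (rule ball_vol_nonpos) (smt (verit) atLeastAtMost_iff power2_le_iff_abs_le abs_le_iff power2_minus)

lemma integrable_ball_vol_slice:
  assumes [measurable]: "g \<in> borel_measurable borel" and "\<And>t. \<bar>g t\<bar> \<le> 1"
  shows "integrable lborel (\<lambda>t. ball_vol n (s - t\<^sup>2) * g t)"
proof (rule integrableI_bounded_set[where A = "{-sqrt \<bar>s\<bar>..sqrt \<bar>s\<bar>}" and B = "ball_vol n s"])
  have "\<bar>ball_vol n (s - t\<^sup>2)\<bar> * \<bar>g t\<bar> \<le> ball_vol n s * 1" for t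
    by (intro mult_mono assms(2)) (auto intro: ball_vol_mono)
  thus "AE t\<in>{-sqrt \<bar>s\<bar>..sqrt \<bar>s\<bar>} in lborel. norm (ball_vol n (s - t\<^sup>2) * g t) \<le> ball_vol n s"
    by (simp add: abs_mult)
  show "AE t in lborel. t \<notin> {-sqrt \<bar>s\<bar>..sqrt \<bar>s\<bar>} \<longrightarrow> ball_vol n (s - t\<^sup>2) * g t = 0"
    by (intro AE_I2 impI) (subst ball_vol_slice_support[where a = "sqrt \<bar>s\<bar>"], auto)
qed auto

lemma ball_ft_scale:
  assumes "s > 0"
  shows "ball_ft (Suc n) s \<xi> = sqrt s ^ Suc n * ball_ft (Suc n) 1 (sqrt s * \<xi>)"
proof -
  have "ball_ft (Suc n) s \<xi> =
      sqrt s * (\<integral>u. ball_vol n (s - (sqrt s * u)\<^sup>2) * cos (2 * pi * \<xi> * (sqrt s * u)) \<partial>lborel)"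
    unfolding ball_ft_def using assms
    by (subst lborel_integral_real_affine[where c = "sqrt s" and t = 0]) auto
  also have "(\<lambda>u. ball_vol n (s - (sqrt s * u)\<^sup>2) * cos (2 * pi * \<xi> * (sqrt s * u))) =
      (\<lambda>u. sqrt s ^ n * (ball_vol n (1 - u\<^sup>2) * cos (2 * pi * (sqrt s * \<xi>) * u)))"
  proof
    fix u
    have "s - (sqrt s * u)\<^sup>2 = s * (1 - u\<^sup>2)"
      using assms by (simp add: power_mult_distrib algebra_simps)
    thus "ball_vol n (s - (sqrt s * u)\<^sup>2) * cos (2 * pi * \<xi> * (sqrt s * u)) =
        sqrt s ^ n * (ball_vol n (1 - u\<^sup>2) * cos (2 * pi * (sqrt s * \<xi>) * u))"
      using ball_vol_scale[OF assms, of n "1 - u\<^sup>2"] by (simp add: mult_ac)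
  qed
  finally show ?thesis by (simp add: ball_ft_def)
qed

lemma ball_ft_nonpos [simp]: "s \<le> 0 \<Longrightarrow> ball_ft n s \<xi> = 0"
proof -
  assume "s \<le> 0"
  hence "ball_vol (n - 1) (s - t\<^sup>2) = 0" for t 
    by (intro ball_vol_nonpos) (smt (verit) zero_le_power2)
  thus ?thesis by (simp add: ball_ft_def)
qed

text \<open>
  At frequency 0 the transform is the total volume. After scaling to radius 1 this is the beta
  integral in the recursion for the volumes of balls.
\<close>

lemma ball_ft_zero: "ball_ft (Suc n) s 0 = ball_vol (Suc n) s"
proof (cases "s > 0")
  case True
  have "ennreal (ball_ft (Suc n) 1 0) = (\<integral>\<^sup>+u. ennreal (ball_vol n (1 - u\<^sup>2)) \<partial>lborel)"
    unfolding ball_ft_def using integrable_ball_vol_slice[of "\<lambda>_. 1" n 1]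
    by (subst nn_integral_eq_integral) auto
  also have "\<dots> = (\<integral>\<^sup>+u. ennreal (unit_ball_vol (real n)) *
                       ennreal (indicator {-1..1} u * sqrt (1 - u\<^sup>2) ^ n) \<partial>lborel)"
  proof (rule nn_integral_cong_AE)
    have "AE u in lborel. u \<notin> {-1,1::real}"
      by (intro AE_not_in countable_imp_null_set_lborel) auto
    thus "AE u in lborel. ennreal (ball_vol n (1 - u\<^sup>2)) = ennreal (unit_ball_vol (real n)) *
                       ennreal (indicator {-1..1} u * sqrt (1 - u\<^sup>2) ^ n)"
    proof eventually_elim
      case (elim u)
      have "u\<^sup>2 < 1 \<longleftrightarrow> u \<in> {-1<..<1}"
        using abs_square_less_1[of u] by (auto simp: abs_less_iff)
      moreover have "u \<in> {-1<..<1} \<longleftrightarrow> u \<in> {-1..1}" using elim by auto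
      ultimately show ?case
        by (auto simp: ball_vol_def indicator_def ennreal_mult' simp flip: ennreal_mult)
    qed
  qed
  also have "\<dots> = ennreal (unit_ball_vol (real n)) * ennreal (Beta (1 / 2) (real n / 2 + 1))"
    by (subst nn_integral_cmult) (auto simp: emeasure_cball_aux_integral)
  also have "\<dots> = ennreal (unit_ball_vol (real n) * Beta (1 / 2) (real n / 2 + 1))"
    by (subst ennreal_mult') (auto simp: Beta_def intro!: divide_nonneg_pos mult_nonneg_nonneg)
  finally have "ball_ft (Suc n) 1 0 = unit_ball_vol (real n) * Beta (1 / 2) (real n / 2 + 1)"
    unfolding ball_ft_def
    by (subst (asm) ennreal_inj) (auto simp: Beta_def intro!: divide_nonneg_pos mult_nonneg_nonneg)
  also have "\<dots> = unit_ball_vol (real (Suc n))"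
  proof -
    have "Gamma (real n / 2 + 1) > 0"
      by (intro Gamma_real_pos) auto
    hence "Gamma (real n / 2 + 1) \<noteq> 0"
      by (rule less_imp_neq[THEN not_sym])
    moreover have "pi powr (real (Suc n) / 2) = pi powr (real n / 2) * sqrt pi"
      using powr_add[of pi "real n / 2" "1 / 2"] by (simp add: powr_half_sqrt add_divide_distrib add_ac)
    moreover have "real (Suc n) / 2 + 1 = 1 / 2 + (real n / 2 + 1)"
      by (simp add: field_simps)
    ultimately show ?thesis
      unfolding unit_ball_vol_def Beta_def Gamma_one_half_real by (simp only:) simp
  qed
  finally have "ball_ft (Suc n) 1 0 = unit_ball_vol (real (Suc n))" .
  thus ?thesis using True ball_ft_scale[OF True, of n 0] by (simp add: ball_vol_def)
qed auto

text \<open>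
  The antiderivative of the volume in the squared radius is the volume in dimension two higher, up to
  the factor \<open>\<pi>\<close>; on the constants this is the functional equation of the Gamma function. The shift
  \<open>c\<close> allows the lemma to be used for slices and for off-centre lattice points.
\<close>

lemma ball_vol_has_integral:
  assumes "a \<le> b"
  shows "((\<lambda>s. ball_vol n (s - c)) has_integral
           (ball_vol (n + 2) (b - c) - ball_vol (n + 2) (a - c)) / pi) {a..b}"
proof -
  have *: "unit_ball_vol (real (n + 2)) * (real n / 2 + 1) = pi * unit_ball_vol (real n)"
  proof -
    have "Gamma (real n / 2 + 2) = (real n / 2 + 1) * Gamma (real n / 2 + 1)"
      using Gamma_plus1[of "real n / 2 + 1"] by (simp add: add_ac nonpos_Ints_def)
    moreover have "pi powr (real n / 2 + 1) = pi * pi powr (real n / 2)" by (simp add: powr_add)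
    moreover have "real (n + 2) / 2 = real n / 2 + 1" "real (n + 2) / 2 + 1 = real n / 2 + 2"
      by simp_all
    ultimately show ?thesis
      unfolding unit_ball_vol_def by (simp only:) simp
  qed
  have pos: "((\<lambda>s. ball_vol (n + 2) (s - c) / pi) has_vector_derivative ball_vol n (s - c)) (at s)"
    if "s > c" for s
  proof -
    have "((\<lambda>s. unit_ball_vol (real (n + 2)) * (s - c) powr (real n / 2 + 1) / pi) has_vector_derivative
        unit_ball_vol (real (n + 2)) * ((real n / 2 + 1) * (s - c) powr (real n / 2)) / pi) (at s)"
      unfolding has_real_derivative_iff_has_vector_derivative[symmetric]
      using that by (auto intro!: derivative_eq_intros)
    also have "unit_ball_vol (real (n + 2)) * ((real n / 2 + 1) * (s - c) powr (real n / 2)) / pi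
        = unit_ball_vol (real n) * (s - c) powr (real n / 2)"
      unfolding mult.assoc[symmetric] * by simp
    also have "\<dots> = ball_vol n (s - c)"
      using that by (simp add: ball_vol_def powr_half_sqrt[symmetric] powr_powr flip: powr_realpow)
    finally show ?thesis
    proof (rule has_vector_derivative_transform_within_open[where S = "{c<..}"])
      fix x assume "x \<in> {c<..}"
      moreover have "real n / 2 + 1 = real (n + 2) / 2" by simp
      ultimately show "unit_ball_vol (real (n + 2)) * (x - c) powr (real n / 2 + 1) / pi
           = ball_vol (n + 2) (x - c) / pi"
        by (simp only: ball_vol_def) 
           (simp add: powr_half_sqrt[symmetric] powr_powr del: of_nat_add power_Suc add_2_eq_Suc' flip: powr_realpow)
    qed (use that in auto)
  qed
  have neg: "((\<lambda>s. ball_vol (n + 2) (s - c) / pi) has_vector_derivative ball_vol n (s - c)) (at s)"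
    if "s < c" for s
    by (rule has_vector_derivative_transform_within_open[where S = "{..<c}" and f = "\<lambda>_. 0"])
       (use that in auto)
  have "((\<lambda>s. ball_vol n (s - c)) has_integral
           (ball_vol (n + 2) (b - c) / pi - ball_vol (n + 2) (a - c) / pi)) {a..b}"
  proof (rule fundamental_theorem_of_calculus_interior_strong[where S = "{c}"])
    show "continuous_on {a..b} (\<lambda>s. ball_vol (n + 2) (s - c) / pi)"
      by (intro continuous_intros continuous_on_compose2[OF ball_vol_continuous[where A=UNIV]]) auto
    fix s assume "s \<in> {a<..<b} - {c}"
    thus "((\<lambda>s. ball_vol (n + 2) (s - c) / pi) has_vector_derivative ball_vol n (s - c)) (at s)"
      using pos neg by (cases "s < c") auto
  qed (use assms in auto)
  thus ?thesis by (simp add: diff_divide_distrib)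
qed

text \<open>
  The relation for volumes is inherited by the transforms because, by Fubini, integration in \<open>s\<close> can
  be carried out slice by slice.
\<close>

lemma ball_ft_has_integral:
  assumes "a \<le> b"
  shows "((\<lambda>s. ball_ft (Suc n) s \<xi>) has_integral
           (ball_ft (Suc n + 2) b \<xi> - ball_ft (Suc n + 2) a \<xi>) / pi) {a..b}"
proof -
  define A where "A = sqrt \<bar>b\<bar>"
  define g where "g = (\<lambda>s t. indicator {a..b} s * (ball_vol n (s - t\<^sup>2) * cos (2 * pi * \<xi> * t)) :: real)"
  have g_int: "integrable (lborel \<Otimes>\<^sub>M lborel) (\<lambda>(s, t). g s t)"
  proof (rule integrableI_bounded_set[where A = "{a..b} \<times> {-A..A}" and B = "ball_vol n b"])
    show "(\<lambda>(s, t). g s t) \<in> borel_measurable (lborel \<Otimes>\<^sub>M lborel)"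
      unfolding g_def by measurable
    show "emeasure (lborel \<Otimes>\<^sub>M lborel) ({a..b} \<times> {-A..A}) < \<infinity>"
      using assms by (subst lborel.emeasure_pair_measure_Times) (auto simp: A_def ennreal_mult_less_top)
    have "norm (g s t) \<le> ball_vol n b" for s t
    proof (cases "s \<in> {a..b}")
      case True
      have "ball_vol n (s - t\<^sup>2) * \<bar>cos (2 * pi * \<xi> * t)\<bar> \<le> ball_vol n b * 1"
        using True by (intro mult_mono ball_vol_mono) (auto intro: order_trans[of _ s])
      thus ?thesis using True by (simp add: g_def abs_mult)
    qed (auto simp: g_def)
    thus "AE z\<in>{a..b} \<times> {-A..A} in lborel \<Otimes>\<^sub>M lborel. norm (case z of (s, t) \<Rightarrow> g s t) \<le> ball_vol n b"
      by auto
    have "g s t = 0" if "(s, t) \<notin> {a..b} \<times> {-A..A}" for s t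
    proof (cases "s \<in> {a..b}")
      case True
      hence "ball_vol n (s - t\<^sup>2) = 0"
        using that by (intro ball_vol_slice_support[of _ A]) (auto simp: A_def)
      thus ?thesis by (simp add: g_def)
    qed (auto simp: g_def)
    thus "AE z in lborel \<Otimes>\<^sub>M lborel. z \<notin> {a..b} \<times> {-A..A} \<longrightarrow> (case z of (s, t) \<Rightarrow> g s t) = 0"
      by (intro AE_I2) (auto split: prod.splits)
  qed auto
  have inner_s: "(\<integral>t. g s t \<partial>lborel) = indicator {a..b} s * ball_ft (Suc n) s \<xi>" for s
    by (simp add: g_def ball_ft_def)
  have inner_t: "(\<integral>s. g s t \<partial>lborel) =
      (ball_vol (n + 2) (b - t\<^sup>2) - ball_vol (n + 2) (a - t\<^sup>2)) / pi * cos (2 * pi * \<xi> * t)" for t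
  proof -
    have si: "set_integrable lborel {a..b} (\<lambda>s. ball_vol n (s - t\<^sup>2))"
      unfolding set_integrable_def real_scaleR_def
    proof (rule integrableI_bounded_set[where A = "{a..b}" and B = "ball_vol n b"])
      have "ball_vol n (s - t\<^sup>2) \<le> ball_vol n b" if "s \<le> b" for s
        using that zero_le_power2[of t] by (intro ball_vol_mono) linarith
      thus "AE s\<in>{a..b} in lborel. norm (indicator {a..b} s * ball_vol n (s - t\<^sup>2)) \<le> ball_vol n b"
        by (intro AE_I2) auto
    qed (use assms in auto)
    have "(\<integral>s. g s t \<partial>lborel) = (LINT s:{a..b}|lborel. ball_vol n (s - t\<^sup>2)) * cos (2 * pi * \<xi> * t)"
      by (simp add: g_def set_lebesgue_integral_def flip: mult.assoc)
    also have "(LINT s:{a..b}|lborel. ball_vol n (s - t\<^sup>2)) = integral {a..b} (\<lambda>s. ball_vol n (s - t\<^sup>2))"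
      by (rule set_borel_integral_eq_integral[OF si])
    also have "\<dots> = (ball_vol (n + 2) (b - t\<^sup>2) - ball_vol (n + 2) (a - t\<^sup>2)) / pi"
      by (rule integral_unique[OF ball_vol_has_integral[OF assms]])
    finally show ?thesis .
  qed
  have int_s: "integrable lborel (\<lambda>s. indicator {a..b} s * ball_ft (Suc n) s \<xi>)"
    using lborel_pair.integrable_fst'[OF g_int] by (simp add: inner_s)
  have "(\<integral>s. indicator {a..b} s * ball_ft (Suc n) s \<xi> \<partial>lborel) = (\<integral>s. (\<integral>t. g s t \<partial>lborel) \<partial>lborel)"
    by (simp add: inner_s)
  also have "\<dots> = (\<integral>t. (\<integral>s. g s t \<partial>lborel) \<partial>lborel)"
    by (rule lborel_pair.Fubini_integral[symmetric]) (use g_int in auto)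
  also have "\<dots> = (\<integral>t. (ball_vol (n + 2) (b - t\<^sup>2) * cos (2 * pi * \<xi> * t)
       - ball_vol (n + 2) (a - t\<^sup>2) * cos (2 * pi * \<xi> * t)) / pi \<partial>lborel)"
    by (simp add: inner_t algebra_simps)
  also have "\<dots> = (ball_ft (Suc n + 2) b \<xi> - ball_ft (Suc n + 2) a \<xi>) / pi"
    by (simp add: ball_ft_def integrable_ball_vol_slice)
  finally have eq: "(LINT s:{a..b}|lborel. ball_ft (Suc n) s \<xi>) =
      (ball_ft (Suc n + 2) b \<xi> - ball_ft (Suc n + 2) a \<xi>) / pi"
    by (simp add: set_lebesgue_integral_def)
  have si: "set_integrable lborel {a..b} (\<lambda>s. ball_ft (Suc n) s \<xi>)"
    using int_s by (simp add: set_integrable_def)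
  show ?thesis
    using set_borel_integral_eq_integral[OF si] eq by (simp add: has_integral_iff)
qed

text \<open>
  On a half-line \<open>s \<le> c\<^sup>2\<close> the defining integral extends over the fixed interval from \<open>-c\<close> to \<open>c\<close>,
  which turns it into a continuous parametric integral.
\<close>

lemma ball_ft_continuous:
  assumes "n \<ge> 1"
  shows "continuous_on A (\<lambda>s. ball_ft (Suc n) s \<xi>)"
proof -
  have *: "continuous_on {..c\<^sup>2} (\<lambda>s. ball_ft (Suc n) s \<xi>)" if "c \<ge> 0" for c
  proof -
    define f where "f = (\<lambda>s t. ball_vol n (s - t\<^sup>2) * cos (2 * pi * \<xi> * t))"
    have cont: "continuous_on UNIV (\<lambda>(s, t). f s t)"
      unfolding f_def case_prod_unfold
      by (intro continuous_intros continuous_on_compose2[OF ball_vol_continuous[OF assms, of UNIV]]) auto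
    have "continuous_on {..c\<^sup>2} (\<lambda>s. integral (cbox (-c) c) (f s))"
      by (rule integral_continuous_on_param) (rule continuous_on_subset[OF cont], auto)
    also have "?this \<longleftrightarrow> continuous_on {..c\<^sup>2} (\<lambda>s. ball_ft (Suc n) s \<xi>)"
    proof (rule continuous_on_cong[OF refl])
      fix s assume s: "s \<in> {..c\<^sup>2}"
      have "(f s has_integral ball_ft (Suc n) s \<xi>) UNIV"
        unfolding f_def ball_ft_def diff_Suc_1
        by (intro has_integral_integral_lborel integrable_ball_vol_slice) auto
      hence "(f s has_integral ball_ft (Suc n) s \<xi>) (cbox (-c) c)"
      proof (rule has_integral_restrict_UNIV[THEN iffD1, rotated 0, OF has_integral_eq[rotated]])
        fix t show "f s t = (if t \<in> cbox (- c) c then f s t else 0)"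
          using ball_vol_slice_support[of s c t n] s that by (auto simp: f_def)
      qed
      thus "integral (cbox (-c) c) (f s) = ball_ft (Suc n) s \<xi>"
        by (rule integral_unique)
    qed
    finally show ?thesis .
  qed
  have "isCont (\<lambda>s. ball_ft (Suc n) s \<xi>) x" for x
  proof (rule continuous_on_interior[OF *[of "\<bar>x\<bar> + 1"]])
    have "(\<bar>x\<bar> + 1)\<^sup>2 = x\<^sup>2 + 2 * \<bar>x\<bar> + 1" by (simp add: power2_sum)
    hence "x < (\<bar>x\<bar> + 1)\<^sup>2"
      using zero_le_power2[of x] by linarith
    thus "x \<in> interior {..(\<bar>x\<bar> + 1)\<^sup>2}" by simp
  qed auto
  thus ?thesis by (simp add: continuous_at_imp_continuous_on)
qed

text \<open>
  A rotation with \<open>c \<noteq> 0\<close> is the composition of two substitutions that each change a single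
  variable: first \<open>v = s x + c y\<close> for fixed \<open>x\<close>, then \<open>u = (x - s v) / c\<close> for fixed \<open>v\<close>.
  Their Jacobians \<open>1 / \<bar>c\<bar>\<close> and \<open>\<bar>c\<bar>\<close> cancel.
\<close>

lemma integral_rotation:
  fixes f :: "real \<Rightarrow> real \<Rightarrow> real"
  assumes h_int: "integrable (lborel \<Otimes>\<^sub>M lborel) (\<lambda>(x, v). f ((x - s * v) / c) v)"
    and cs: "c\<^sup>2 + s\<^sup>2 = 1" "c \<noteq> 0"
  shows "(\<integral>x. (\<integral>y. f (c * x - s * y) (s * x + c * y) \<partial>lborel) \<partial>lborel) =
         (\<integral>v. (\<integral>u. f u v \<partial>lborel) \<partial>lborel)"
proof -
  have *: "(\<integral>y. f (c * x - s * y) (s * x + c * y) \<partial>lborel) = (\<integral>v. f ((x - s * v) / c) v \<partial>lborel) / \<bar>c\<bar>" for x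
  proof -
    have "(\<integral>v. f ((x - s * v) / c) v \<partial>lborel) =
        \<bar>c\<bar> * (\<integral>y. f ((x - s * (s * x + c * y)) / c) (s * x + c * y) \<partial>lborel)"
      using \<open>c \<noteq> 0\<close> by (subst lborel_integral_real_affine[where c = c and t = "s * x"]) auto
    also have "(\<lambda>y. (x - s * (s * x + c * y)) / c) = (\<lambda>y. c * x - s * y)"
    proof
      fix y
      have "x - s * (s * x + c * y) = c\<^sup>2 * x - s * c * y"
      proof -
        have "x = (c\<^sup>2 + s\<^sup>2) * x" using cs(1) by simp
        thus ?thesis by (simp add: power2_eq_square algebra_simps)
      qed
      also have "\<dots> = c * (c * x - s * y)"
        by (simp add: power2_eq_square algebra_simps)
      finally show "(x - s * (s * x + c * y)) / c = c * x - s * y"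
        using \<open>c \<noteq> 0\<close> by simp
    qed
    finally show ?thesis using \<open>c \<noteq> 0\<close> by simp
  qed
  have "(\<integral>x. (\<integral>y. f (c * x - s * y) (s * x + c * y) \<partial>lborel) \<partial>lborel) =
      (\<integral>x. (\<integral>v. f ((x - s * v) / c) v \<partial>lborel) \<partial>lborel) / \<bar>c\<bar>"
    unfolding * by simp
  also have "(\<integral>x. (\<integral>v. f ((x - s * v) / c) v \<partial>lborel) \<partial>lborel) =
      (\<integral>v. (\<integral>x. f ((x - s * v) / c) v \<partial>lborel) \<partial>lborel)"
    by (rule lborel_pair.Fubini_integral[symmetric]) (use h_int in auto)
  also have "(\<lambda>v. \<integral>x. f ((x - s * v) / c) v \<partial>lborel) = (\<lambda>v. \<bar>c\<bar> * (\<integral>u. f u v \<partial>lborel))"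
  proof
    fix v
    show "(\<integral>x. f ((x - s * v) / c) v \<partial>lborel) = \<bar>c\<bar> * (\<integral>u. f u v \<partial>lborel)"
      using \<open>c \<noteq> 0\<close> by (subst lborel_integral_real_affine[where c = c and t = "s * v"]) auto
  qed
  finally show ?thesis using \<open>c \<noteq> 0\<close> by simp
qed

text \<open>
  The left-hand side is a planar integral of a radial function against
  \<open>cos (2 \<pi> \<xi> y) cos (2 \<pi> \<eta> x)\<close>. By symmetry the product may be replaced by
  \<open>cos (2 \<pi> (\<xi> y + \<eta> x))\<close>, and a rotation moves the vector \<open>(\<eta>, \<xi>)\<close> onto a coordinate
  axis. This makes the functions \<open>x \<mapsto> ball_ft n (s - x\<^sup>2) \<xi>\<close> a family that is closed under the
  one-dimensional Fourier transform.
\<close>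

lemma ball_ft_rotation:
  "(\<integral>x. ball_ft (Suc n) (s - x\<^sup>2) \<xi> * cos (2 * pi * \<eta> * x) \<partial>lborel) =
     ball_ft (Suc (Suc n)) s (sqrt (\<xi>\<^sup>2 + \<eta>\<^sup>2))"
proof (cases "\<xi> = 0")
  case True
  have "cos (2 * pi * \<bar>\<eta>\<bar> * x) = cos (2 * pi * \<eta> * x)" for x
    by (cases "\<eta> \<ge> 0") (auto simp: abs_if)
  with True show ?thesis
    by (simp add: ball_ft_zero) (simp add: ball_ft_def)
next
  case False
  define r where "r = sqrt (\<xi>\<^sup>2 + \<eta>\<^sup>2)"
  have r: "r > 0" "r\<^sup>2 = \<xi>\<^sup>2 + \<eta>\<^sup>2"
    using False by (auto simp: r_def add_pos_nonneg)
  define c d where "c = \<xi> / r" and "d = \<eta> / r"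
  have cd: "c\<^sup>2 + d\<^sup>2 = 1" "c \<noteq> 0" "r * c = \<xi>" "r * d = \<eta>"
    using r False by (auto simp: c_def d_def power_divide simp flip: add_divide_distrib)
  have "c\<^sup>2 \<le> 1" "d\<^sup>2 \<le> 1"
    using cd(1) zero_le_power2[of c] zero_le_power2[of d] by linarith+
  hence cd_le: "\<bar>c\<bar> \<le> 1" "\<bar>d\<bar> \<le> 1"
    by (simp_all add: abs_square_le_1)
  define f where "f = (\<lambda>u v. ball_vol n (s - v\<^sup>2 - u\<^sup>2) * cos (2 * pi * r * v))"
  define A where "A = sqrt \<bar>s\<bar>"
  have h_int: "integrable (lborel \<Otimes>\<^sub>M lborel) (\<lambda>(x, v). f ((x - d * v) / c) v)"
  proof (rule integrableI_bounded_set[where A = "{-2*A..2*A} \<times> {-A..A}" and B = "ball_vol n s"])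
    show "(\<lambda>(x, v). f ((x - d * v) / c) v) \<in> borel_measurable (lborel \<Otimes>\<^sub>M lborel)"
      unfolding f_def by measurable
    show "emeasure (lborel \<Otimes>\<^sub>M lborel) ({-2*A..2*A} \<times> {-A..A}) < \<infinity>"
      by (subst lborel.emeasure_pair_measure_Times) (auto simp: A_def ennreal_mult_less_top)
    have "norm (f u v) \<le> ball_vol n s" for u v
    proof -
      have "ball_vol n (s - v\<^sup>2 - u\<^sup>2) * \<bar>cos (2 * pi * r * v)\<bar> \<le> ball_vol n s * 1"
        by (intro mult_mono ball_vol_mono) auto
      thus ?thesis by (simp add: f_def abs_mult)
    qed
    thus "AE z\<in>{-2*A..2*A} \<times> {-A..A} in lborel \<Otimes>\<^sub>M lborel.
        norm (case z of (x, v) \<Rightarrow> f ((x - d * v) / c) v) \<le> ball_vol n s"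
      by (intro AE_I2) (auto split: prod.splits)
    have "f ((x - d * v) / c) v = 0" if "(x, v) \<notin> {-2*A..2*A} \<times> {-A..A}" for x v
    proof -
      have "s - v\<^sup>2 - u\<^sup>2 \<le> 0" if "\<bar>v\<bar> > A \<or> \<bar>u\<bar> > A" for u
      proof -
        have "A\<^sup>2 \<le> v\<^sup>2 \<or> A\<^sup>2 \<le> u\<^sup>2"
          using that abs_le_square_iff[of A v] abs_le_square_iff[of A u]
          by (auto simp: A_def)
        moreover have "A\<^sup>2 \<ge> s" by (simp add: A_def)
        ultimately show ?thesis
          using zero_le_power2[of u] zero_le_power2[of v] by linarith
      qed
      moreover have "\<bar>v\<bar> > A \<or> \<bar>(x - d * v) / c\<bar> > A"
      proof (rule ccontr)
        assume "\<not> ?thesis"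
        hence v: "\<bar>v\<bar> \<le> A" and u: "\<bar>(x - d * v) / c\<bar> \<le> A" by auto
        have "\<bar>x - d * v\<bar> \<le> A * \<bar>c\<bar>" using u cd(2) by (simp add: field_simps)
        also have "\<dots> \<le> A * 1" using cd_le by (intro mult_left_mono) (auto simp: A_def)
        finally have "\<bar>x - d * v\<bar> \<le> A" by simp
        moreover have "\<bar>d * v\<bar> \<le> 1 * A"
          unfolding abs_mult using cd_le v by (intro mult_mono) auto
        ultimately have "\<bar>x\<bar> \<le> 2 * A" by linarith
        with v that show False by auto
      qed
      ultimately show ?thesis by (simp add: f_def)
    qed
    thus "AE z in lborel \<Otimes>\<^sub>M lborel. z \<notin> {-2*A..2*A} \<times> {-A..A} \<longrightarrow>
        (case z of (x, v) \<Rightarrow> f ((x - d * v) / c) v) = 0"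
      by (intro AE_I2) (auto split: prod.splits)
  qed auto
  have slice: "(\<integral>y. f (c * x - d * y) (d * x + c * y) \<partial>lborel) =
      ball_ft (Suc n) (s - x\<^sup>2) \<xi> * cos (2 * pi * \<eta> * x)" for x
  proof -
    have feq: "f (c * x - d * y) (d * x + c * y) =
        ball_vol n ((s - x\<^sup>2) - y\<^sup>2) * cos (2 * pi * \<xi> * y) * cos (2 * pi * \<eta> * x) -
        ball_vol n ((s - x\<^sup>2) - y\<^sup>2) * sin (2 * pi * \<xi> * y) * sin (2 * pi * \<eta> * x)" for y
    proof -
      have "(d * x + c * y)\<^sup>2 + (c * x - d * y)\<^sup>2 = (c\<^sup>2 + d\<^sup>2) * (x\<^sup>2 + y\<^sup>2)"
        by (simp add: power2_eq_square algebra_simps)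
      hence "s - (d * x + c * y)\<^sup>2 - (c * x - d * y)\<^sup>2 = (s - x\<^sup>2) - y\<^sup>2"
        by (simp add: cd(1))
      moreover have "2 * pi * r * (d * x + c * y) = 2 * pi * \<xi> * y + 2 * pi * \<eta> * x"
        unfolding cd(3,4)[symmetric] by (simp add: algebra_simps)
      ultimately show ?thesis
        by (simp add: f_def cos_add algebra_simps)
    qed
    have odd: "(\<integral>y. ball_vol n ((s - x\<^sup>2) - y\<^sup>2) * sin (2 * pi * \<xi> * y) \<partial>lborel) = 0" (is "?I = 0")
    proof -
      have "?I = (\<integral>y. ball_vol n ((s - x\<^sup>2) - (-y)\<^sup>2) * sin (2 * pi * \<xi> * (-y)) \<partial>lborel)"
        by (subst lborel_integral_real_affine[where c = "-1" and t = 0]) auto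
      also have "\<dots> = - ?I" by simp
      finally show ?thesis by simp
    qed
    show ?thesis
      unfolding feq
      by (subst Bochner_Integration.integral_diff)
         (auto simp: integrable_ball_vol_slice odd ball_ft_def)
  qed
  have "(\<integral>x. ball_ft (Suc n) (s - x\<^sup>2) \<xi> * cos (2 * pi * \<eta> * x) \<partial>lborel) = 
      (\<integral>v. (\<integral>u. f u v \<partial>lborel) \<partial>lborel)"
    using integral_rotation[OF h_int cd(1,2)] by (simp add: slice)
  also have "(\<lambda>v. \<integral>u. f u v \<partial>lborel) = (\<lambda>v. ball_vol (Suc n) (s - v\<^sup>2) * cos (2 * pi * r * v))"
    using ball_ft_zero[of n] by (auto simp: f_def ball_ft_def fun_eq_iff)
  finally show ?thesis by (simp add: ball_ft_def r_def)
qed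

section \<open>Decay of the Fourier transform of a ball\<close>

lemma power_over_fact_le_exp: 
  fixes x :: real
  assumes "x \<ge> 0"
  shows "x ^ n / fact n \<le> exp x"
proof -
  have "(\<Sum>i\<in>{n}. inverse (fact i) * x ^ i) \<le> (\<Sum>i. inverse (fact i) * x ^ i)"
    using assms by (intro sum_le_suminf summable_exp) auto
  thus ?thesis by (simp add: exp_def divide_inverse mult_ac scaleR_conv_of_real)
qed

text \<open>
  A power of \<open>t\<close> is absorbed by half of the exponential, at the price of the same power of \<open>1 / x\<close>.
\<close>

lemma sqrt_power_mult_exp_le:
  fixes n :: nat and x t :: real
  assumes x: "x > 0" and t: "t \<ge> 0"
  defines "K \<equiv> 1 + 2 ^ n * fact n"
  shows "sqrt t ^ n * exp (- (x * t)) \<le> K / sqrt x ^ n * exp (- (x * t) / 2)"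
proof -
  have main: "sqrt y ^ n * exp (- y) \<le> K * exp (- y / 2)" if "y \<ge> 0" for y :: real
  proof -
    have "sqrt y ^ n \<le> 1 + y ^ n"
    proof (cases "y \<le> 1")
      case True
      have "sqrt y ^ n \<le> 1" using True that by (intro power_le_one) auto
      thus ?thesis using that by (simp add: add_increasing2)
    next
      case False
      hence "sqrt y * 1 \<le> sqrt y * sqrt y" by (intro mult_left_mono) auto
      hence "sqrt y ^ n \<le> y ^ n" using False by (intro power_mono) auto
      thus ?thesis by simp
    qed
    also have "y ^ n = 2 ^ n * fact n * ((y / 2) ^ n / fact n)"
      by (simp add: power_divide)
    also have "\<dots> \<le> 2 ^ n * fact n * exp (y / 2)"
      using power_over_fact_le_exp[of "y / 2" n] that by (intro mult_left_mono) auto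
    also have "1 + 2 ^ n * fact n * exp (y / 2) \<le> K * exp (y / 2)"
      using that by (simp add: K_def algebra_simps)
    finally have "sqrt y ^ n * exp (- y) \<le> K * exp (y / 2) * exp (- y)"
      by (auto intro: mult_right_mono)
    also have "\<dots> = K * exp (- y / 2)" by (simp add: mult.assoc exp_add[symmetric])
    finally show ?thesis .
  qed
  have "sqrt (x * t) ^ n * exp (- (x * t)) \<le> K * exp (- (x * t) / 2)"
    using x t by (intro main) auto
  thus ?thesis using x by (simp add: real_sqrt_mult power_mult_distrib field_simps)
qed

text \<open>
  The end points \<open>-1\<close> and \<open>1\<close> of the contour below are zeros of the radicand \<open>1 - z\<^sup>2\<close>, so
  continuity of the square root is needed at 0 as well, where it is not differentiable.
\<close>

lemma continuous_on_csqrt_right_halfplane: "continuous_on {z. Re z \<ge> 0} csqrt"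
  unfolding continuous_on_eq_continuous_within
proof
  fix z assume z: "z \<in> {z. Re z \<ge> 0}"
  show "continuous (at z within {z. Re z \<ge> 0}) csqrt"
  proof (cases "z = 0")
    case True
    have "((\<lambda>w. sqrt (norm w)) \<longlongrightarrow> sqrt (norm (0::complex))) (at 0 within {z. Re z \<ge> 0})"
      by (intro tendsto_intros)
    hence "((\<lambda>w. norm (csqrt w)) \<longlongrightarrow> 0) (at 0 within {z. Re z \<ge> 0})"
      by (simp add: norm_csqrt)
    hence "(csqrt \<longlongrightarrow> 0) (at 0 within {z. Re z \<ge> 0})"
      by (rule tendsto_norm_zero_cancel)
    thus ?thesis using True by (simp add: continuous_within)
  next
    case False
    hence "z \<notin> \<real>\<^sub>\<le>\<^sub>0" using z by (auto simp: complex_nonpos_Reals_iff complex_eq_iff)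
    thus ?thesis by (rule continuous_within_csqrt)
  qed
qed

lemma integral_segment_primitive:
  fixes G f :: "complex \<Rightarrow> complex"
  assumes G: "\<And>z. z \<in> U \<Longrightarrow> (G has_field_derivative f z) (at z within U)"
    and path: "\<And>t. t \<in> {a..b} \<Longrightarrow> p + of_real t * v \<in> U" and "a \<le> b"
  shows "((\<lambda>t. v * f (p + of_real t * v)) has_integral
           (G (p + of_real b * v) - G (p + of_real a * v))) {a..b}"
proof (rule fundamental_theorem_of_calculus[OF \<open>a \<le> b\<close>, where f = "\<lambda>t. G (p + of_real t * v)"])
  fix t assume t: "t \<in> {a..b}"
  define \<gamma> where "\<gamma> = (\<lambda>t. p + of_real t * v)"
  have "(\<gamma> has_vector_derivative v) (at t within {a..b})"
    unfolding \<gamma>_def by (auto intro!: derivative_eq_intros)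
  moreover have "(G has_field_derivative f (\<gamma> t)) (at (\<gamma> t) within \<gamma> ` {a..b})"
    using t path by (intro DERIV_subset[OF G]) (auto simp: \<gamma>_def)
  ultimately have "((G \<circ> \<gamma>) has_vector_derivative (v * f (\<gamma> t))) (at t within {a..b})"
    by (rule field_vector_diff_chain_within)
  thus "((\<lambda>t. G (p + of_real t * v)) has_vector_derivative v * f (p + of_real t * v)) (at t within {a..b})"
    by (simp add: \<gamma>_def o_def)
qed

text \<open>
  The function \<open>csqrt (1 - z\<^sup>2)^n exp (i x z)\<close> is holomorphic inside the rectangle over \<open>[-1, 1]\<close> of
  height 1 and continuous on its boundary, so it has a primitive there and the integral over the bottom
  side can be replaced by integrals over the other three sides. On these the exponential decays: the top
  side contributes an exponentially small amount, and on the vertical sides, at height \<open>t\<close> over the end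
  points, the root has size at most \<open>sqrt (3 t)\<close>, so the decay is determined by the integral of
  \<open>t^(n/2) exp (- x t)\<close>.
\<close>

lemma fourier_semicircle_power_bound:
  fixes n :: nat and x :: real
  assumes x: "x > 0"
  defines "K \<equiv> 1 + 2 ^ n * fact n"
  shows "\<exists>I. ((\<lambda>t. of_real (sqrt (1 - t\<^sup>2) ^ n) * exp (\<i> * of_real (x * t))) has_integral I) {-1..1} \<and>
             norm I \<le> 8 * sqrt 3 ^ n * K / (x * sqrt x ^ n)"
proof -
  define f where "f = (\<lambda>z. csqrt (1 - z\<^sup>2) ^ n * exp (\<i> * of_real x * z))"
  define U where "U = cbox (-1) (1 + \<i>)"
  have U_iff: "z \<in> U \<longleftrightarrow> \<bar>Re z\<bar> \<le> 1 \<and> Im z \<in> {0..1}" for z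
    by (auto simp: U_def in_cbox_complex_iff abs_le_iff)
  have Re_eq: "Re (1 - z\<^sup>2) = 1 - (Re z)\<^sup>2 + (Im z)\<^sup>2" for z
    by (simp add: power2_eq_square)
  have "continuous_on U f"
    unfolding f_def
  proof (intro continuous_intros continuous_on_compose2[OF continuous_on_csqrt_right_halfplane])
    show "(\<lambda>z. 1 - z\<^sup>2) ` U \<subseteq> {z. Re z \<ge> 0}"
      by (auto simp: U_iff Re_eq abs_square_le_1 intro!: add_nonneg_nonneg simp del: minus_complex.sel)
  qed
  moreover have "f holomorphic_on interior U"
    unfolding f_def
  proof (intro holomorphic_intros)
    fix z assume "z \<in> interior U"
    hence "z \<in> box (-1) (1 + \<i>)" by (simp add: U_def interior_cbox)
    hence "\<bar>Re z\<bar> < 1" by (auto simp: in_box_complex_iff abs_less_iff)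
    hence "(Re z)\<^sup>2 < 1" by (simp add: abs_square_less_1)
    hence "Re (1 - z\<^sup>2) > 0" unfolding Re_eq by (intro add_pos_nonneg) auto
    thus "1 - z\<^sup>2 \<notin> \<real>\<^sub>\<le>\<^sub>0" by (auto simp: complex_nonpos_Reals_iff)
  qed
  ultimately obtain G where G: "\<And>z. z \<in> U \<Longrightarrow> (G has_field_derivative f z) (at z within U)"
    using holomorphic_convex_primitive[of U "{}" f] holomorphic_on_imp_differentiable_at[of f "interior U"]
    by (auto simp: U_def)
  have norm_f: "norm (f z) = sqrt (norm (1 - z\<^sup>2)) ^ n * exp (- (x * Im z))" for z
    by (simp add: f_def norm_mult norm_power norm_csqrt)
  have bottom: "((\<lambda>t. 1 * f (0 + of_real t * 1)) has_integral (G (0 + of_real 1 * 1) - G (0 + of_real (-1) * 1))) {-1..1}"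
    by (rule integral_segment_primitive[OF G]) (auto simp: U_iff)
  have top: "((\<lambda>t. 1 * f (\<i> + of_real t * 1)) has_integral (G (\<i> + of_real 1 * 1) - G (\<i> + of_real (-1) * 1))) {-1..1}"
    by (rule integral_segment_primitive[OF G]) (auto simp: U_iff)
  have side: "((\<lambda>t. \<i> * f (c + of_real t * \<i>)) has_integral (G (c + of_real 1 * \<i>) - G (c + of_real 0 * \<i>))) {0..1}"
    if "c \<in> {-1, 1}" for c
    by (rule integral_segment_primitive[OF G]) (use that in \<open>auto simp: U_iff\<close>)
  define B where "B = sqrt 3 ^ n * K / sqrt x ^ n"
  have K: "K > 0" by (auto simp: K_def intro!: add_pos_pos)
  have B: "B > 0" using x K by (simp add: B_def)
  have exp_le: "exp (- x / 2) \<le> 2 / x"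
  proof -
    have "x / 2 \<le> exp (x / 2)" using exp_ge_add_one_self[of "x / 2"] by linarith
    thus ?thesis using x by (simp add: exp_minus field_simps)
  qed
  have top_le: "norm (G (\<i> + of_real 1 * 1) - G (\<i> + of_real (-1) * 1)) \<le> B * (2 / x) * 2"
  proof -
    have "norm (G (\<i> + of_real 1 * 1) - G (\<i> + of_real (-1) * 1)) \<le> (B * (2 / x)) * measure lborel (cbox (-1) (1::real))"
    proof (rule has_integral_bound[OF _ top[folded box_real(2)]])
      fix t :: real assume t: "t \<in> cbox (-1) 1"
      have "norm (1 - (\<i> + of_real t)\<^sup>2) \<le> 1 + norm (\<i> + of_real t) ^ 2"
        using norm_triangle_ineq4[of 1 "(\<i> + of_real t)\<^sup>2"] by (simp add: norm_power)
      also have "norm (\<i> + of_real t) ^ 2 = 1 + t\<^sup>2" 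
        by (simp add: cmod_power2)
      also have "1 + (1 + t\<^sup>2) \<le> 3" using t abs_square_le_1[of t] by (auto simp: abs_le_iff)
      finally have "norm (f (\<i> + of_real t)) \<le> sqrt 3 ^ n * (sqrt 1 ^ n * exp (- (x * 1)))"
        unfolding norm_f by (intro mult_mono power_mono) auto
      also have "\<dots> \<le> sqrt 3 ^ n * (K / sqrt x ^ n * exp (- (x * 1) / 2))"
        unfolding K_def by (intro mult_left_mono sqrt_power_mult_exp_le x) auto
      also have "\<dots> = B * exp (- x / 2)" by (simp add: B_def)
      also have "\<dots> \<le> B * (2 / x)" using exp_le B by (intro mult_left_mono) auto
      finally show "norm (1 * f (\<i> + of_real t * 1)) \<le> B * (2 / x)" by simp
    qed (use x B in auto)
    thus ?thesis by simp
  qed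
  have exp_int: "((\<lambda>t. B * exp (- (x * t) / 2)) has_integral (B * (- 2 / x * exp (-(x*1) / 2)) - B * (- 2 / x * exp (-(x*0)/2)))) {0..1}"
    by (rule fundamental_theorem_of_calculus)
       (use x in \<open>auto intro!: derivative_eq_intros simp flip: has_real_derivative_iff_has_vector_derivative\<close>)
  have side_le: "norm (G (c + of_real 1 * \<i>) - G (c + of_real 0 * \<i>)) \<le> B * (2 / x)" if c: "c \<in> {-1, 1}" for c
  proof -
    have "norm (integral {0..1} (\<lambda>t. \<i> * f (c + of_real t * \<i>))) \<le> integral {0..1} (\<lambda>t. B * exp (- (x * t) / 2))"
    proof (rule integral_norm_bound_integral)
      fix t :: real assume t: "t \<in> {0..1}"
      have "1 - (c + of_real t * \<i>)\<^sup>2 = of_real (t\<^sup>2) - 2 * c * of_real t * \<i>"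
        using c by (auto simp: power2_eq_square algebra_simps)
      also have "norm \<dots> \<le> t\<^sup>2 + 2 * t"
        using norm_triangle_ineq4[of "of_real (t\<^sup>2)" "2 * c * of_real t * \<i>"] c t
        by (auto simp: norm_mult norm_power)
      also have "\<dots> \<le> 3 * t"
        using mult_left_mono[of t 1 t] t by (simp add: power2_eq_square)
      finally have "norm (f (c + of_real t * \<i>)) \<le> sqrt (3 * t) ^ n * exp (- (x * t))"
        unfolding norm_f using c t by (intro mult_mono power_mono) auto
      also have "\<dots> = sqrt 3 ^ n * (sqrt t ^ n * exp (- (x * t)))"
        by (simp add: real_sqrt_mult power_mult_distrib)
      also have "\<dots> \<le> sqrt 3 ^ n * (K / sqrt x ^ n * exp (- (x * t) / 2))"
        unfolding K_def using t by (intro mult_left_mono sqrt_power_mult_exp_le x) auto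
      finally show "norm (\<i> * f (c + of_real t * \<i>)) \<le> B * exp (- (x * t) / 2)"
        by (simp add: B_def norm_mult)
    qed (use side[OF c] exp_int in \<open>auto simp: has_integral_iff\<close>)
    also have "integral {0..1} (\<lambda>t. B * exp (- (x * t) / 2)) = B * (2 / x) * (1 - exp (- x / 2))"
      using integral_unique[OF exp_int] by (simp add: algebra_simps)
    also have "\<dots> \<le> B * (2 / x) * 1"
      using B x by (intro mult_left_mono) auto
    finally show ?thesis using integral_unique[OF side[OF c]] by simp
  qed
  define I where "I = G 1 - G (-1)"
  have "I = (G (\<i> + of_real 1 * 1) - G (\<i> + of_real (-1) * 1)) - (G (1 + of_real 1 * \<i>) - G (1 + of_real 0 * \<i>))
            + (G ((-1) + of_real 1 * \<i>) - G ((-1) + of_real 0 * \<i>))"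
    by (simp add: I_def add_ac)
  also have "norm \<dots> \<le> B * (2 / x) * 2 + B * (2 / x) + B * (2 / x)"
    by (intro norm_triangle_le norm_triangle_le_diff add_mono top_le side_le) auto
  also have "\<dots> = 8 * sqrt 3 ^ n * K / (x * sqrt x ^ n)"
    by (simp add: B_def)
  finally have "norm I \<le> 8 * sqrt 3 ^ n * K / (x * sqrt x ^ n)" .
  moreover have "((\<lambda>t. of_real (sqrt (1 - t\<^sup>2) ^ n) * exp (\<i> * of_real (x * t))) has_integral I) {-1..1}"
  proof (rule has_integral_eq)
    show "((\<lambda>t. 1 * f (0 + of_real t * 1)) has_integral I) {-1..1}"
      using bottom by (simp add: I_def)
    fix t :: real assume "t \<in> {-1..1}"
    hence "1 - t\<^sup>2 \<ge> 0" using abs_square_le_1[of t] by (auto simp: abs_le_iff)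
    moreover have "1 - (of_real t)\<^sup>2 = complex_of_real (1 - t\<^sup>2)" by simp
    ultimately have "csqrt (1 - (of_real t)\<^sup>2) = of_real (sqrt (1 - t\<^sup>2))"
      by (simp only: csqrt_of_real)
    thus "1 * f (0 + of_real t * 1) = of_real (sqrt (1 - t\<^sup>2) ^ n) * exp (\<i> * of_real (x * t))"
      by (simp add: f_def mult_ac)
  qed
  ultimately show ?thesis by blast
qed

lemma ball_ft_unit_decay:
  "\<exists>C\<ge>0. \<forall>\<xi>>0. \<bar>ball_ft (Suc n) 1 \<xi>\<bar> \<le> C / (\<xi> * sqrt \<xi> ^ n)"
proof -
  define D where "D = unit_ball_vol (real n) * (8 * sqrt 3 ^ n * (1 + 2 ^ n * fact n))"
  define C where "C = D / (2 * pi * sqrt (2 * pi) ^ n)"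
  have "\<bar>ball_ft (Suc n) 1 \<xi>\<bar> \<le> C / (\<xi> * sqrt \<xi> ^ n)" if \<xi>: "\<xi> > 0" for \<xi>
  proof -
    define x where "x = 2 * pi * \<xi>"
    have x: "x > 0" using \<xi> by (simp add: x_def)
    obtain I where I: "((\<lambda>t. of_real (sqrt (1 - t\<^sup>2) ^ n) * exp (\<i> * of_real (x * t))) has_integral I) {-1..1}"
      "norm I \<le> 8 * sqrt 3 ^ n * (1 + 2 ^ n * fact n) / (x * sqrt x ^ n)"
      using fourier_semicircle_power_bound[OF x, of n] by blast
    have "((\<lambda>t. Re (of_real (sqrt (1 - t\<^sup>2) ^ n) * exp (\<i> * of_real (x * t)))) has_integral Re I) {-1..1}"
      using has_integral_linear[OF I(1) bounded_linear_Re] by (simp add: o_def)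
    hence "((\<lambda>t. sqrt (1 - t\<^sup>2) ^ n * cos (x * t)) has_integral Re I) {-1..1}"
      by (simp add: Re_exp)
    hence "((\<lambda>t. unit_ball_vol (real n) * (sqrt (1 - t\<^sup>2) ^ n * cos (x * t))) has_integral unit_ball_vol (real n) * Re I) {-1..1}"
      by (rule has_integral_mult_right)
    hence 1: "((\<lambda>t. ball_vol n (1 - t\<^sup>2) * cos (2 * pi * \<xi> * t)) has_integral unit_ball_vol (real n) * Re I) {-1..1}"
    proof (rule has_integral_spike_finite[where S = "{-1, 1}", rotated 2])
      fix t :: real assume "t \<in> {-1..1} - {-1, 1}"
      hence "t\<^sup>2 < 1" by (auto simp: abs_square_less_1 abs_less_iff)
      thus "ball_vol n (1 - t\<^sup>2) * cos (2 * pi * \<xi> * t) = unit_ball_vol (real n) * (sqrt (1 - t\<^sup>2) ^ n * cos (x * t))"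
        by (simp add: ball_vol_def x_def)
    qed auto
    have "((\<lambda>t. ball_vol n (1 - t\<^sup>2) * cos (2 * pi * \<xi> * t)) has_integral ball_ft (Suc n) 1 \<xi>) UNIV"
      unfolding ball_ft_def diff_Suc_1
      by (intro has_integral_integral_lborel integrable_ball_vol_slice) auto
    moreover have "((\<lambda>t. ball_vol n (1 - t\<^sup>2) * cos (2 * pi * \<xi> * t)) has_integral unit_ball_vol (real n) * Re I) UNIV"
      by (rule has_integral_on_superset[OF 1]) (auto simp: ball_vol_slice_support[of 1 1])
    ultimately have "ball_ft (Suc n) 1 \<xi> = unit_ball_vol (real n) * Re I"
      by (rule has_integral_unique)
    also have "\<bar>\<dots>\<bar> \<le> unit_ball_vol (real n) * (8 * sqrt 3 ^ n * (1 + 2 ^ n * fact n) / (x * sqrt x ^ n))"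
      unfolding abs_mult using abs_Re_le_cmod[of I] I(2) by (intro mult_mono) auto
    also have "\<dots> = C / (\<xi> * sqrt \<xi> ^ n)"
      by (simp add: C_def D_def x_def real_sqrt_mult power_mult_distrib mult_ac)
    finally show ?thesis .
  qed
  moreover have "C \<ge> 0" by (simp add: C_def D_def)
  ultimately show ?thesis by blast
qed

text \<open>
  Scaling turns the estimate for radius 1 into one for all radii; the power of \<open>s\<close> is what remains of
  \<open>sqrt s^(n+1)\<close> after the decay in \<open>sqrt s * \<xi>\<close> has been used.
\<close>

lemma ball_ft_decay:
  "\<exists>C\<ge>0. \<forall>s. \<forall>\<xi>>0. \<bar>ball_ft (Suc n) s \<xi>\<bar> \<le> C * s powr (real n / 4) * \<xi> powr (- (real n / 2 + 1))"
proof -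
  obtain C where C: "C \<ge> 0" "\<And>\<xi>. \<xi> > 0 \<Longrightarrow> \<bar>ball_ft (Suc n) 1 \<xi>\<bar> \<le> C / (\<xi> * sqrt \<xi> ^ n)"
    using ball_ft_unit_decay[of n] by blast
  have "\<bar>ball_ft (Suc n) s \<xi>\<bar> \<le> C * s powr (real n / 4) * \<xi> powr (- (real n / 2 + 1))" if \<xi>: "\<xi> > 0" for s \<xi>
  proof (cases "s > 0")
    case True
    have pw: "sqrt y ^ n = y powr (real n / 2)" if "y > 0" for y
      using that by (simp add: powr_half_sqrt[symmetric] powr_powr flip: powr_realpow)
    have "\<bar>ball_ft (Suc n) s \<xi>\<bar> = sqrt s ^ Suc n * \<bar>ball_ft (Suc n) 1 (sqrt s * \<xi>)\<bar>"
      using ball_ft_scale[OF True, of n \<xi>] True by (simp add: abs_mult)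
    also have "\<dots> \<le> sqrt s ^ Suc n * (C / (sqrt s * \<xi> * sqrt (sqrt s * \<xi>) ^ n))"
      using True \<xi> by (intro mult_left_mono C) auto
    also have "\<dots> = C * (sqrt s ^ n / sqrt (sqrt s) ^ n) / (\<xi> * sqrt \<xi> ^ n)"
      using True \<xi> by (simp add: real_sqrt_mult power_mult_distrib mult_ac)
    also have "sqrt s ^ n / sqrt (sqrt s) ^ n = s powr (real n / 4)"
    proof -
      have "sqrt (sqrt s) ^ n = s powr (real n / 4)"
        using True by (subst pw) (auto simp: powr_half_sqrt[symmetric] powr_powr)
      thus ?thesis using True by (simp add: pw flip: powr_diff)
    qed
    also have "\<xi> * sqrt \<xi> ^ n = \<xi> powr (real n / 2 + 1)"
      using \<xi> by (simp add: pw powr_add)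
    finally show ?thesis by (simp only: powr_minus divide_inverse)
  qed (use C in auto)
  with C(1) show ?thesis by blast
qed

section \<open>Poisson summation on the line\<close>

text \<open>
  The Fejer kernel, written as a double sum so that integrating a function against it produces averages
  of its Fourier coefficients, and so that it is visibly a squared modulus.
\<close>

definition fejer :: "nat \<Rightarrow> real \<Rightarrow> real" where
  "fejer M u = (\<Sum>i<M. \<Sum>j<M. cos (2 * pi * of_int (int i - int j) * u)) / M"

lemma fejer_eq_norm: "fejer M u = (norm (\<Sum>j<M. cis (2 * pi * u) ^ j))\<^sup>2 / M"
proof -
  have z: "cis (2 * pi * u) ^ j = cis (2 * pi * u * j)" for j
    by (simp add: Complex.DeMoivre mult_ac)
  have "(norm (\<Sum>j<M. cis (2 * pi * u) ^ j))\<^sup>2 =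
      (\<Sum>j<M. cos (2 * pi * u * j))\<^sup>2 + (\<Sum>j<M. sin (2 * pi * u * j))\<^sup>2"
    unfolding cmod_power2 z by simp
  also have "\<dots> = (\<Sum>i<M. \<Sum>j<M. cos (2 * pi * u * i - 2 * pi * u * j))"
    unfolding power2_eq_square sum_product cos_diff by (simp add: sum.distrib)
  also have "\<dots> = (\<Sum>i<M. \<Sum>j<M. cos (2 * pi * of_int (int i - int j) * u))"
    by (simp add: algebra_simps)
  finally show ?thesis by (simp add: fejer_def)
qed

lemma fejer_nonneg: "fejer M u \<ge> 0"
  by (simp add: fejer_eq_norm)

text \<open>
  Away from the integers the geometric sum is bounded independently of its length.
\<close>

lemma fejer_le:
  assumes "sin (pi * u) \<noteq> 0"
  shows "fejer M u \<le> 1 / (M * (sin (pi * u))\<^sup>2)"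
proof -
  define z where "z = cis (2 * pi * u)"
  have "(norm (z - 1))\<^sup>2 = (cos (2 * pi * u) - 1)\<^sup>2 + (sin (2 * pi * u))\<^sup>2"
    by (simp add: z_def cmod_power2)
  also have "\<dots> = 2 - 2 * cos (2 * pi * u)"
    using sin_cos_squared_add[of "2 * pi * u"] by (simp add: power2_diff)
  also have "cos (2 * pi * u) = 1 - 2 * (sin (pi * u))\<^sup>2"
    using cos_double_sin[of "pi * u"] by (simp add: mult_ac)
  finally have "(norm (z - 1))\<^sup>2 = 4 * (sin (pi * u))\<^sup>2"
    by simp
  moreover have "norm (z - 1) * norm (\<Sum>j<M. z ^ j) = norm (z ^ M - 1)"
    by (simp add: power_diff_1_eq norm_mult)
  moreover have "norm (z ^ M - 1) \<le> 2"
    using norm_triangle_ineq4[of "z ^ M" 1] by (simp add: z_def norm_power)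
  ultimately have "4 * (sin (pi * u))\<^sup>2 * (norm (\<Sum>j<M. z ^ j))\<^sup>2 \<le> 2\<^sup>2"
    using power_mono[of "norm (z ^ M - 1)" 2 2] by (metis norm_ge_zero power_mult_distrib)
  hence "(norm (\<Sum>j<M. z ^ j))\<^sup>2 \<le> 1 / (sin (pi * u))\<^sup>2"
    using assms by (simp add: field_simps)
  hence "(norm (\<Sum>j<M. z ^ j))\<^sup>2 / M \<le> 1 / (sin (pi * u))\<^sup>2 / M"
    by (rule divide_right_mono) auto
  thus ?thesis by (simp add: fejer_eq_norm z_def mult.commute)
qed

lemma fejer_continuous [continuous_intros]: "continuous_on A (fejer M)"
  unfolding fejer_def by (cases "M = 0") (auto intro!: continuous_intros)

lemma fejer_periodic: "fejer M (of_int n + u) = fejer M u"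
proof -
  have "cis (2 * pi * (of_int n + u)) = cis (2 * pi * u)"
    using cis_multiple_2pi[of "of_int n"] by (simp add: distrib_left flip: cis_mult)
  thus ?thesis by (simp add: fejer_eq_norm)
qed

lemma cos_has_integral_period:
  "((\<lambda>u. cos (2 * pi * of_int m * u)) has_integral (if m = 0 then 1 else 0)) {-1/2..1/2::real}"
proof (cases "m = 0")
  case True
  thus ?thesis using has_integral_const_real[of "1::real" "-1/2" "1/2"] by simp
next
  case False
  have "((\<lambda>u. cos (2 * pi * of_int m * u)) has_integral
     (sin (2 * pi * of_int m * (1/2)) / (2 * pi * of_int m) - sin (2 * pi * of_int m * (-1/2)) / (2 * pi * of_int m))) {-1/2..1/2::real}"
    by (rule fundamental_theorem_of_calculus)
       (use False in \<open>auto intro!: derivative_eq_intros simp flip: has_real_derivative_iff_has_vector_derivative\<close>)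
  moreover have "sin (pi * of_int m) = 0"
    using sin_zero_iff_int2 by (auto simp: mult.commute)
  ultimately show ?thesis using False by simp
qed

lemma fejer_has_integral: "M > 0 \<Longrightarrow> (fejer M has_integral 1) {-1/2..1/2}"
proof -
  assume "M > 0"
  have "((\<lambda>u. (\<Sum>i<M. \<Sum>j<M. cos (2 * pi * of_int (int i - int j) * u)) / M) has_integral
          (\<Sum>i<M. \<Sum>j<M. if int i - int j = 0 then 1 else 0) / M) {-1/2..1/2}"
    by (intro has_integral_divide has_integral_sum cos_has_integral_period) auto
  also have "(\<Sum>i<M. \<Sum>j<M. if int i - int j = 0 then 1 else (0::real)) = M"
    by (simp add: sum.delta)
  finally show ?thesis using \<open>M > 0\<close> by (simp add: fejer_def[abs_def])
qed

text \<open>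
  The kernel is nonnegative with integral 1 and tends to 0 uniformly outside every neighbourhood of 0.
\<close>

lemma fejer_approximate_identity:
  fixes q :: "real \<Rightarrow> real"
  assumes q: "continuous_on {-1/2..1/2} q"
  shows "(\<lambda>M. integral {-1/2..1/2} (\<lambda>u. q u * fejer M u)) \<longlonglongrightarrow> q 0"
proof (rule LIMSEQ_I)
  fix e :: real assume e: "e > 0"
  obtain Q where Q: "\<And>u. u \<in> {-1/2..1/2} \<Longrightarrow> norm (q u) \<le> Q" "Q \<ge> 0"
    using continuous_on_compact_bound[OF compact_Icc q] by metis
  have "\<exists>d>0. \<forall>u\<in>{-1/2..1/2}. dist u 0 < d \<longrightarrow> dist (q u) (q 0) < e / 2"
    using q[unfolded continuous_on_iff, rule_format, of 0 "e / 2"] e by simp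
  then obtain d where d: "d > 0" "\<And>u. u \<in> {-1/2..1/2} \<Longrightarrow> \<bar>u\<bar> < d \<Longrightarrow> \<bar>q u - q 0\<bar> < e / 2"
    by (auto simp: dist_real_def)
  define d' where "d' = min d (1/2)"
  have d': "d' > 0" "d' \<le> 1/2" "d' \<le> d" using d(1) by (auto simp: d'_def)
  define \<sigma> where "\<sigma> = (sin (pi * d'))\<^sup>2"
  have sin_pos: "sin (pi * d') > 0"
    using d' by (intro sin_gt_zero) (auto simp: field_simps)
  hence \<sigma>: "\<sigma> > 0" by (simp add: \<sigma>_def)
  obtain M0 :: nat where M0: "real M0 > 4 * Q / (\<sigma> * e)"
    using reals_Archimedean2 by blast
  show "\<exists>M0. \<forall>M\<ge>M0. norm (integral {-1/2..1/2} (\<lambda>u. q u * fejer M u) - q 0) < e"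
  proof (intro exI[of _ "Suc M0"] allI impI)
    fix M :: nat assume M: "M \<ge> Suc M0"
    hence Mpos: "M > 0" by simp
    define E where "E = 2 * Q / (M * \<sigma>)"
    have pw: "norm ((q u - q 0) * fejer M u) \<le> e / 2 * fejer M u + E" if u: "u \<in> {-1/2..1/2}" for u
    proof (cases "\<bar>u\<bar> < d'")
      case True
      hence "\<bar>q u - q 0\<bar> \<le> e / 2" using d(2)[of u] u d' by force
      hence "\<bar>q u - q 0\<bar> * fejer M u \<le> e / 2 * fejer M u"
        using fejer_nonneg by (intro mult_right_mono) auto
      moreover have "E \<ge> 0" using Q \<sigma> by (simp add: E_def)
      ultimately show ?thesis using fejer_nonneg[of M u] by (simp add: abs_mult)
    next
      case False
      have "pi * d' \<le> pi * \<bar>u\<bar>" "pi * \<bar>u\<bar> \<le> pi / 2"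
        using False u by (auto simp: abs_le_iff)
      hence "sin (pi * d') \<le> sin (pi * \<bar>u\<bar>)"
        using d' by (intro sin_monotone_2pi_le) (auto intro: order_trans[of _ 0])
      hence "sin (pi * d') \<le> \<bar>sin (pi * u)\<bar>" by (cases "u \<ge> 0") auto
      hence sq: "\<sigma> \<le> (sin (pi * u))\<^sup>2" and nz: "sin (pi * u) \<noteq> 0"
        using power_mono[of "sin (pi * d')" "\<bar>sin (pi * u)\<bar>" 2] sin_pos by (auto simp: \<sigma>_def)
      have "fejer M u \<le> 1 / (M * (sin (pi * u))\<^sup>2)" by (rule fejer_le[OF nz])
      also have "\<dots> \<le> 1 / (M * \<sigma>)" using sq \<sigma> Mpos nz by (intro divide_left_mono mult_left_mono) auto
      finally have "fejer M u \<le> 1 / (M * \<sigma>)" .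
      moreover have "\<bar>q u - q 0\<bar> \<le> 2 * Q" using Q(1)[OF u] Q(1)[of 0] by auto
      ultimately have "\<bar>q u - q 0\<bar> * fejer M u \<le> 2 * Q * (1 / (M * \<sigma>))"
        using fejer_nonneg Q by (intro mult_mono) auto
      moreover have "e / 2 * fejer M u \<ge> 0" using e fejer_nonneg[of M u] by simp
      moreover have "norm ((q u - q 0) * fejer M u) = \<bar>q u - q 0\<bar> * fejer M u"
        using fejer_nonneg[of M u] by (simp add: abs_mult)
      moreover have "E = 2 * Q * (1 / (M * \<sigma>))" by (simp add: E_def)
      ultimately show ?thesis by linarith
    qed
    have q_int: "(\<lambda>u. q u * fejer M u) integrable_on {-1/2..1/2}" "(\<lambda>u. (q u - q 0) * fejer M u) integrable_on {-1/2..1/2}"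
      by (intro integrable_continuous_real continuous_intros q)+
    have bd: "((\<lambda>u. e / 2 * fejer M u + E) has_integral (e / 2 * 1 + E)) {-1/2..1/2}"
      using has_integral_const_real[of E "-1/2" "1/2"]
      by (intro has_integral_add has_integral_mult_right fejer_has_integral Mpos) auto
    have "((\<lambda>u. q u * fejer M u - q 0 * fejer M u) has_integral
        (integral {-1/2..1/2} (\<lambda>u. q u * fejer M u) - q 0 * 1)) {-1/2..1/2}"
      by (intro has_integral_diff integrable_integral q_int has_integral_mult_right fejer_has_integral Mpos)
    hence diff: "((\<lambda>u. (q u - q 0) * fejer M u) has_integral
        (integral {-1/2..1/2} (\<lambda>u. q u * fejer M u) - q 0)) {-1/2..1/2}"
      by (simp add: left_diff_distrib)
    have "norm (integral {-1/2..1/2} (\<lambda>u. (q u - q 0) * fejer M u)) \<le> integral {-1/2..1/2} (\<lambda>u. e / 2 * fejer M u + E)"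
      by (rule integral_norm_bound_integral[OF q_int(2) has_integral_integrable[OF bd] pw])
    hence "norm (integral {-1/2..1/2} (\<lambda>u. q u * fejer M u) - q 0) \<le> integral {-1/2..1/2} (\<lambda>u. e / 2 * fejer M u + E)"
      unfolding integral_unique[OF diff] .
    also have "\<dots> = e / 2 + E" using integral_unique[OF bd] by simp
    also have "E < e / 2"
    proof -
      have "4 * Q < M0 * (\<sigma> * e)" using M0 \<sigma> e by (simp add: field_simps)
      also have "\<dots> \<le> M * (\<sigma> * e)" using M \<sigma> e by (intro mult_right_mono) auto
      finally show ?thesis using \<sigma> Mpos by (simp add: E_def field_simps)
    qed
    finally show "norm (integral {-1/2..1/2} (\<lambda>u. q u * fejer M u) - q 0) < e" by simp
  qed
qed

lemma cesaro_means:
  fixes b :: "nat \<Rightarrow> real"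
  assumes "b \<longlonglongrightarrow> L"
  shows "(\<lambda>M. (\<Sum>k<M. b k) / M) \<longlonglongrightarrow> L"
proof (rule LIMSEQ_I)
  fix e :: real assume e: "e > 0"
  obtain K where K: "\<And>k. k \<ge> K \<Longrightarrow> \<bar>b k - L\<bar> < e / 2"
    using LIMSEQ_D[OF assms, of "e / 2"] e by auto
  define P where "P = (\<Sum>k<K. \<bar>b k - L\<bar>)"
  obtain M0 :: nat where M0: "real M0 > 2 * P / e"
    using reals_Archimedean2 by blast
  show "\<exists>M0. \<forall>M\<ge>M0. norm ((\<Sum>k<M. b k) / M - L) < e"
  proof (intro exI[of _ "Suc (max M0 K)"] allI impI)
    fix M assume M: "M \<ge> Suc (max M0 K)"
    have "(\<Sum>k<M. \<bar>b k - L\<bar>) = P + (\<Sum>k\<in>{K..<M}. \<bar>b k - L\<bar>)"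
    proof -
      have "{..<M} = {..<K} \<union> {K..<M}" using M by auto
      moreover have "{..<K} \<inter> {K..<M} = {}" by auto
      ultimately show ?thesis by (simp add: P_def sum.union_disjoint)
    qed
    also have "(\<Sum>k\<in>{K..<M}. \<bar>b k - L\<bar>) \<le> (\<Sum>k\<in>{K..<M}. e / 2)"
      using K by (intro sum_mono) (auto intro: less_imp_le)
    also have "\<dots> \<le> M * (e / 2)" using e by simp
    also have "P < M * (e / 2)"
    proof -
      have "P < M0 * (e / 2)" using M0 e by (simp add: field_simps)
      also have "\<dots> \<le> M * (e / 2)" using M e by (intro mult_right_mono) auto
      finally show ?thesis .
    qed
    finally have "(\<Sum>k<M. \<bar>b k - L\<bar>) < M * e" by (simp add: mult.commute)
    moreover have "\<bar>\<Sum>k<M. b k - L\<bar> \<le> (\<Sum>k<M. \<bar>b k - L\<bar>)" by (rule sum_abs)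
    ultimately have "\<bar>\<Sum>k<M. b k - L\<bar> < M * e" by linarith
    hence "\<bar>(\<Sum>k<M. b k - L) / M\<bar> < e"
      using M by (simp add: pos_divide_less_eq mult.commute)
    moreover have "(\<Sum>k<M. b k) / M - L = (\<Sum>k<M. b k - L) / M"
      using M by (simp add: sum_subtractf field_simps)
    ultimately have "\<bar>(\<Sum>k<M. b k) / M - L\<bar> < e" by simp
    thus "norm ((\<Sum>k<M. b k) / M - L) < e" using M by simp
  qed
qed

text \<open>
  The double sums grow by the symmetric partial sums of \<open>a\<close>: enlarging the index square from \<open>M\<close> to
  \<open>M + 1\<close> adds each difference from \<open>-M\<close> to \<open>M\<close> once. Hence the quotients are arithmetic means of
  the symmetric partial sums.
\<close>

lemma fejer_means_of_summable:
  fixes a :: "int \<Rightarrow> real"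
  assumes "(a has_sum L) UNIV"
  shows "(\<lambda>M. (\<Sum>i<M. \<Sum>j<M. a (int i - int j)) / M) \<longlonglongrightarrow> L"
proof -
  define b where "b = (\<lambda>M::nat. \<Sum>m\<in>{-int M..int M}. a m)"
  have "filterlim (\<lambda>M. {-int M..int M}) (finite_subsets_at_top UNIV) sequentially"
    unfolding filterlim_finite_subsets_at_top
  proof (intro allI impI)
    fix X :: "int set" assume "finite X \<and> X \<subseteq> UNIV"
    hence X: "finite X" by simp
    show "\<forall>\<^sub>F M in sequentially. finite {-int M..int M} \<and> X \<subseteq> {-int M..int M} \<and> {-int M..int M} \<subseteq> UNIV"
    proof (rule eventually_sequentiallyI[of "nat (\<Sum>x\<in>X. \<bar>x\<bar>)"])
      fix M assume M: "M \<ge> nat (\<Sum>x\<in>X. \<bar>x\<bar>)"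
      have "\<bar>x\<bar> \<le> int M" if "x \<in> X" for x
        using member_le_sum[OF that, of abs] X M by auto
      thus "finite {-int M..int M} \<and> X \<subseteq> {-int M..int M} \<and> {-int M..int M} \<subseteq> UNIV"
        by (auto simp: abs_le_iff) (metis minus_le_iff)+
    qed
  qed
  hence "b \<longlonglongrightarrow> L"
    unfolding b_def by (rule filterlim_compose[OF assms[unfolded has_sum_def]])
  moreover have "(\<Sum>i<M. \<Sum>j<M. a (int i - int j)) = (\<Sum>k<M. b k)" for M
  proof (induction M)
    case (Suc M)
    have "(\<Sum>i<Suc M. \<Sum>j<Suc M. a (int i - int j)) =
        (\<Sum>i<M. \<Sum>j<M. a (int i - int j)) + ((\<Sum>i<M. a (int i - int M)) + (\<Sum>j<Suc M. a (int M - int j)))"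
      by (simp add: sum.distrib)
    also have "(\<Sum>i<M. a (int i - int M)) = (\<Sum>m\<in>{-int M..<0}. a m)"
      by (rule sum.reindex_bij_witness[of _ "\<lambda>m. nat (m + int M)" "\<lambda>i. int i - int M"]) auto
    also have "(\<Sum>j<Suc M. a (int M - int j)) = (\<Sum>m\<in>{0..int M}. a m)"
      by (rule sum.reindex_bij_witness[of _ "\<lambda>m. nat (int M - m)" "\<lambda>j. int M - int j"]) auto
    also have "(\<Sum>m\<in>{-int M..<0}. a m) + (\<Sum>m\<in>{0..int M}. a m) = b M"
      unfolding b_def by (subst sum.union_disjoint[symmetric]) (auto intro!: arg_cong[where f = "sum a"])
    finally show ?case using Suc by simp
  qed auto
  ultimately show ?thesis using cesaro_means by simp
qed

lemma integrable_continuous_compact_support: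
  fixes g :: "real \<Rightarrow> real"
  assumes "continuous_on UNIV g" "\<And>x. x \<notin> {a..b} \<Longrightarrow> g x = 0"
  shows "integrable lborel g"
proof -
  obtain B where "\<And>x. x \<in> {a..b} \<Longrightarrow> norm (g x) \<le> B"
    using continuous_on_compact_bound[OF compact_Icc continuous_on_subset[OF assms(1)], of a b] by auto
  thus ?thesis
    using assms by (intro integrableI_bounded_set[where A = "{a..b}" and B = B])
      (auto intro: borel_measurable_continuous_onI simp: emeasure_lborel_Icc_eq)
qed

lemma lborel_integral_eq_integral_support:
  fixes g :: "real \<Rightarrow> real"
  assumes "continuous_on UNIV g" "\<And>x. x \<notin> {a..b} \<Longrightarrow> g x = 0"
  shows "(\<integral>x. g x \<partial>lborel) = integral {a..b} g"
proof -
  have "(g has_integral (\<integral>x. g x \<partial>lborel)) UNIV"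
    by (rule has_integral_integral_lborel[OF integrable_continuous_compact_support[OF assms]])
  hence "((\<lambda>x. if x \<in> {a..b} then g x else 0) has_integral (\<integral>x. g x \<partial>lborel)) UNIV"
    by (rule has_integral_eq[rotated]) (use assms(2) in auto)
  hence "(g has_integral (\<integral>x. g x \<partial>lborel)) {a..b}"
    by (simp only: has_integral_restrict_UNIV)
  thus ?thesis by (simp add: integral_unique)
qed

lemma integral_unit_intervals:
  fixes g :: "real \<Rightarrow> real"
  assumes "continuous_on UNIV g"
  shows "integral {c..c + real j} g = (\<Sum>i<j. integral {0..1} (\<lambda>u. g (c + real i + u)))"
proof (induction j)
  case (Suc j)
  have int: "g integrable_on {x..y}" for x y
    by (intro integrable_continuous_real continuous_on_subset[OF assms]) auto
  have "integral {c..c + real (Suc j)} g = integral {c..c + real j} g + integral {c + real j..c + real (Suc j)} g"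
    by (rule Henstock_Kurzweil_Integration.integral_combine[symmetric]) (auto intro: int)
  moreover have "integral {c + real j..c + real (Suc j)} g = integral {0..1} (\<lambda>u. g (c + real j + u))"
    using has_integral_affinity'[OF integrable_integral[OF int, folded box_real(2)], of 1 "c + real j" "c + real j" "c + real (Suc j)"]
    by (auto dest!: integral_unique simp: add_ac)
  ultimately show ?case using Suc by simp
qed auto

text \<open>
  Integrate \<open>g\<close> against the Fejer kernel. By periodicity of the kernel the integral splits into unit
  intervals around the integers and tends to the sum of the values of \<open>g\<close>; on the other hand it is an
  average of Fourier coefficients and tends to their sum.
\<close>

lemma poisson_summation:
  fixes g :: "real \<Rightarrow> real"
  assumes cont: "continuous_on UNIV g" and supp: "\<And>x. \<bar>x\<bar> > real L \<Longrightarrow> g x = 0"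
    and summ: "(\<lambda>m::int. \<integral>x. g x * cos (2 * pi * of_int m * x) \<partial>lborel) summable_on UNIV"
  shows "((\<lambda>m::int. \<integral>x. g x * cos (2 * pi * of_int m * x) \<partial>lborel) has_sum
            (\<Sum>n\<in>{-int L..int L}. g (of_int n))) UNIV"
proof -
  define c where "c = - real L - 1/2"
  define a where "a = (\<lambda>m::int. \<integral>x. g x * cos (2 * pi * of_int m * x) \<partial>lborel)"
  have end_eq: "c + real (2 * L + 1) = real L + 1/2" by (simp add: c_def)
  have supp': "g x = 0" if "x \<notin> {c..c + real (2 * L + 1)}" for x
    by (rule supp) (use that in \<open>auto simp: c_def\<close>)
  have "(\<Sum>i<M. \<Sum>j<M. a (int i - int j)) / M = (\<integral>x. g x * fejer M x \<partial>lborel)" for M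
  proof -
    have int: "integrable lborel (\<lambda>x. g x * cos (2 * pi * of_int m * x))" for m :: int
      by (rule integrable_continuous_compact_support[where a = c and b = "c + real (2 * L + 1)"])
         (use supp' in \<open>auto intro!: continuous_intros cont\<close>)
    have "(\<Sum>i<M. \<Sum>j<M. a (int i - int j)) / M = 
       (\<integral>x. (\<Sum>i<M. \<Sum>j<M. g x * cos (2 * pi * of_int (int i - int j) * x)) / M \<partial>lborel)"
      unfolding a_def by (simp add: Bochner_Integration.integral_sum Bochner_Integration.integrable_sum int del: of_int_diff)
    thus ?thesis by (simp add: fejer_def sum_distrib_left)
  qed
  moreover have "(\<integral>x. g x * fejer M x \<partial>lborel) =
     (\<Sum>i<2*L+1. integral {-1/2..1/2} (\<lambda>u. g (of_int (int i - int L) + u) * fejer M u))" for M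
  proof -
    have "(\<integral>x. g x * fejer M x \<partial>lborel) = integral {c..c + real (2 * L + 1)} (\<lambda>x. g x * fejer M x)"
      using supp' by (intro lborel_integral_eq_integral_support continuous_intros cont) auto
    also have "\<dots> = (\<Sum>i<2*L+1. integral {0..1} (\<lambda>u. g (c + real i + u) * fejer M (c + real i + u)))"
      by (intro integral_unit_intervals continuous_intros cont)
    also have "\<dots> = (\<Sum>i<2*L+1. integral {-1/2..1/2} (\<lambda>u. g (of_int (int i - int L) + u) * fejer M u))"
    proof (intro sum.cong refl)
      fix i
      define f where "f = (\<lambda>u. g (of_int (int i - int L) + u) * fejer M u)"
      have "continuous_on UNIV f"
        unfolding f_def by (intro continuous_intros continuous_on_compose2[OF cont]) auto
      hence "f integrable_on {-1/2..1/2}"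
        by (intro integrable_continuous_real) (auto intro: continuous_on_subset)
      from has_integral_affinity'[OF integrable_integral[OF this, folded box_real(2)], of 1 "-1/2"]
      have "((\<lambda>u. f (u - 1/2)) has_integral integral {-1/2..1/2} f) {0..1}" by simp
      moreover have "f (u - 1/2) = g (c + real i + u) * fejer M (c + real i + u)" for u
        using fejer_periodic[of M "int i - int L" "u - 1/2"] by (simp add: f_def c_def algebra_simps)
      ultimately show "integral {0..1} (\<lambda>u. g (c + real i + u) * fejer M (c + real i + u)) = integral {-1/2..1/2} f"
        by (simp add: integral_unique)
    qed
    finally show ?thesis .
  qed
  moreover have "(\<lambda>M. \<Sum>i<2*L+1. integral {-1/2..1/2} (\<lambda>u. g (of_int (int i - int L) + u) * fejer M u))
      \<longlonglongrightarrow> (\<Sum>i<2*L+1. g (of_int (int i - int L) + 0))"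
    by (intro tendsto_sum fejer_approximate_identity continuous_on_compose2[OF cont] continuous_intros) auto
  ultimately have "(\<lambda>M. (\<Sum>i<M. \<Sum>j<M. a (int i - int j)) / M) \<longlonglongrightarrow> (\<Sum>i<2*L+1. g (of_int (int i - int L) + 0))"
    by simp
  moreover have "(a has_sum infsum a UNIV) UNIV"
    using summ by (simp add: a_def)
  hence "(\<lambda>M. (\<Sum>i<M. \<Sum>j<M. a (int i - int j)) / M) \<longlonglongrightarrow> infsum a UNIV"
    by (rule fejer_means_of_summable)
  ultimately have "infsum a UNIV = (\<Sum>i<2*L+1. g (of_int (int i - int L) + 0))"
    using LIMSEQ_unique by blast
  also have "\<dots> = (\<Sum>n\<in>{-int L..int L}. g (of_int n))"
    by (rule sum.reindex_bij_witness[of _ "\<lambda>n. nat (n + int L)" "\<lambda>i. int i - int L"]) auto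
  finally show ?thesis
    using summ unfolding a_def[symmetric] by (simp add: has_sum_iff)
qed

text \<open>
  For an even function the translation by \<open>\<kappa>\<close> multiplies the cosine transform by a cosine, because the
  sine transform vanishes. The transform is thereby separated from the translation, whose contribution
  has absolute value at most 1.
\<close>

lemma poisson_summation_even:
  fixes h :: "real \<Rightarrow> real" and \<kappa> :: real
  assumes cont: "continuous_on UNIV h" and supp: "\<And>x. \<bar>x\<bar> > B \<Longrightarrow> h x = 0"
    and even: "\<And>x. h (- x) = h x"
    and summ: "(\<lambda>m::int. norm (\<integral>x. h x * cos (2 * pi * of_int m * x) \<partial>lborel)) summable_on UNIV"
  shows "((\<lambda>m::int. cos (2 * pi * of_int m * \<kappa>) * (\<integral>x. h x * cos (2 * pi * of_int m * x) \<partial>lborel)) has_sum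
            (\<Sum>\<^sub>\<infinity>n::int. h (of_int n - \<kappa>))) UNIV"
    and "(\<lambda>n::int. h (of_int n - \<kappa>)) summable_on UNIV"
proof -
  obtain L :: nat where L: "real L > \<bar>B\<bar> + \<bar>\<kappa>\<bar>" using reals_Archimedean2 by blast
  define g where "g = (\<lambda>x. h (x - \<kappa>))"
  have g_supp: "g x = 0" if "\<bar>x\<bar> > real L" for x
    unfolding g_def by (rule supp) (use that L in linarith)
  have g_cont: "continuous_on UNIV g"
    unfolding g_def by (intro continuous_intros continuous_on_compose2[OF cont]) auto
  have coeff: "(\<integral>x. g x * cos (2 * pi * of_int m * x) \<partial>lborel) = 
     cos (2 * pi * of_int m * \<kappa>) * (\<integral>x. h x * cos (2 * pi * of_int m * x) \<partial>lborel)" for m :: int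
  proof -
    define w where "w = 2 * pi * of_int m"
    have int: "integrable lborel (\<lambda>x. h x * cos (w * x))" "integrable lborel (\<lambda>x. h x * sin (w * x))"
      by (rule integrable_continuous_compact_support[where a = "-B" and b = B]; 
          use supp in \<open>auto intro!: continuous_intros cont simp: abs_le_iff not_le\<close>)+
    have odd: "(\<integral>x. h x * sin (w * x) \<partial>lborel) = 0" (is "?I = 0")
    proof -
      have "?I = (\<integral>x. h (-x) * sin (w * (-x)) \<partial>lborel)"
        by (subst lborel_integral_real_affine[where c = "-1" and t = 0]) auto
      also have "\<dots> = - ?I" by (simp add: even)
      finally show ?thesis by simp
    qed
    have "(\<integral>x. g x * cos (w * x) \<partial>lborel) = (\<integral>x. g (\<kappa> + x) * cos (w * (\<kappa> + x)) \<partial>lborel)"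
      by (subst lborel_integral_real_affine[where c = 1 and t = \<kappa>]) auto
    also have "\<dots> = (\<integral>x. cos (w * \<kappa>) * (h x * cos (w * x)) - sin (w * \<kappa>) * (h x * sin (w * x)) \<partial>lborel)"
      by (simp add: g_def distrib_left cos_add algebra_simps)
    also have "\<dots> = cos (w * \<kappa>) * (\<integral>x. h x * cos (w * x) \<partial>lborel)"
      using int odd by simp
    finally show ?thesis by (simp add: w_def)
  qed
  have "(\<lambda>m::int. norm (\<integral>x. g x * cos (2 * pi * of_int m * x) \<partial>lborel)) summable_on UNIV"
    unfolding coeff
    by (rule Infinite_Sum.abs_summable_on_comparison_test[OF summ]) (auto simp: abs_mult intro!: mult_left_le_one_le)
  hence summ_g: "(\<lambda>m::int. \<integral>x. g x * cos (2 * pi * of_int m * x) \<partial>lborel) summable_on UNIV"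
    by (rule abs_summable_summable)
  have 1: "((\<lambda>n::int. g (of_int n)) has_sum (\<Sum>n\<in>{-int L..int L}. g (of_int n))) UNIV"
  proof (rule has_sum_finite_neutralI)
    fix n :: int assume "n \<in> UNIV - {-int L..int L}"
    hence "\<bar>n\<bar> > int L" by auto
    hence "\<bar>real_of_int n\<bar> > real L" by linarith
    thus "g (of_int n) = 0" by (rule g_supp)
  qed auto
  with poisson_summation[OF g_cont g_supp summ_g]
  show "((\<lambda>m::int. cos (2 * pi * of_int m * \<kappa>) * (\<integral>x. h x * cos (2 * pi * of_int m * x) \<partial>lborel)) has_sum
            (\<Sum>\<^sub>\<infinity>n::int. h (of_int n - \<kappa>))) UNIV"
    unfolding coeff by (simp add: g_def infsumI)
  from 1 show "(\<lambda>n::int. h (of_int n - \<kappa>)) summable_on UNIV"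
    by (auto simp: g_def has_sum_iff)
qed

section \<open>Sums over the integer lattice\<close>

abbreviation lattice_norm :: "nat \<Rightarrow> (nat \<Rightarrow> int) \<Rightarrow> real" where
  "lattice_norm k m \<equiv> lattice_dist k m (\<lambda>_. 0)"

text \<open>
  Lattice points are extensional functions, so the origin is not the constant function 0; it is singled
  out by its norm.
\<close>

definition nonzero_lattice :: "nat \<Rightarrow> (nat \<Rightarrow> int) set" where
  "nonzero_lattice k = {m \<in> int_lattice k. lattice_norm k m \<noteq> 0}"

lemma lattice_norm_eq_0_iff: "lattice_norm k m = 0 \<longleftrightarrow> (\<forall>i<k. m i = 0)"
  by (auto simp: lattice_dist_def L2_set_eq_0_iff)

lemma abs_le_lattice_norm: "i < k \<Longrightarrow> \<bar>real_of_int (m i)\<bar> \<le> lattice_norm k m"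
proof -
  assume "i < k"
  hence "\<bar>real_of_int (m i)\<bar> \<le> L2_set (\<lambda>i. \<bar>real_of_int (m i)\<bar>) {..<k}"
    by (intro member_le_L2_set) auto
  thus ?thesis by (simp add: lattice_dist_def L2_set_def)
qed

definition sup_norm :: "nat \<Rightarrow> (nat \<Rightarrow> int) \<Rightarrow> nat" where
  "sup_norm k m = Max ((\<lambda>i. nat \<bar>m i\<bar>) ` {..<k})"

text \<open>
  A point of the shell lies on one of the \<open>k\<close> pairs of opposite faces of a cube, and each pair has
  \<open>2 (2j + 1)^(k-1)\<close> points.
\<close>

lemma card_sup_norm_shell:
  assumes "j > 0" "k > 0"
  shows "finite {m \<in> int_lattice k. sup_norm k m = j}"
    and "real (card {m \<in> int_lattice k. sup_norm k m = j}) \<le> 2 * real k * 3 ^ (k - 1) * real j ^ (k - 1)"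
proof -
  define face where "face = (\<lambda>i. \<Pi>\<^sub>E i'\<in>{..<k}. if i' = i then {-int j, int j} else {-int j..int j})"
  have fin: "finite (face i)" for i
    unfolding face_def by (intro finite_PiE) auto
  have card: "card (face i) = 2 * (2 * j + 1) ^ (k - 1)" if "i < k" for i
  proof -
    have "card (face i) = (\<Prod>i'<k. card (if i' = i then {-int j, int j} else {-int j..int j}))"
      unfolding face_def by (rule card_PiE) auto
    also have "\<dots> = 2 * (\<Prod>i'\<in>{..<k} - {i}. card (if i' = i then {-int j, int j} else {-int j..int j}))"
      using that assms by (subst prod.remove[of _ i]) auto
    also have "(\<Prod>i'\<in>{..<k} - {i}. card (if i' = i then {-int j, int j} else {-int j..int j})) = 
               (\<Prod>i'\<in>{..<k} - {i}. 2 * j + 1)"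
      by (intro prod.cong) auto
    finally show ?thesis using that by simp
  qed
  have sub: "{m \<in> int_lattice k. sup_norm k m = j} \<subseteq> (\<Union>i<k. face i)"
  proof
    fix m assume "m \<in> {m \<in> int_lattice k. sup_norm k m = j}"
    hence m: "m \<in> int_lattice k" "sup_norm k m = j" by auto
    have ne: "(\<lambda>i. nat \<bar>m i\<bar>) ` {..<k} \<noteq> {}" using assms by auto
    have "j \<in> (\<lambda>i. nat \<bar>m i\<bar>) ` {..<k}"
      using Max_in[OF _ ne] m(2) by (auto simp: sup_norm_def)
    then obtain i where i: "i < k" "nat \<bar>m i\<bar> = j" by auto
    have "nat \<bar>m i'\<bar> \<le> j" if "i' < k" for i'
      unfolding m(2)[symmetric] sup_norm_def using that by (intro Max_ge) auto
    hence "\<bar>m i'\<bar> \<le> int j" if "i' < k" for i' using that by (simp add: nat_le_iff)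
    hence "m \<in> face i"
      using m(1) i assms unfolding face_def int_lattice_def by (auto simp: PiE_iff abs_le_iff minus_le_iff)
    thus "m \<in> (\<Union>i<k. face i)" using i by auto
  qed
  show "finite {m \<in> int_lattice k. sup_norm k m = j}"
    by (rule finite_subset[OF sub]) (use fin in auto)
  have "card {m \<in> int_lattice k. sup_norm k m = j} \<le> card (\<Union>i<k. face i)"
    by (rule card_mono[OF _ sub]) (use fin in auto)
  also have "\<dots> \<le> (\<Sum>i<k. card (face i))" by (rule card_UN_le) auto
  also have "\<dots> = k * (2 * (2 * j + 1) ^ (k - 1))" using card by simp
  also have "\<dots> \<le> k * (2 * (3 * j) ^ (k - 1))"
    using assms by (intro mult_left_mono power_mono) auto
  finally have "real (card {m \<in> int_lattice k. sup_norm k m = j}) \<le> real (k * (2 * (3 * j) ^ (k - 1)))"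
    by (rule of_nat_mono)
  thus "real (card {m \<in> int_lattice k. sup_norm k m = j}) \<le> 2 * real k * 3 ^ (k - 1) * real j ^ (k - 1)"
    by (simp add: power_mult_distrib mult_ac)
qed

text \<open>
  The maximum norm is at most the Euclidean norm, so a decreasing function of the latter may be evaluated
  at the former, and the points are counted shell by shell.
\<close>

lemma lattice_sum_le_radial_sum:
  assumes X: "finite X" "X \<subseteq> nonzero_lattice k"
    and \<phi>: "\<And>x. x \<ge> 1 \<Longrightarrow> \<phi> x \<ge> 0" "\<And>x y. 1 \<le> x \<Longrightarrow> x \<le> y \<Longrightarrow> \<phi> y \<le> (\<phi> x :: real)"
  shows "\<exists>J. (\<Sum>m\<in>X. \<phi> (lattice_norm k m)) \<le> 2 * real k * 3 ^ (k - 1) * (\<Sum>j=1..J. real j ^ (k - 1) * \<phi> (real j))"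
proof (cases "k = 0")
  case True
  hence "X = {}" using X by (auto simp: nonzero_lattice_def lattice_norm_eq_0_iff)
  thus ?thesis using True by auto
next
  case False
  define J where "J = Max (insert 0 (sup_norm k ` X))"
  have sup: "1 \<le> sup_norm k m \<and> sup_norm k m \<le> J \<and> real (sup_norm k m) \<le> lattice_norm k m" if "m \<in> X" for m
  proof -
    have "sup_norm k m \<in> (\<lambda>i. nat \<bar>m i\<bar>) ` {..<k}"
      unfolding sup_norm_def using False by (intro Max_in) auto
    then obtain i where i: "i < k" "sup_norm k m = nat \<bar>m i\<bar>" by auto
    obtain i' where i': "i' < k" "m i' \<noteq> 0"
      using subsetD[OF X(2) \<open>m \<in> X\<close>] by (auto simp: nonzero_lattice_def lattice_norm_eq_0_iff)
    have "nat \<bar>m i'\<bar> \<le> sup_norm k m"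
      unfolding sup_norm_def using i' by (intro Max_ge) auto
    with i' have "1 \<le> sup_norm k m" by linarith
    moreover have "sup_norm k m \<le> J" using X that by (auto simp: J_def intro!: Max_ge)
    ultimately show ?thesis using abs_le_lattice_norm[OF i(1), of m] i(2) by auto
  qed
  have "(\<Sum>m\<in>X. \<phi> (lattice_norm k m)) \<le> (\<Sum>m\<in>X. \<phi> (real (sup_norm k m)))"
    by (intro sum_mono \<phi>(2)) (use sup in auto)
  also have "\<dots> = (\<Sum>j=1..J. \<Sum>m\<in>{m \<in> X. sup_norm k m = j}. \<phi> (real (sup_norm k m)))"
    using sup X by (intro sum.group[symmetric]) auto
  also have "\<dots> \<le> (\<Sum>j=1..J. 2 * real k * 3 ^ (k - 1) * real j ^ (k - 1) * \<phi> (real j))"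
  proof (rule sum_mono)
    fix j assume j: "j \<in> {1..J}"
    have "(\<Sum>m\<in>{m \<in> X. sup_norm k m = j}. \<phi> (real (sup_norm k m))) = card {m \<in> X. sup_norm k m = j} * \<phi> (real j)"
      by simp
    also have "\<dots> \<le> (2 * real k * 3 ^ (k - 1) * real j ^ (k - 1)) * \<phi> (real j)"
    proof (rule mult_right_mono)
      have "card {m \<in> X. sup_norm k m = j} \<le> card {m \<in> int_lattice k. sup_norm k m = j}"
        using card_sup_norm_shell(1)[of j k] j False X
        by (intro card_mono) (auto simp: nonzero_lattice_def)
      with card_sup_norm_shell(2)[of j k] j False
      show "real (card {m \<in> X. sup_norm k m = j}) \<le> 2 * real k * 3 ^ (k - 1) * real j ^ (k - 1)"
        by (auto intro: order_trans[rotated])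
    qed (use j in \<open>auto intro!: \<phi>\<close>)
    finally show "(\<Sum>m\<in>{m \<in> X. sup_norm k m = j}. \<phi> (real (sup_norm k m))) \<le> 2 * real k * 3 ^ (k - 1) * real j ^ (k - 1) * \<phi> (real j)" .
  qed
  also have "\<dots> = 2 * real k * 3 ^ (k - 1) * (\<Sum>j=1..J. real j ^ (k - 1) * \<phi> (real j))"
    by (simp add: sum_distrib_left mult_ac)
  finally show ?thesis by blast
qed

text \<open>
  The mean value theorem for \<open>x^(\<beta>+1)\<close>; sums of powers can then be compared with telescoping sums. The
  sign of \<open>\<beta> + 1\<close> is arbitrary, so the lemma serves for the tails of convergent sums as well as for
  the partial sums of divergent ones.
\<close>

lemma powr_diff_ge:
  fixes x \<beta> :: real
  assumes "1 < x" "\<beta> \<le> 0" "\<beta> \<noteq> -1"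
  shows "x powr \<beta> \<le> (x powr (\<beta> + 1) - (x - 1) powr (\<beta> + 1)) / (\<beta> + 1)"
proof -
  have "\<exists>z>x - 1. z < x \<and> x powr (\<beta> + 1) - (x - 1) powr (\<beta> + 1) = (x - (x - 1)) * ((\<beta> + 1) * z powr \<beta>)"
  proof (rule MVT2[where f = "\<lambda>x. x powr (\<beta> + 1)"])
    fix z assume "x - 1 \<le> z" "z \<le> x"
    thus "((\<lambda>x. x powr (\<beta> + 1)) has_real_derivative (\<beta> + 1) * z powr \<beta>) (at z)"
      using assms by (auto intro!: derivative_eq_intros)
  qed auto
  then obtain z where z: "z > x - 1" "z < x"
    "x powr (\<beta> + 1) - (x - 1) powr (\<beta> + 1) = (\<beta> + 1) * z powr \<beta>" by auto
  have "x powr \<beta> \<le> z powr \<beta>"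
    using z assms by (intro powr_mono2') auto
  thus ?thesis using z(3) assms by simp
qed

lemma sum_powr_tail:
  assumes "\<tau> > 1" "M \<ge> 1"
  shows "(\<Sum>j\<in>{M<..J}. real j powr (-\<tau>)) \<le> real M powr (1 - \<tau>) / (\<tau> - 1)"
proof -
  have "(\<Sum>j\<in>{M<..J}. real j powr (-\<tau>)) \<le> (real M powr (1 - \<tau>) - real J powr (1 - \<tau>)) / (\<tau> - 1)" if "M \<le> J"
    using that
  proof (induction J rule: dec_induct)
    case (step J)
    have "real (Suc J) powr (-\<tau>) \<le> (real (Suc J) powr (-\<tau> + 1) - (real (Suc J) - 1) powr (-\<tau> + 1)) / (-\<tau> + 1)"
      by (rule powr_diff_ge) (use step assms in auto)
    also have "\<dots> = (real J powr (1 - \<tau>) - real (Suc J) powr (1 - \<tau>)) / (\<tau> - 1)"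
      using assms by (simp add: field_simps)
    finally have "real (Suc J) powr (-\<tau>) \<le> \<dots>" .
    moreover have "{M<..Suc J} = insert (Suc J) {M<..J}" using step by auto
    ultimately show ?case using step.IH by (simp add: diff_divide_distrib)
  qed auto
  moreover have "(real M powr (1 - \<tau>) - real J powr (1 - \<tau>)) / (\<tau> - 1) \<le> real M powr (1 - \<tau>) / (\<tau> - 1)"
    using assms by (intro divide_right_mono) auto
  moreover have "(\<Sum>j\<in>{M<..J}. real j powr (-\<tau>)) = 0" if "M > J" using that by simp
  ultimately show ?thesis using assms by (cases "M \<le> J") auto
qed

lemma sum_powr_head:
  assumes "\<beta> > -1"
  shows "(\<Sum>j=1..M. real j powr \<beta>) \<le> max 1 (1 / (\<beta> + 1)) * real M powr (\<beta> + 1)"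
proof (induction M)
  case (Suc M)
  define K where "K = max 1 (1 / (\<beta> + 1))"
  have "real (Suc M) powr \<beta> \<le> K * (real (Suc M) powr (\<beta> + 1) - real M powr (\<beta> + 1))"
  proof (cases "\<beta> \<ge> 0")
    case True
    have "real M powr (\<beta> + 1) \<le> real M * real (Suc M) powr \<beta>"
      using True by (cases "M = 0") (auto simp: powr_add mult.commute intro!: mult_left_mono powr_mono2)
    moreover have "real (Suc M) powr (\<beta> + 1) = (real M + 1) * real (Suc M) powr \<beta>"
      by (simp add: powr_add)
    ultimately have "real (Suc M) powr \<beta> \<le> 1 * (real (Suc M) powr (\<beta> + 1) - real M powr (\<beta> + 1))"
      by (simp add: algebra_simps)
    also have "\<dots> \<le> K * (real (Suc M) powr (\<beta> + 1) - real M powr (\<beta> + 1))"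
      using assms by (intro mult_right_mono) (auto simp: K_def intro!: powr_mono2)
    finally show ?thesis .
  next
    case False
    have "real (Suc M) powr \<beta> \<le> 1 / (\<beta> + 1) * (real (Suc M) powr (\<beta> + 1) - real M powr (\<beta> + 1))"
    proof (cases "M = 0")
      case False
      thus ?thesis using powr_diff_ge[of "real (Suc M)" \<beta>] assms \<open>\<not> \<beta> \<ge> 0\<close> by simp
    qed (use assms False in \<open>auto simp: field_simps\<close>)
    also have "\<dots> \<le> K * (real (Suc M) powr (\<beta> + 1) - real M powr (\<beta> + 1))"
      using assms by (intro mult_right_mono) (auto simp: K_def intro!: powr_mono2)
    finally show ?thesis .
  qed
  with Suc show ?case by (simp add: K_def algebra_simps)
qed auto

text \<open>
  The order of growth in \<open>M\<close> of the sum of \<open>|m|^(-\<alpha>)\<close> over the nonzero points \<open>m\<close> of \<open>Z^k\<close> with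
  \<open>|m| \<le> M\<close>.
\<close>

definition lattice_sum_order :: "nat \<Rightarrow> real \<Rightarrow> real \<Rightarrow> real" where
  "lattice_sum_order k \<alpha> M =
     (if real k < \<alpha> then 1 else if real k = \<alpha> then 1 + ln M else M powr (real k - \<alpha>))"

text \<open>
  Up to \<open>M\<close> the minimum is bounded by 1 and the sum by a partial sum of powers; beyond \<open>M\<close> the factor
  \<open>(M / j)^N\<close> makes the sum converge, and the tail has the same order as the last dyadic part of the
  partial sum.
\<close>

lemma truncated_power_sum_bound:
  assumes "\<alpha> > 0" "N > k" "k > 0"
  shows "\<exists>K\<ge>0. \<forall>M\<ge>1. \<forall>J. (\<Sum>j=1..J. real j ^ (k - 1) * (real j powr (-\<alpha>) * min 1 ((real M / real j) ^ N)))
           \<le> K * lattice_sum_order k \<alpha> (real M)"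
proof -
  define \<beta> where "\<beta> = real k - 1 - \<alpha>"
  define \<tau> where "\<tau> = real N - \<beta>"
  have \<tau>: "\<tau> > 1" using assms by (simp add: \<tau>_def \<beta>_def)
  define H where "H = (\<lambda>M. \<Sum>j=1..M. real j powr \<beta>)"
  have split: "(\<Sum>j=1..J. real j ^ (k - 1) * (real j powr (-\<alpha>) * min 1 ((real M / real j) ^ N)))
           \<le> H M + real M powr (\<beta> + 1) / (\<tau> - 1)" if M: "M \<ge> 1" for M J :: nat
  proof -
    define t where "t = (\<lambda>j. real j ^ (k - 1) * (real j powr (-\<alpha>) * min 1 ((real M / real j) ^ N)))"
    have pw: "real j ^ (k - 1) * real j powr (-\<alpha>) = real j powr \<beta>" if "j \<ge> 1" for j
      using that assms by (simp add: \<beta>_def powr_realpow[symmetric] powr_add[symmetric] of_nat_diff algebra_simps)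
    have t1: "t j \<le> real j powr \<beta>" if "j \<ge> 1" for j
      unfolding t_def mult.assoc[symmetric] pw[OF that] by (simp add: mult_left_le)
    have t2: "t j \<le> real M ^ N * real j powr (-\<tau>)" if "j \<ge> 1" for j
    proof -
      have "t j \<le> real j powr \<beta> * (real M / real j) ^ N"
        unfolding t_def mult.assoc[symmetric] pw[OF that] by (intro mult_left_mono) auto
      also have "\<dots> = real M ^ N * real j powr (-\<tau>)"
        using that by (simp add: power_divide \<tau>_def powr_diff powr_realpow)
      finally show ?thesis .
    qed
    have t0: "t j \<ge> 0" for j by (simp add: t_def)
    have "(\<Sum>j=1..J. t j) \<le> (\<Sum>j\<in>{1..M} \<union> {M<..J}. t j)"
      by (intro sum_mono2 t0) auto
    also have "\<dots> = (\<Sum>j=1..M. t j) + (\<Sum>j\<in>{M<..J}. t j)"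
      by (intro sum.union_disjoint) auto
    also have "(\<Sum>j=1..M. t j) \<le> H M"
      unfolding H_def by (intro sum_mono t1) auto
    also have "(\<Sum>j\<in>{M<..J}. t j) \<le> (\<Sum>j\<in>{M<..J}. real M ^ N * real j powr (-\<tau>))"
      using M by (intro sum_mono t2) auto
    also have "\<dots> = real M ^ N * (\<Sum>j\<in>{M<..J}. real j powr (-\<tau>))"
      by (simp add: sum_distrib_left)
    also have "\<dots> \<le> real M ^ N * (real M powr (1 - \<tau>) / (\<tau> - 1))"
      by (intro mult_left_mono sum_powr_tail \<tau> M) auto
    also have "\<dots> = real M powr (\<beta> + 1) / (\<tau> - 1)"
      using M by (simp add: powr_realpow[symmetric] powr_add[symmetric] \<tau>_def add_ac)
    finally show ?thesis by (simp add: t_def)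
  qed
  define c where "c = 1 / (\<tau> - 1)"
  have c: "c > 0" using \<tau> by (simp add: c_def)
  have "\<exists>K\<ge>0. \<forall>M\<ge>1. H M + real M powr (\<beta> + 1) / (\<tau> - 1) \<le> K * lattice_sum_order k \<alpha> (real M)"
  proof (cases "real k" \<alpha> rule: linorder_cases)
    case less
    define K where "K = 1 + 1 / (- \<beta> - 1) + c"
    have "H M + real M powr (\<beta> + 1) / (\<tau> - 1) \<le> K" if M: "M \<ge> 1" for M
    proof -
      have "{1..M} = insert 1 {1<..M}" using M by auto
      hence "H M = 1 + (\<Sum>j\<in>{1<..M}. real j powr (-(- \<beta>)))"
        by (simp add: H_def)
      also have "\<dots> \<le> 1 + real 1 powr (1 - (-\<beta>)) / (- \<beta> - 1)"
        using less by (intro add_left_mono sum_powr_tail) (auto simp: \<beta>_def)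
      finally have "H M \<le> 1 + 1 / (- \<beta> - 1)" by simp
      moreover have "real M powr (\<beta> + 1) \<le> 1 powr (\<beta> + 1)"
        using M less by (intro powr_mono2') (auto simp: \<beta>_def)
      hence "real M powr (\<beta> + 1) * c \<le> 1 * c" using c by (intro mult_right_mono) auto
      ultimately show ?thesis by (simp add: K_def c_def)
    qed
    moreover have "K \<ge> 0" using c less by (simp add: K_def \<beta>_def)
    ultimately show ?thesis using less by (auto simp: lattice_sum_order_def intro!: exI[of _ K])
  next
    case equal
    have "H M + real M powr (\<beta> + 1) / (\<tau> - 1) \<le> (1 + c) * (1 + ln (real M))" if M: "M \<ge> 1" for M
    proof -
      have "\<beta> = -1" using equal by (simp add: \<beta>_def)
      hence "H M = harm M" by (simp add: H_def harm_def powr_minus divide_inverse)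
      also have "\<dots> \<le> ln (real M) + 1" using euler_mascheroni_sequence_decreasing[of 1 M] M by (simp add: harm_def)
      finally have "H M \<le> 1 * (1 + ln (real M))" by simp
      moreover have "real M powr (\<beta> + 1) / (\<tau> - 1) = c * 1"
        using \<open>\<beta> = -1\<close> M by (simp add: c_def)
      moreover have "c * 1 \<le> c * (1 + ln (real M))"
        using c M by (intro mult_left_mono) auto
      ultimately show ?thesis unfolding distrib_right by linarith
    qed
    thus ?thesis using equal c by (auto simp: lattice_sum_order_def intro!: exI[of _ "1 + c"])
  next
    case greater
    define K where "K = max 1 (1 / (\<beta> + 1))"
    have "H M + real M powr (\<beta> + 1) / (\<tau> - 1) \<le> (K + c) * real M powr (real k - \<alpha>)" for M
    proof -
      have "H M \<le> K * real M powr (\<beta> + 1)"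
        unfolding H_def K_def using greater by (intro sum_powr_head) (auto simp: \<beta>_def)
      moreover have "\<beta> + 1 = real k - \<alpha>" by (simp add: \<beta>_def)
      ultimately show ?thesis by (simp add: c_def distrib_right)
    qed
    moreover have "K + c \<ge> 0" using c by (simp add: K_def)
    ultimately show ?thesis using greater by (auto simp: lattice_sum_order_def intro!: exI[of _ "K + c"])
  qed
  thus ?thesis using split by (meson order_trans)
qed

lemma lattice_sum_bound:
  assumes "\<alpha> > 0" "N > k"
  shows "\<exists>K\<ge>0. \<forall>M\<ge>1. \<forall>X. finite X \<longrightarrow> X \<subseteq> nonzero_lattice k \<longrightarrow>
           (\<Sum>m\<in>X. lattice_norm k m powr (-\<alpha>) * min 1 ((real M / lattice_norm k m) ^ N))
           \<le> K * lattice_sum_order k \<alpha> (real M)"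
proof (cases "k = 0")
  case True
  hence "nonzero_lattice k = {}" by (auto simp: nonzero_lattice_def lattice_norm_eq_0_iff)
  thus ?thesis by (intro exI[of _ 0]) auto
next
  case False
  obtain K where K: "K \<ge> 0" "\<And>M J. M \<ge> 1 \<Longrightarrow> 
       (\<Sum>j=1..J. real j ^ (k - 1) * (real j powr (-\<alpha>) * min 1 ((real M / real j) ^ N))) \<le> K * lattice_sum_order k \<alpha> (real M)"
    using truncated_power_sum_bound[OF assms] False by blast
  define c where "c = 2 * real k * 3 ^ (k - 1)"
  show ?thesis
  proof (intro exI[of _ "c * K"] conjI allI impI)
    fix M :: nat and X assume M: "M \<ge> 1" and X: "finite X" "X \<subseteq> nonzero_lattice k"
    define \<phi> where "\<phi> = (\<lambda>x::real. x powr (-\<alpha>) * min 1 ((real M / x) ^ N))"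
    have "\<phi> y \<le> \<phi> x" if "1 \<le> x" "x \<le> y" for x y
      unfolding \<phi>_def using that assms
      by (intro mult_mono min.mono powr_mono2' power_mono divide_left_mono) auto
    moreover have "\<phi> x \<ge> 0" if "x \<ge> 1" for x
      using that by (auto simp: \<phi>_def)
    ultimately obtain J where "(\<Sum>m\<in>X. \<phi> (lattice_norm k m)) \<le> c * (\<Sum>j=1..J. real j ^ (k - 1) * \<phi> (real j))"
      using lattice_sum_le_radial_sum[OF X, of \<phi>] unfolding c_def by blast
    also have "\<dots> \<le> c * (K * lattice_sum_order k \<alpha> (real M))"
      unfolding \<phi>_def by (intro mult_left_mono K M) (auto simp: c_def)
    finally show "(\<Sum>m\<in>X. lattice_norm k m powr (-\<alpha>) * min 1 ((real M / lattice_norm k m) ^ N))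
           \<le> c * K * lattice_sum_order k \<alpha> (real M)" by (simp add: \<phi>_def mult.assoc)
  qed (use K in \<open>auto simp: c_def\<close>)
qed

section \<open>Poisson summation over the integer lattice\<close>

text \<open>
  For every finite set of lattice points the cutoff is inactive once \<open>M\<close> exceeds all their norms, and in
  the convergent case the bound does not depend on \<open>M\<close>.
\<close>

lemma lattice_powr_summable:
  assumes "\<alpha> > real k"
  shows "(\<lambda>m. lattice_norm k m powr (-\<alpha>)) summable_on nonzero_lattice k"
proof -
  obtain K where K: "\<And>M X. \<lbrakk>M \<ge> 1; finite X; X \<subseteq> nonzero_lattice k\<rbrakk> \<Longrightarrow>
      (\<Sum>m\<in>X. lattice_norm k m powr (-\<alpha>) * min 1 ((real M / lattice_norm k m) ^ (k + 1)))
           \<le> K * lattice_sum_order k \<alpha> (real M)"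
    using lattice_sum_bound[of \<alpha> k "k + 1"] assms by auto
  have "(\<Sum>m\<in>X. lattice_norm k m powr (-\<alpha>)) \<le> K" if X: "finite X" "X \<subseteq> nonzero_lattice k" for X
  proof -
    obtain M :: nat where M: "real M > Max (insert 1 (lattice_norm k ` X))"
      using reals_Archimedean2 by blast
    have M1: "real M > 1" using M X by simp
    have "(\<Sum>m\<in>X. lattice_norm k m powr (-\<alpha>)) =
        (\<Sum>m\<in>X. lattice_norm k m powr (-\<alpha>) * min 1 ((real M / lattice_norm k m) ^ (k + 1)))"
    proof (rule sum.cong[OF refl])
      fix m assume m: "m \<in> X"
      hence "lattice_norm k m > 0"
        using X by (auto simp: nonzero_lattice_def less_le)
      moreover have "lattice_norm k m \<le> real M" using M m X by auto
      ultimately have "(real M / lattice_norm k m) ^ (k + 1) \<ge> 1"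
        by (intro one_le_power) auto
      thus "lattice_norm k m powr (-\<alpha>) = lattice_norm k m powr (-\<alpha>) * min 1 ((real M / lattice_norm k m) ^ (k + 1))"
        by simp
    qed
    also have "\<dots> \<le> K * lattice_sum_order k \<alpha> (real M)"
      using M1 X by (intro K) auto
    finally show ?thesis using assms by (simp add: lattice_sum_order_def)
  qed
  thus ?thesis
    by (intro nonneg_bdd_above_summable_on bdd_aboveI2[where M = K]) auto
qed

lemma int_lattice_insert_0: "int_lattice k = insert (\<lambda>i\<in>{..<k}. 0) (nonzero_lattice k)"
proof -
  have "m = (\<lambda>i\<in>{..<k}. 0)" if "m \<in> int_lattice k" "m \<notin> nonzero_lattice k" for m
  proof
    fix i
    have "m i = 0" if "i < k"
      using \<open>m \<in> int_lattice k\<close> \<open>m \<notin> nonzero_lattice k\<close> that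
      by (simp add: nonzero_lattice_def lattice_norm_eq_0_iff)
    moreover have "m i = undefined" if "\<not> i < k"
      using PiE_arb[of m "{..<k}" _ i] \<open>m \<in> int_lattice k\<close> that by (simp add: int_lattice_def)
    ultimately show "m i = (\<lambda>i\<in>{..<k}. 0) i" by simp
  qed
  moreover have "nonzero_lattice k \<subseteq> int_lattice k" by (auto simp: nonzero_lattice_def)
  moreover have "(\<lambda>i\<in>{..<k}. 0) \<in> int_lattice k" by (simp add: int_lattice_def)
  ultimately show ?thesis by blast
qed

lemma ball_ft_lattice_summable:
  assumes "real n / 2 + 1 > real k"
  shows "(\<lambda>m. norm (ball_ft (Suc n) s (sqrt (\<xi>\<^sup>2 + (lattice_norm k m)\<^sup>2)))) summable_on int_lattice k"
proof -
  let ?f = "\<lambda>m. norm (ball_ft (Suc n) s (sqrt (\<xi>\<^sup>2 + (lattice_norm k m)\<^sup>2)))"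
  define \<alpha> where "\<alpha> = real n / 2 + 1"
  obtain C where C: "C \<ge> 0" "\<And>s \<xi>. \<xi> > 0 \<Longrightarrow> \<bar>ball_ft (Suc n) s \<xi>\<bar> \<le> C * s powr (real n / 4) * \<xi> powr (- \<alpha>)"
    using ball_ft_decay[of n] unfolding \<alpha>_def by blast
  have "?f summable_on nonzero_lattice k"
  proof (rule summable_on_comparison_test)
    show "(\<lambda>m. C * s powr (real n / 4) * lattice_norm k m powr (-\<alpha>)) summable_on nonzero_lattice k"
      using assms by (intro summable_on_cmult_right lattice_powr_summable) (simp add: \<alpha>_def)
    fix m assume "m \<in> nonzero_lattice k"
    hence m: "lattice_norm k m > 0" by (auto simp: nonzero_lattice_def less_le)
    have le: "lattice_norm k m \<le> sqrt (\<xi>\<^sup>2 + (lattice_norm k m)\<^sup>2)"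
      by (intro real_le_rsqrt) auto
    have "?f m \<le> C * s powr (real n / 4) * sqrt (\<xi>\<^sup>2 + (lattice_norm k m)\<^sup>2) powr (-\<alpha>)"
      unfolding real_norm_def by (rule C(2)) (use m le in linarith)
    also have "\<dots> \<le> C * s powr (real n / 4) * lattice_norm k m powr (-\<alpha>)"
      using m le C by (intro mult_left_mono powr_mono2') (auto simp: \<alpha>_def)
    finally show "?f m \<le> C * s powr (real n / 4) * lattice_norm k m powr (-\<alpha>)" .
  qed auto
  thus ?thesis by (simp add: int_lattice_insert_0 summable_on_insert_iff)
qed

text \<open>
  Splitting off the last coordinate; all inductions over the dimension rest on this bijection.
\<close>

lemma bij_betw_int_lattice_Suc:
  "bij_betw (\<lambda>(\<gamma>, j). \<gamma>(k := j)) (int_lattice k \<times> UNIV) (int_lattice (Suc k))"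
proof (rule bij_betwI[where g = "\<lambda>\<gamma>. (\<gamma>(k := undefined), \<gamma> k)"])
  show "(\<lambda>(\<gamma>, j). \<gamma>(k := j)) \<in> int_lattice k \<times> UNIV \<rightarrow> int_lattice (Suc k)"
    unfolding int_lattice_def
  proof (intro funcsetI, clarify, intro PiE_I)
    fix \<gamma> :: "nat \<Rightarrow> int" and j i assume "\<gamma> \<in> {..<k} \<rightarrow>\<^sub>E UNIV" "i \<notin> {..<Suc k}"
    thus "(\<gamma>(k := j)) i = undefined" using PiE_arb[of \<gamma> "{..<k}" _ i] by simp
  qed auto
  show "(\<lambda>\<gamma>. (\<gamma>(k := undefined), \<gamma> k)) \<in> int_lattice (Suc k) \<rightarrow> int_lattice k \<times> UNIV"
    unfolding int_lattice_def
  proof (intro funcsetI SigmaI PiE_I)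
    fix \<gamma> :: "nat \<Rightarrow> int" and i assume "\<gamma> \<in> {..<Suc k} \<rightarrow>\<^sub>E UNIV" "i \<notin> {..<k}"
    thus "(\<gamma>(k := undefined)) i = undefined" using PiE_arb[of \<gamma> "{..<Suc k}" _ i] by simp
  qed auto
next
  fix p :: "(nat \<Rightarrow> int) \<times> int" assume "p \<in> int_lattice k \<times> UNIV"
  hence "fst p k = undefined" unfolding int_lattice_def by (auto dest: PiE_arb)
  thus "(\<lambda>\<gamma>. (\<gamma>(k := undefined), \<gamma> k)) ((\<lambda>(\<gamma>, j). \<gamma>(k := j)) p) = p"
    by (cases p) (simp add: fun_upd_idem)
next
  fix \<gamma> :: "nat \<Rightarrow> int"
  show "(\<lambda>(\<gamma>, j). \<gamma>(k := j)) (\<gamma>(k := undefined), \<gamma> k) = \<gamma>" by simp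
qed

lemma lattice_dist_Suc:
  "(lattice_dist (Suc k) (\<gamma>(k := j)) \<kappa>)\<^sup>2 = (lattice_dist k \<gamma> \<kappa>)\<^sup>2 + (real_of_int j - \<kappa> k)\<^sup>2"
proof -
  have "(\<Sum>i<k. (real_of_int ((\<gamma>(k := j)) i) - \<kappa> i)\<^sup>2) = (\<Sum>i<k. (real_of_int (\<gamma> i) - \<kappa> i)\<^sup>2)"
    by (intro sum.cong) auto
  thus ?thesis by (simp add: lattice_dist_def L2_set_def sum_nonneg)
qed

lemma int_lattice_0: "int_lattice 0 = {\<lambda>_. undefined}"
  by (simp add: int_lattice_def)

lemma lattice_dist_0 [simp]: "lattice_dist 0 \<gamma> \<kappa> = 0"
  by (simp add: lattice_dist_def)

lemma ball_ft_abs: "ball_ft n s \<bar>\<xi>\<bar> = ball_ft n s \<xi>"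
proof -
  have "cos (2 * pi * \<bar>\<xi>\<bar> * x) = cos (2 * pi * \<xi> * x)" for x
    by (cases "\<xi> \<ge> 0") (auto simp: abs_if)
  thus ?thesis by (simp add: ball_ft_def)
qed

lemma has_sum_finite_sum:
  fixes f :: "'a \<Rightarrow> 'b \<Rightarrow> real"
  assumes "\<And>a. a \<in> A \<Longrightarrow> (f a has_sum t a) B"
  shows "((\<lambda>b. \<Sum>a\<in>A. f a b) has_sum (\<Sum>a\<in>A. t a)) B"
  using assms by (induction A rule: infinite_finite_induct) (auto intro: has_sum_add)

text \<open>
  Only the lattice points inside the ball contribute.
\<close>

lemma ball_ft_lattice_sum_finite:
  "(\<Sum>\<^sub>\<infinity>\<gamma>\<in>int_lattice k. ball_ft n (s - (lattice_dist k \<gamma> \<kappa>)\<^sup>2) \<xi>) =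
     (\<Sum>\<gamma> | \<gamma> \<in> int_lattice k \<and> lattice_dist k \<gamma> \<kappa> < sqrt s. ball_ft n (s - (lattice_dist k \<gamma> \<kappa>)\<^sup>2) \<xi>)"
  "(\<lambda>\<gamma>. ball_ft n (s - (lattice_dist k \<gamma> \<kappa>)\<^sup>2) \<xi>) summable_on int_lattice k"
proof -
  have "((\<lambda>\<gamma>. ball_ft n (s - (lattice_dist k \<gamma> \<kappa>)\<^sup>2) \<xi>) has_sum
     (\<Sum>\<gamma> | \<gamma> \<in> int_lattice k \<and> lattice_dist k \<gamma> \<kappa> < sqrt s. ball_ft n (s - (lattice_dist k \<gamma> \<kappa>)\<^sup>2) \<xi>)) (int_lattice k)"
  proof (rule has_sum_finite_neutralI[OF finite_lattice_ball])
    fix \<gamma> assume "\<gamma> \<in> int_lattice k - {\<gamma> \<in> int_lattice k. lattice_dist k \<gamma> \<kappa> < sqrt s}"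
    hence "s \<le> (lattice_dist k \<gamma> \<kappa>)\<^sup>2"
      by (auto simp: not_less intro: sqrt_le_D)
    thus "ball_ft n (s - (lattice_dist k \<gamma> \<kappa>)\<^sup>2) \<xi> = 0" by simp
  qed auto
  thus "(\<Sum>\<^sub>\<infinity>\<gamma>\<in>int_lattice k. ball_ft n (s - (lattice_dist k \<gamma> \<kappa>)\<^sup>2) \<xi>) =
     (\<Sum>\<gamma> | \<gamma> \<in> int_lattice k \<and> lattice_dist k \<gamma> \<kappa> < sqrt s. ball_ft n (s - (lattice_dist k \<gamma> \<kappa>)\<^sup>2) \<xi>)"
    "(\<lambda>\<gamma>. ball_ft n (s - (lattice_dist k \<gamma> \<kappa>)\<^sup>2) \<xi>) summable_on int_lattice k"
    by (auto simp: has_sum_iff)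
qed

lemma ball_ft_int_summable:
  assumes "n \<ge> 1"
  shows "(\<lambda>j::int. norm (ball_ft (Suc n) s (sqrt (\<xi>\<^sup>2 + (of_int j)\<^sup>2)))) summable_on UNIV"
proof -
  have "(\<lambda>m. norm (ball_ft (Suc n) s (sqrt (\<xi>\<^sup>2 + (lattice_norm (Suc 0) m)\<^sup>2)))) summable_on int_lattice (Suc 0)"
    by (rule ball_ft_lattice_summable) (use assms in auto)
  hence "(\<lambda>(\<gamma>, j). norm (ball_ft (Suc n) s (sqrt (\<xi>\<^sup>2 + (lattice_norm (Suc 0) (\<gamma>(0 := j)))\<^sup>2))))
           summable_on (int_lattice 0 \<times> UNIV)"
    unfolding summable_on_reindex_bij_betw[OF bij_betw_int_lattice_Suc, symmetric]
    by (simp only: case_prod_unfold)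
  hence "(\<lambda>j. norm (ball_ft (Suc n) s (sqrt (\<xi>\<^sup>2 + (lattice_norm (Suc 0) ((\<lambda>_. undefined)(0 := j)))\<^sup>2)))) summable_on UNIV"
    by (rule summable_on_SigmaD1) (simp add: int_lattice_0)
  thus ?thesis by (simp only: lattice_dist_Suc) simp
qed

text \<open>
  By the rotation lemma the coefficients in one-dimensional Poisson summation are transforms of balls of
  one dimension more, and these are summable by the decay estimate.
\<close>

lemma ball_ft_poisson:
  assumes "n \<ge> 1"
  shows "((\<lambda>m::int. cos (2 * pi * of_int m * \<kappa>) * ball_ft (Suc (Suc n)) s (sqrt (\<xi>\<^sup>2 + (of_int m)\<^sup>2))) has_sum
            (\<Sum>\<^sub>\<infinity>j::int. ball_ft (Suc n) (s - (of_int j - \<kappa>)\<^sup>2) \<xi>)) UNIV"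
    and "(\<lambda>j::int. ball_ft (Suc n) (s - (of_int j - \<kappa>)\<^sup>2) \<xi>) summable_on UNIV"
proof -
  define h where "h = (\<lambda>x. ball_ft (Suc n) (s - x\<^sup>2) \<xi>)"
  have "continuous_on UNIV h"
    unfolding h_def by (intro continuous_intros continuous_on_compose2[OF ball_ft_continuous[OF assms, of UNIV]]) auto
  moreover have "h x = 0" if "\<bar>x\<bar> > sqrt \<bar>s\<bar>" for x
  proof -
    have "(sqrt \<bar>s\<bar>)\<^sup>2 \<le> x\<^sup>2" using that abs_le_square_iff[of "sqrt \<bar>s\<bar>" x] by simp
    thus ?thesis by (simp add: h_def)
  qed
  moreover have "h (-x) = h x" for x by (simp add: h_def)
  moreover have ft: "(\<integral>x. h x * cos (2 * pi * of_int m * x) \<partial>lborel) = ball_ft (Suc (Suc n)) s (sqrt (\<xi>\<^sup>2 + (of_int m)\<^sup>2))" for m :: int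
    unfolding h_def by (rule ball_ft_rotation)
  moreover have "(\<lambda>m::int. norm (\<integral>x. h x * cos (2 * pi * of_int m * x) \<partial>lborel)) summable_on UNIV"
    unfolding ft by (rule ball_ft_int_summable) auto
  ultimately show "((\<lambda>m::int. cos (2 * pi * of_int m * \<kappa>) * ball_ft (Suc (Suc n)) s (sqrt (\<xi>\<^sup>2 + (of_int m)\<^sup>2))) has_sum
            (\<Sum>\<^sub>\<infinity>j::int. ball_ft (Suc n) (s - (of_int j - \<kappa>)\<^sup>2) \<xi>)) UNIV"
    and "(\<lambda>j::int. ball_ft (Suc n) (s - (of_int j - \<kappa>)\<^sup>2) \<xi>) summable_on UNIV"
    using poisson_summation_even[of h "sqrt \<bar>s\<bar>" \<kappa>] unfolding ft by (simp_all only: h_def)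
qed

text \<open>
  Induction over the dimension of the lattice, generalised over the frequency \<open>\<xi>\<close>. One-dimensional Poisson
  summation in the last coordinate replaces the frequency \<open>\<xi>\<close> by \<open>sqrt (\<xi>\<^sup>2 + j\<^sup>2)\<close> and raises the
  dimension of the ball by one; the induction hypothesis applies to the remaining coordinates for each
  \<open>j\<close>. The bound on \<open>n\<close> ensures absolute convergence, which justifies the exchange of the sums.
\<close>

lemma ball_ft_lattice_poisson:
  assumes "n \<ge> 1" "n \<ge> k"
  shows "((\<lambda>m. (\<Prod>i<k. cos (2 * pi * of_int (m i) * \<kappa> i)) *
              ball_ft (Suc n + k) s (sqrt (\<xi>\<^sup>2 + (lattice_norm k m)\<^sup>2))) has_sum
            (\<Sum>\<^sub>\<infinity>\<gamma>\<in>int_lattice k. ball_ft (Suc n) (s - (lattice_dist k \<gamma> \<kappa>)\<^sup>2) \<xi>)) (int_lattice k)"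
  using assms
proof (induction k arbitrary: n \<xi>)
  case 0
  show ?case
    by (rule has_sum_finiteI) (simp_all add: int_lattice_0 ball_ft_abs)
next
  case (Suc k)
  define F where "F = {\<gamma> \<in> int_lattice k. lattice_dist k \<gamma> \<kappa> < sqrt s}"
  define c where "c = (\<lambda>m. \<Prod>i<k. cos (2 * pi * of_int (m i) * \<kappa> i))"
  define c1 where "c1 = (\<lambda>j::int. cos (2 * pi * of_int j * \<kappa> k))"
  define T where "T = (\<lambda>m j. c1 j * (c m * ball_ft (Suc (Suc n) + k) s (sqrt (\<xi>\<^sup>2 + (of_int j)\<^sup>2 + (lattice_norm k m)\<^sup>2))))"
  have finF: "finite F" unfolding F_def by (rule finite_lattice_ball)
  have c_le: "\<bar>c m\<bar> \<le> 1" for m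
    unfolding c_def abs_prod by (rule prod_le_1) auto
  have left: "(\<Sum>\<^sub>\<infinity>\<gamma>\<in>int_lattice (Suc k). ball_ft (Suc n) (s - (lattice_dist (Suc k) \<gamma> \<kappa>)\<^sup>2) \<xi>) =
     (\<Sum>\<gamma>\<in>F. \<Sum>\<^sub>\<infinity>j. ball_ft (Suc n) (s - (lattice_dist k \<gamma> \<kappa>)\<^sup>2 - (of_int j - \<kappa> k)\<^sup>2) \<xi>)"
  proof -
    let ?f = "\<lambda>\<gamma>. ball_ft (Suc n) (s - (lattice_dist (Suc k) \<gamma> \<kappa>)\<^sup>2) \<xi>"
    let ?g = "\<lambda>(\<gamma>, j). ball_ft (Suc n) (s - (lattice_dist k \<gamma> \<kappa>)\<^sup>2 - (real_of_int j - \<kappa> k)\<^sup>2) \<xi>"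
    have eq: "?f ((\<lambda>(\<gamma>, j). \<gamma>(k := j)) p) = ?g p" for p
      by (cases p) (simp add: lattice_dist_Suc diff_diff_eq del: fun_upd_apply)
    have summ: "?g summable_on (int_lattice k \<times> UNIV)"
      using ball_ft_lattice_sum_finite(2)[of "Suc n" s "Suc k" \<kappa> \<xi>]
      unfolding summable_on_reindex_bij_betw[OF bij_betw_int_lattice_Suc, symmetric] eq .
    have "infsum ?f (int_lattice (Suc k)) = infsum ?g (int_lattice k \<times> UNIV)"
      unfolding infsum_reindex_bij_betw[OF bij_betw_int_lattice_Suc, symmetric] eq ..
    also have "\<dots> = (\<Sum>\<^sub>\<infinity>\<gamma>\<in>int_lattice k. \<Sum>\<^sub>\<infinity>j. ?g (\<gamma>, j))"
      by (rule infsum_Sigma_banach[OF summ, symmetric])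
    also have "\<dots> = (\<Sum>\<^sub>\<infinity>\<gamma>\<in>F. \<Sum>\<^sub>\<infinity>j. ?g (\<gamma>, j))"
    proof (rule infsum_cong_neutral)
      fix \<gamma> assume "\<gamma> \<in> int_lattice k - F"
      hence "s \<le> (lattice_dist k \<gamma> \<kappa>)\<^sup>2"
        by (auto simp: F_def not_less intro: sqrt_le_D)
      hence "?g (\<gamma>, j) = 0" for j
        using zero_le_power2[of "real_of_int j - \<kappa> k"] by (simp only: prod.case) (rule ball_ft_nonpos, linarith)
      thus "(\<Sum>\<^sub>\<infinity>j. ?g (\<gamma>, j)) = 0" by simp
    qed (auto simp: F_def)
    finally show ?thesis using finF by simp
  qed
  have "((\<lambda>j. \<Sum>\<gamma>\<in>F. c1 j * ball_ft (Suc (Suc n)) (s - (lattice_dist k \<gamma> \<kappa>)\<^sup>2) (sqrt (\<xi>\<^sup>2 + (of_int j)\<^sup>2))) has_sum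
       (\<Sum>\<gamma>\<in>F. \<Sum>\<^sub>\<infinity>j. ball_ft (Suc n) (s - (lattice_dist k \<gamma> \<kappa>)\<^sup>2 - (of_int j - \<kappa> k)\<^sup>2) \<xi>)) UNIV"
    unfolding c1_def using Suc.prems by (intro has_sum_finite_sum ball_ft_poisson) auto
  also have "(\<lambda>j. \<Sum>\<gamma>\<in>F. c1 j * ball_ft (Suc (Suc n)) (s - (lattice_dist k \<gamma> \<kappa>)\<^sup>2) (sqrt (\<xi>\<^sup>2 + (of_int j)\<^sup>2))) =
      (\<lambda>j. \<Sum>\<^sub>\<infinity>m\<in>int_lattice k. T m j)"
  proof
    fix j :: int
    define \<eta> where "\<eta> = sqrt (\<xi>\<^sup>2 + (of_int j)\<^sup>2)"
    have \<eta>2: "\<eta>\<^sup>2 = \<xi>\<^sup>2 + (of_int j)\<^sup>2" by (simp add: \<eta>_def)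
    have "(\<Sum>\<gamma>\<in>F. c1 j * ball_ft (Suc (Suc n)) (s - (lattice_dist k \<gamma> \<kappa>)\<^sup>2) \<eta>) =
        c1 j * (\<Sum>\<^sub>\<infinity>\<gamma>\<in>int_lattice k. ball_ft (Suc (Suc n)) (s - (lattice_dist k \<gamma> \<kappa>)\<^sup>2) \<eta>)"
      by (simp add: ball_ft_lattice_sum_finite(1) F_def sum_distrib_left)
    also have "(\<Sum>\<^sub>\<infinity>\<gamma>\<in>int_lattice k. ball_ft (Suc (Suc n)) (s - (lattice_dist k \<gamma> \<kappa>)\<^sup>2) \<eta>) =
        (\<Sum>\<^sub>\<infinity>m\<in>int_lattice k. c m * ball_ft (Suc (Suc n) + k) s (sqrt (\<eta>\<^sup>2 + (lattice_norm k m)\<^sup>2)))"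
      unfolding c_def by (rule infsumI[OF Suc.IH, symmetric]) (use Suc.prems in auto)
    also have "c1 j * \<dots> = (\<Sum>\<^sub>\<infinity>m\<in>int_lattice k. T m j)"
      unfolding T_def \<eta>2 by (rule infsum_cmult_right'[symmetric])
    finally show "(\<Sum>\<gamma>\<in>F. c1 j * ball_ft (Suc (Suc n)) (s - (lattice_dist k \<gamma> \<kappa>)\<^sup>2) (sqrt (\<xi>\<^sup>2 + (of_int j)\<^sup>2))) =
        (\<Sum>\<^sub>\<infinity>m\<in>int_lattice k. T m j)" unfolding \<eta>_def .
  qed
  finally have right: "((\<lambda>j. \<Sum>\<^sub>\<infinity>m\<in>int_lattice k. T m j) has_sum
      (\<Sum>\<^sub>\<infinity>\<gamma>\<in>int_lattice (Suc k). ball_ft (Suc n) (s - (lattice_dist (Suc k) \<gamma> \<kappa>)\<^sup>2) \<xi>)) UNIV"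
    unfolding left .
  let ?t = "\<lambda>m. (\<Prod>i<Suc k. cos (2 * pi * of_int (m i) * \<kappa> i)) *
              ball_ft (Suc n + Suc k) s (sqrt (\<xi>\<^sup>2 + (lattice_norm (Suc k) m)\<^sup>2))"
  have teq: "?t ((\<lambda>(\<gamma>, j). \<gamma>(k := j)) p) = (\<lambda>(m, j). T m j) p" for p
  proof (cases p)
    case (Pair m j)
    have "(\<Prod>i<k. cos (2 * pi * of_int ((m(k := j)) i) * \<kappa> i)) = c m"
      unfolding c_def by (intro prod.cong) auto
    thus ?thesis using Pair lattice_dist_Suc[of k m j "\<lambda>_. 0"]
      by (simp add: T_def c1_def add_ac mult_ac)
  qed
  have "(\<lambda>m. norm (ball_ft (Suc (n + Suc k)) s (sqrt (\<xi>\<^sup>2 + (lattice_norm (Suc k) m)\<^sup>2)))) summable_on int_lattice (Suc k)"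
    by (rule ball_ft_lattice_summable) (use Suc.prems in auto)
  hence "(\<lambda>m. norm (?t m)) summable_on int_lattice (Suc k)"
  proof (rule summable_on_comparison_test)
    fix m
    have "\<bar>\<Prod>i<Suc k. cos (2 * pi * of_int (m i) * \<kappa> i)\<bar> \<le> 1"
      unfolding abs_prod by (rule prod_le_1) auto
    thus "norm (?t m) \<le> norm (ball_ft (Suc (n + Suc k)) s (sqrt (\<xi>\<^sup>2 + (lattice_norm (Suc k) m)\<^sup>2)))"
      by (simp add: abs_mult mult_left_le_one_le)
  qed auto
  hence t_summ: "?t summable_on int_lattice (Suc k)" by (rule abs_summable_summable)
  hence T_summ: "(\<lambda>(m, j). T m j) summable_on (int_lattice k \<times> UNIV)"
    unfolding summable_on_reindex_bij_betw[OF bij_betw_int_lattice_Suc, symmetric] teq by simp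
  have "infsum ?t (int_lattice (Suc k)) = infsum (\<lambda>(m, j). T m j) (int_lattice k \<times> UNIV)"
    unfolding infsum_reindex_bij_betw[OF bij_betw_int_lattice_Suc, symmetric] teq ..
  also have "\<dots> = (\<Sum>\<^sub>\<infinity>m\<in>int_lattice k. \<Sum>\<^sub>\<infinity>j. T m j)"
    using infsum_Sigma'_banach[OF T_summ] by simp
  also have "\<dots> = (\<Sum>\<^sub>\<infinity>j. \<Sum>\<^sub>\<infinity>m\<in>int_lattice k. T m j)"
    by (rule infsum_swap_banach[OF T_summ])
  also have "\<dots> = (\<Sum>\<^sub>\<infinity>\<gamma>\<in>int_lattice (Suc k). ball_ft (Suc n) (s - (lattice_dist (Suc k) \<gamma> \<kappa>)\<^sup>2) \<xi>)"
    by (rule infsumI[OF right])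
  finally show ?case using t_summ by (simp add: has_sum_iff)
qed

section \<open>Finite differences\<close>

primrec fdiff :: "nat \<Rightarrow> real \<Rightarrow> (real \<Rightarrow> real) \<Rightarrow> real \<Rightarrow> real" where
  "fdiff 0 h f s = f s"
| "fdiff (Suc N) h f s = fdiff N h f (s + h) - fdiff N h f s"

lemma fdiff_diff: "fdiff N h (\<lambda>s. f s - g s) s = fdiff N h f s - fdiff N h g s"
  by (induction N arbitrary: s) auto

lemma abs_fdiff_le:
  assumes "h \<ge> 0" "\<And>u. u \<in> {s..s + N * h} \<Longrightarrow> \<bar>f u\<bar> \<le> B"
  shows "\<bar>fdiff N h f s\<bar> \<le> 2 ^ N * B"
  using assms(2)
proof (induction N arbitrary: s)
  case (Suc N)
  have "\<bar>fdiff N h f (s + h)\<bar> \<le> 2 ^ N * B"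
    by (rule Suc.IH, rule Suc.prems) (use \<open>h \<ge> 0\<close> in \<open>auto simp: algebra_simps\<close>)
  moreover have "\<bar>fdiff N h f s\<bar> \<le> 2 ^ N * B"
    by (rule Suc.IH, rule Suc.prems) (use \<open>h \<ge> 0\<close> in \<open>auto simp: algebra_simps\<close>)
  ultimately show ?case by simp
qed auto

lemma has_sum_fdiff:
  assumes "\<And>u. ((\<lambda>m. c m * F m u) has_sum G u) X"
  shows "((\<lambda>m. c m * fdiff N h (F m) s) has_sum fdiff N h G s) X"
proof (induction N arbitrary: s)
  case (Suc N)
  have "((\<lambda>m. c m * fdiff N h (F m) (s + h) + (-1) * (c m * fdiff N h (F m) s)) has_sum
          (fdiff N h G (s + h) + (-1) * fdiff N h G s)) X"
    by (intro has_sum_add has_sum_cmult_right Suc)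
  thus ?case by (simp add: algebra_simps)
qed (use assms in auto)

lemma has_integral_fdiff:
  assumes "h \<ge> 0" "a \<le> b"
    and "\<And>a b. a \<le> b \<Longrightarrow> (f has_integral (g b - g a) / c) {a..b}"
  shows "(fdiff N h f has_integral (fdiff N h g b - fdiff N h g a) / c) {a..b}"
  using assms(2)
proof (induction N arbitrary: a b)
  case 0
  have "fdiff 0 h f = f" "fdiff 0 h g = g" by auto
  thus ?case using assms(3) 0 by simp
next
  case (Suc N)
  have "(fdiff N h f has_integral (fdiff N h g (b + h) - fdiff N h g (a + h)) / c) {a + h..b + h}"
    using Suc by auto
  from has_integral_affinity'[OF this[folded box_real(2)], of 1 h]
  have "((\<lambda>x. fdiff N h f (x + h)) has_integral (fdiff N h g (b + h) - fdiff N h g (a + h)) / c) {a..b}"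
    by simp
  from has_integral_diff[OF this Suc.IH[OF Suc.prems]]
  have "((\<lambda>x. fdiff N h f (x + h) - fdiff N h f x) has_integral
     (fdiff N h g (b + h) - fdiff N h g (a + h)) / c - (fdiff N h g b - fdiff N h g a) / c) {a..b}" .
  moreover have "(\<lambda>x. fdiff N h f (x + h) - fdiff N h f x) = fdiff (Suc N) h f"
    by auto
  ultimately show ?case by (simp add: diff_divide_distrib add_divide_distrib algebra_simps)
qed

text \<open>
  The \<open>N\<close>-th difference of an \<open>N\<close>-fold antiderivative of \<open>G 0\<close> is an integral of \<open>G 0\<close> over a
  family of translates by at most \<open>N h\<close>. Differentiability is replaced by the integral relation because
  \<open>G 0\<close> may have jumps, as it does when lattice points are counted. The constant \<open>c\<close> is \<open>\<pi>\<close> in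
  the applications.
\<close>

lemma fdiff_bounds:
  fixes G :: "nat \<Rightarrow> real \<Rightarrow> real"
  assumes h: "h \<ge> 0" and c: "c > 0"
    and G: "\<And>j a b. a \<le> b \<Longrightarrow> (G j has_integral (G (Suc j) b - G (Suc j) a) / c) {a..b}"
    and bd: "\<And>u. u \<in> {s..s + real N * h} \<Longrightarrow> G 0 u \<in> {A..B}"
  shows "fdiff N h (G N) s \<in> {(c * h) ^ N * A..(c * h) ^ N * B}"
  using bd
proof (induction N arbitrary: s)
  case (Suc N)
  have int: "(fdiff N h (G N) has_integral (fdiff N h (G (Suc N)) (s + h) - fdiff N h (G (Suc N)) s) / c) {s..s+h}"
    using h by (intro has_integral_fdiff G) auto
  have IH: "fdiff N h (G N) u \<in> {(c * h) ^ N * A..(c * h) ^ N * B}" if "u \<in> {s..s+h}" for u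
    using that h by (intro Suc.IH Suc.prems) (auto simp: algebra_simps)
  have const: "((\<lambda>_. x) has_integral h * x) {s..s+h}" for x :: real
    using has_integral_const_real[of x s "s + h"] h by simp
  have "h * ((c * h) ^ N * A) \<le> (fdiff N h (G (Suc N)) (s + h) - fdiff N h (G (Suc N)) s) / c"
    by (rule has_integral_le[OF const int]) (use IH in auto)
  moreover have "(fdiff N h (G (Suc N)) (s + h) - fdiff N h (G (Suc N)) s) / c \<le> h * ((c * h) ^ N * B)"
    by (rule has_integral_le[OF int const]) (use IH in auto)
  ultimately show ?case using c by (simp add: field_simps)
qed auto

section \<open>The error term\<close>

text \<open>
  For \<open>s > 0\<close>, the \<open>n\<close>-dimensional volume of the intersection of \<open>Z^k \<times> R^n\<close> with a ball of radius
  \<open>sqrt s\<close>. The radius and the dimension \<open>n\<close> have to vary independently of \<open>d\<close>, since the argument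
  passes through the dimensions \<open>n + 2j\<close>.
\<close>

definition lattice_ball_vol :: "nat \<Rightarrow> nat \<Rightarrow> (nat \<Rightarrow> real) \<Rightarrow> real \<Rightarrow> real" where
  "lattice_ball_vol n k \<kappa> s = (\<Sum>\<^sub>\<infinity>\<gamma>\<in>int_lattice k. ball_vol n (s - (lattice_dist k \<gamma> \<kappa>)\<^sup>2))"

lemma lattice_ball_vol_finite:
  assumes "s \<le> b"
  shows "lattice_ball_vol n k \<kappa> s =
    (\<Sum>\<gamma> | \<gamma> \<in> int_lattice k \<and> lattice_dist k \<gamma> \<kappa> < sqrt b. ball_vol n (s - (lattice_dist k \<gamma> \<kappa>)\<^sup>2))"
  unfolding lattice_ball_vol_def
proof (rule infsumI, rule has_sum_finite_neutralI[OF finite_lattice_ball])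
  fix \<gamma> assume "\<gamma> \<in> int_lattice k - {\<gamma> \<in> int_lattice k. lattice_dist k \<gamma> \<kappa> < sqrt b}"
  hence "b \<le> (lattice_dist k \<gamma> \<kappa>)\<^sup>2"
    by (auto simp: not_less intro: sqrt_le_D)
  thus "ball_vol n (s - (lattice_dist k \<gamma> \<kappa>)\<^sup>2) = 0" using assms by simp
qed auto

lemma S_eq_lattice_ball_vol:
  assumes "\<rho> > 0"
  shows "S d k \<rho> \<kappa> = lattice_ball_vol (d - k) k \<kappa> (\<rho>\<^sup>2)"
  unfolding S_def lattice_ball_vol_finite[OF order_refl] sum_distrib_left
proof (rule sum.cong)
  show "{\<gamma> \<in> int_lattice k. lattice_dist k \<gamma> \<kappa> < \<rho>} =
        {\<gamma> \<in> int_lattice k. lattice_dist k \<gamma> \<kappa> < sqrt (\<rho>\<^sup>2)}"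
    using assms by simp
  fix \<gamma> assume "\<gamma> \<in> {\<gamma> \<in> int_lattice k. lattice_dist k \<gamma> \<kappa> < sqrt (\<rho>\<^sup>2)}"
  hence "(lattice_dist k \<gamma> \<kappa>)\<^sup>2 < \<rho>\<^sup>2"
    using assms by (intro power_strict_mono) auto
  thus "unit_ball_vol (real (d - k)) * (\<rho>\<^sup>2 - (lattice_dist k \<gamma> \<kappa>)\<^sup>2) powr (real (d - k) / 2) =
        ball_vol (d - k) (\<rho>\<^sup>2 - (lattice_dist k \<gamma> \<kappa>)\<^sup>2)"
    by (simp add: ball_vol_def powr_half_sqrt[symmetric] powr_powr flip: powr_realpow)
qed

lemma lattice_ball_vol_mono: "s \<le> t \<Longrightarrow> lattice_ball_vol n k \<kappa> s \<le> lattice_ball_vol n k \<kappa> t"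
  unfolding lattice_ball_vol_finite[OF order_refl, of n k \<kappa> t] lattice_ball_vol_finite[of s t]
  by (intro sum_mono ball_vol_mono) auto

lemma lattice_ball_vol_has_integral:
  assumes "a \<le> b"
  shows "(lattice_ball_vol n k \<kappa> has_integral
           (lattice_ball_vol (n + 2) k \<kappa> b - lattice_ball_vol (n + 2) k \<kappa> a) / pi) {a..b}"
proof -
  let ?F = "{\<gamma> \<in> int_lattice k. lattice_dist k \<gamma> \<kappa> < sqrt b}"
  have "((\<lambda>s. \<Sum>\<gamma>\<in>?F. ball_vol n (s - (lattice_dist k \<gamma> \<kappa>)\<^sup>2)) has_integral
      (\<Sum>\<gamma>\<in>?F. (ball_vol (n + 2) (b - (lattice_dist k \<gamma> \<kappa>)\<^sup>2) - ball_vol (n + 2) (a - (lattice_dist k \<gamma> \<kappa>)\<^sup>2)) / pi)) {a..b}"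
    by (intro has_integral_sum finite_lattice_ball ball_vol_has_integral assms)
  also have "(\<Sum>\<gamma>\<in>?F. (ball_vol (n + 2) (b - (lattice_dist k \<gamma> \<kappa>)\<^sup>2) - ball_vol (n + 2) (a - (lattice_dist k \<gamma> \<kappa>)\<^sup>2)) / pi)
     = (lattice_ball_vol (n + 2) k \<kappa> b - lattice_ball_vol (n + 2) k \<kappa> a) / pi"
    unfolding lattice_ball_vol_finite[OF order_refl, of _ _ _ b] lattice_ball_vol_finite[OF assms]
    by (simp only: sum_subtractf sum_divide_distrib diff_divide_distrib)
  finally show ?thesis
    by (rule has_integral_eq[rotated]) (simp add: lattice_ball_vol_finite[of _ b])
qed

text \<open>
  Poisson summation with the frequency \<open>m = 0\<close> moved to the other side: its term is the volume of the
  ball in the full dimension \<open>n + k\<close>.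
\<close>

lemma lattice_ball_vol_poisson:
  assumes "n \<ge> 2" "n > k"
  shows "((\<lambda>m. (\<Prod>i<k. cos (2 * pi * of_int (m i) * \<kappa> i)) * ball_ft (n + k) s (lattice_norm k m)) has_sum
            (lattice_ball_vol n k \<kappa> s - ball_vol (n + k) s)) (nonzero_lattice k)"
proof -
  obtain n' where n': "n = Suc n'" "n' \<ge> 1" "n' \<ge> k"
    using assms by (cases n) auto
  let ?t = "\<lambda>m. (\<Prod>i<k. cos (2 * pi * of_int (m i) * \<kappa> i)) * ball_ft (n + k) s (lattice_norm k m)"
  define z where "z = (\<lambda>i\<in>{..<k}. 0 :: int)"
  have z_norm: "lattice_norm k z = 0" by (simp add: lattice_norm_eq_0_iff z_def)
  hence z_notin: "z \<notin> nonzero_lattice k" by (simp add: nonzero_lattice_def)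
  have all: "(?t has_sum lattice_ball_vol n k \<kappa> s) (insert z (nonzero_lattice k))"
    using ball_ft_lattice_poisson[OF n'(2,3), of \<kappa> s 0]
    by (simp add: n'(1) ball_ft_zero lattice_ball_vol_def z_def int_lattice_insert_0[symmetric])
  hence "?t summable_on nonzero_lattice k"
    using summable_on_subset_banach has_sum_imp_summable by blast
  then obtain T where T: "(?t has_sum T) (nonzero_lattice k)"
    unfolding summable_on_def by blast
  have "lattice_ball_vol n k \<kappa> s = ?t z + T"
    using has_sum_unique[OF all has_sum_insert[OF z_notin T]] .
  also have "?t z = ball_vol (n + k) s"
    unfolding z_norm n'(1) using ball_ft_zero[of "n' + k" s] by (simp add: z_def)
  finally have "T = lattice_ball_vol n k \<kappa> s - ball_vol (n + k) s" by simp
  with T show ?thesis by simp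
qed

text \<open>
  Two bounds for the same difference: as an averaged \<open>N\<close>-th derivative it has the size of the
  transform of the \<open>d\<close>-ball, and as a combination of \<open>2^N\<close> values it has the size of the transform of
  the \<open>(d + 2N)\<close>-ball, which decays faster in \<open>\<xi>\<close> by \<open>N\<close> powers. With step \<open>sqrt T / M\<close> the two
  bounds agree, up to constants, at \<open>\<xi> = M\<close>.
\<close>

lemma ball_ft_fdiff_bound:
  assumes "d \<ge> 1"
  shows "\<exists>C\<ge>0. \<forall>T>0. \<forall>M\<ge>1. \<forall>s \<xi>. \<xi> > 0 \<longrightarrow> s + real N * (sqrt T / real M) \<le> T \<longrightarrow>
     \<bar>fdiff N (sqrt T / real M) (\<lambda>u. ball_ft (d + 2 * N) u \<xi>) s\<bar> \<le>
       (pi * (sqrt T / real M)) ^ N * (C * T powr ((real d - 1) / 4) *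
          (\<xi> powr (-((real d + 1) / 2)) * min 1 ((real M / \<xi>) ^ N)))"
proof -
  have decay: "\<exists>C\<ge>0. \<forall>T>0. \<forall>u\<le>T. \<forall>\<xi>>0. \<bar>ball_ft n u \<xi>\<bar> \<le> C * T powr ((real n - 1) / 4) * \<xi> powr (-((real n + 1) / 2))"
    if n: "n \<ge> 1" for n
  proof -
    obtain n' where n': "n = Suc n'" using n by (cases n) auto
    obtain C where C: "C \<ge> 0" "\<And>s \<xi>. \<xi> > 0 \<Longrightarrow> \<bar>ball_ft n s \<xi>\<bar> \<le> C * s powr (real n' / 4) * \<xi> powr (- (real n' / 2 + 1))"
      using ball_ft_decay[of n'] unfolding n' by blast
    have "\<bar>ball_ft n u \<xi>\<bar> \<le> C * T powr ((real n - 1) / 4) * \<xi> powr (-((real n + 1) / 2))"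
      if "T > 0" "u \<le> T" "\<xi> > 0" for T u \<xi>
    proof (cases "u > 0")
      case True
      have "\<bar>ball_ft n u \<xi>\<bar> \<le> C * u powr (real n' / 4) * \<xi> powr (- (real n' / 2 + 1))"
        by (rule C) fact
      also have "\<dots> \<le> C * T powr (real n' / 4) * \<xi> powr (- (real n' / 2 + 1))"
        using True that C by (intro mult_right_mono mult_left_mono powr_mono2) auto
      also have "real n' = real n - 1" by (simp add: n')
      also have "- ((real n - 1) / 2 + 1) = -((real n + 1) / 2)" by (simp add: field_simps)
      finally show ?thesis .
    qed (use C that in auto)
    with C(1) show ?thesis by blast
  qed
  obtain C0 where C0: "C0 \<ge> 0" "\<And>T u \<xi>. \<lbrakk>T > 0; u \<le> T; \<xi> > 0\<rbrakk> \<Longrightarrow>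
      \<bar>ball_ft d u \<xi>\<bar> \<le> C0 * T powr ((real d - 1) / 4) * \<xi> powr (-((real d + 1) / 2))"
    using decay[OF assms] by blast
  obtain C1 where C1: "C1 \<ge> 0" "\<And>T u \<xi>. \<lbrakk>T > 0; u \<le> T; \<xi> > 0\<rbrakk> \<Longrightarrow>
      \<bar>ball_ft (d + 2 * N) u \<xi>\<bar> \<le> C1 * T powr ((real (d + 2 * N) - 1) / 4) * \<xi> powr (-((real (d + 2 * N) + 1) / 2))"
    using decay[of "d + 2 * N"] assms by auto
  define C where "C = max C0 C1"
  have "\<bar>fdiff N (sqrt T / real M) (\<lambda>u. ball_ft (d + 2 * N) u \<xi>) s\<bar> \<le>
       (pi * (sqrt T / real M)) ^ N * (C * T powr ((real d - 1) / 4) *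
          (\<xi> powr (-((real d + 1) / 2)) * min 1 ((real M / \<xi>) ^ N)))"
    if T: "T > 0" and M: "M \<ge> 1" and \<xi>: "\<xi> > 0" and sT: "s + real N * (sqrt T / real M) \<le> T" for T M s \<xi>
  proof -
    define h where "h = sqrt T / real M"
    have h: "h > 0" using T M by (simp add: h_def)
    define P where "P = T powr ((real d - 1) / 4) * \<xi> powr (-((real d + 1) / 2))"
    have P: "P \<ge> 0" by (simp add: P_def)
    have b0: "\<bar>fdiff N h (\<lambda>u. ball_ft (d + 2 * N) u \<xi>) s\<bar> \<le> (pi * h) ^ N * (C * P * 1)"
    proof -
      have "fdiff N h (\<lambda>u. ball_ft (d + 2 * N) u \<xi>) s \<in> {(pi * h) ^ N * (-(C0 * P))..(pi * h) ^ N * (C0 * P)}"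
      proof (rule fdiff_bounds[where G = "\<lambda>j u. ball_ft (d + 2 * j) u \<xi>"])
        fix j a b assume "a \<le> (b :: real)"
        obtain d' where "d = Suc d'" using assms by (cases d) auto
        thus "((\<lambda>u. ball_ft (d + 2 * j) u \<xi>) has_integral (ball_ft (d + 2 * Suc j) b \<xi> - ball_ft (d + 2 * Suc j) a \<xi>) / pi) {a..b}"
          using ball_ft_has_integral[OF \<open>a \<le> b\<close>, of "d' + 2 * j" \<xi>] by simp
      next
        fix u assume "u \<in> {s..s + real N * h}"
        hence "u \<le> T" using sT by (simp add: h_def)
        from C0(2)[OF T this \<xi>] show "ball_ft (d + 2 * 0) u \<xi> \<in> {-(C0 * P)..C0 * P}"
          by (simp add: P_def mult.assoc abs_le_iff minus_le_iff)
      qed (use h in auto)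
      hence "\<bar>fdiff N h (\<lambda>u. ball_ft (d + 2 * N) u \<xi>) s\<bar> \<le> (pi * h) ^ N * (C0 * P)"
        by (auto simp: abs_le_iff)
      also have "\<dots> \<le> (pi * h) ^ N * (C * P)"
        using h P by (intro mult_left_mono mult_right_mono) (auto simp: C_def)
      finally show ?thesis by simp
    qed
    have b1: "\<bar>fdiff N h (\<lambda>u. ball_ft (d + 2 * N) u \<xi>) s\<bar> \<le> (pi * h) ^ N * (C * P * (real M / \<xi>) ^ N)"
    proof -
      have "\<bar>fdiff N h (\<lambda>u. ball_ft (d + 2 * N) u \<xi>) s\<bar> \<le>
          2 ^ N * (C1 * T powr ((real (d + 2 * N) - 1) / 4) * \<xi> powr (-((real (d + 2 * N) + 1) / 2)))"
      proof (rule abs_fdiff_le)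
        fix u assume "u \<in> {s..s + real N * h}"
        hence "u \<le> T" using sT by (simp add: h_def)
        from C1(2)[OF T this \<xi>]
        show "\<bar>ball_ft (d + 2 * N) u \<xi>\<bar> \<le>
            C1 * T powr ((real (d + 2 * N) - 1) / 4) * \<xi> powr (-((real (d + 2 * N) + 1) / 2))" .
      qed (use h in simp)
      also have "T powr ((real (d + 2 * N) - 1) / 4) = T powr ((real d - 1) / 4) * sqrt T ^ N"
      proof -
        have "sqrt T ^ N = T powr (real N / 2)"
          using T by (simp add: powr_half_sqrt[symmetric] powr_powr flip: powr_realpow)
        moreover have "(real (d + 2 * N) - 1) / 4 = (real d - 1) / 4 + real N / 2" by (simp add: field_simps)
        ultimately show ?thesis by (simp only: powr_add)
      qed
      also have "\<xi> powr (-((real (d + 2 * N) + 1) / 2)) = \<xi> powr (-((real d + 1) / 2)) / \<xi> ^ N"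
      proof -
        have "-((real (d + 2 * N) + 1) / 2) = -((real d + 1) / 2) - real N" by (simp add: field_simps)
        thus ?thesis using \<xi> by (simp only: powr_diff powr_realpow)
      qed
      also have "2 ^ N * (C1 * (T powr ((real d - 1) / 4) * sqrt T ^ N) * (\<xi> powr (-((real d + 1) / 2)) / \<xi> ^ N)) =
          (2 * sqrt T) ^ N * (C1 * P / \<xi> ^ N)"
        by (simp add: P_def power_mult_distrib mult_ac)
      also have "\<dots> \<le> (pi * sqrt T) ^ N * (C * P / \<xi> ^ N)"
        \<comment> \<open>\<open>2 \<le> \<pi>\<close> turns the number \<open>2^N\<close> of terms into the normalising factor\<close>
        using T P \<xi> C1(1) pi_ge_two
        by (intro mult_mono power_mono divide_right_mono mult_right_mono) (auto simp: C_def)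
      also have "\<dots> = (pi * h) ^ N * (C * P * (real M / \<xi>) ^ N)"
        using M by (simp add: h_def power_mult_distrib power_divide)
      finally show ?thesis .
    qed
    from b0 b1 have "\<bar>fdiff N h (\<lambda>u. ball_ft (d + 2 * N) u \<xi>) s\<bar> \<le> (pi * h) ^ N * (C * P * min 1 ((real M / \<xi>) ^ N))"
      by (auto simp: min_def)
    thus ?thesis by (simp add: P_def h_def mult_ac)
  qed
  moreover have "C \<ge> 0" using C0(1) by (simp add: C_def)
  ultimately show ?thesis by blast
qed

text \<open>
  The order \<open>k + 1\<close> of the difference is large enough both for the absolute convergence in
  \<open>lattice_ball_vol_poisson\<close> and for the truncated lattice sum.
\<close>

lemma fdiff_lattice_error_bound:
  assumes "d \<ge> 1" "k \<le> d"
  shows "\<exists>C\<ge>0. \<forall>T>0. \<forall>M\<ge>1. \<forall>s \<kappa>. s + real (Suc k) * (sqrt T / real M) \<le> T \<longrightarrow>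
     \<bar>fdiff (Suc k) (sqrt T / real M) (lattice_ball_vol (d - k + 2 * Suc k) k \<kappa>) s
       - fdiff (Suc k) (sqrt T / real M) (ball_vol (d + 2 * Suc k)) s\<bar> \<le>
       (pi * (sqrt T / real M)) ^ Suc k *
         (C * T powr ((real d - 1) / 4) * lattice_sum_order k ((real d + 1) / 2) (real M))"
proof -
  define N where "N = Suc k"
  define \<alpha> where "\<alpha> = (real d + 1) / 2"
  obtain C where C: "C \<ge> 0" "\<And>T M s \<xi>. \<lbrakk>T > 0; M \<ge> 1; \<xi> > 0; s + real N * (sqrt T / real M) \<le> T\<rbrakk> \<Longrightarrow>
     \<bar>fdiff N (sqrt T / real M) (\<lambda>u. ball_ft (d + 2 * N) u \<xi>) s\<bar> \<le>
       (pi * (sqrt T / real M)) ^ N * (C * T powr ((real d - 1) / 4) * (\<xi> powr (-\<alpha>) * min 1 ((real M / \<xi>) ^ N)))"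
    using ball_ft_fdiff_bound[OF assms(1), of N] unfolding \<alpha>_def by blast
  obtain K where K: "K \<ge> 0" "\<And>M X. \<lbrakk>M \<ge> 1; finite X; X \<subseteq> nonzero_lattice k\<rbrakk> \<Longrightarrow>
      (\<Sum>m\<in>X. lattice_norm k m powr (-\<alpha>) * min 1 ((real M / lattice_norm k m) ^ N)) \<le> K * lattice_sum_order k \<alpha> (real M)"
    using lattice_sum_bound[of \<alpha> k N] by (auto simp: \<alpha>_def N_def)
  have "\<bar>fdiff N (sqrt T / real M) (lattice_ball_vol (d - k + 2 * N) k \<kappa>) s - fdiff N (sqrt T / real M) (ball_vol (d + 2 * N)) s\<bar>
       \<le> (pi * (sqrt T / real M)) ^ N * (C * K * T powr ((real d - 1) / 4) * lattice_sum_order k \<alpha> (real M))"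
    if T: "T > 0" and M: "M \<ge> 1" and sT: "s + real N * (sqrt T / real M) \<le> T" for T M s \<kappa>
  proof -
    define h where "h = sqrt T / real M"
    define c where "c = (\<lambda>m. \<Prod>i<k. cos (2 * pi * of_int (m i) * \<kappa> i))"
    define t where "t = (\<lambda>m. fdiff N h (\<lambda>u. ball_ft (d + 2 * N) u (lattice_norm k m)) s)"
    define W where "W = (pi * h) ^ N * (C * T powr ((real d - 1) / 4))"
    have h: "h > 0" using T M by (simp add: h_def)
    have W: "W \<ge> 0" using h C by (simp add: W_def)
    have c_le: "\<bar>c m\<bar> \<le> 1" for m
      unfolding c_def abs_prod by (rule prod_le_1) auto
    have dim: "d - k + 2 * N + k = d + 2 * N" using assms by simp
    have "((\<lambda>m. c m * ball_ft (d + 2 * N) u (lattice_norm k m)) has_sum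
            (lattice_ball_vol (d - k + 2 * N) k \<kappa> u - ball_vol (d + 2 * N) u)) (nonzero_lattice k)" for u
      using lattice_ball_vol_poisson[of "d - k + 2 * N" k \<kappa> u] unfolding dim c_def by (simp add: N_def)
    hence "((\<lambda>m. c m * t m) has_sum
       fdiff N h (\<lambda>u. lattice_ball_vol (d - k + 2 * N) k \<kappa> u - ball_vol (d + 2 * N) u) s) (nonzero_lattice k)"
      unfolding t_def by (rule has_sum_fdiff)
    hence sum: "((\<lambda>m. c m * t m) has_sum
       (fdiff N h (lattice_ball_vol (d - k + 2 * N) k \<kappa>) s - fdiff N h (ball_vol (d + 2 * N)) s)) (nonzero_lattice k)"
      by (simp add: fdiff_diff)
    have fin: "(\<Sum>m\<in>X. \<bar>c m * t m\<bar>) \<le> W * (K * lattice_sum_order k \<alpha> (real M))"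
      if X: "finite X" "X \<subseteq> nonzero_lattice k" for X
    proof -
      have "(\<Sum>m\<in>X. \<bar>c m * t m\<bar>) \<le> (\<Sum>m\<in>X. W * (lattice_norm k m powr (-\<alpha>) * min 1 ((real M / lattice_norm k m) ^ N)))"
      proof (rule sum_mono)
        fix m assume "m \<in> X"
        hence m: "lattice_norm k m > 0" using X by (auto simp: nonzero_lattice_def less_le)
        have "\<bar>c m * t m\<bar> \<le> 1 * \<bar>t m\<bar>"
          unfolding abs_mult using c_le by (intro mult_right_mono) auto
        also have "\<dots> \<le> W * (lattice_norm k m powr (-\<alpha>) * min 1 ((real M / lattice_norm k m) ^ N))"
          using C(2)[OF T M m sT] by (simp add: t_def W_def h_def mult.assoc)
        finally show "\<bar>c m * t m\<bar> \<le> W * (lattice_norm k m powr (-\<alpha>) * min 1 ((real M / lattice_norm k m) ^ N))" .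
      qed
      also have "\<dots> = W * (\<Sum>m\<in>X. lattice_norm k m powr (-\<alpha>) * min 1 ((real M / lattice_norm k m) ^ N))"
        by (simp add: sum_distrib_left)
      also have "\<dots> \<le> W * (K * lattice_sum_order k \<alpha> (real M))"
        by (intro mult_left_mono K M X W)
      finally show ?thesis .
    qed
    have "fdiff N h (lattice_ball_vol (d - k + 2 * N) k \<kappa>) s - fdiff N h (ball_vol (d + 2 * N)) s
        \<le> W * (K * lattice_sum_order k \<alpha> (real M))"
      by (rule has_sum_le_finite_sums[OF sum]) (rule order_trans[OF sum_mono fin], auto)
    moreover have "-(fdiff N h (lattice_ball_vol (d - k + 2 * N) k \<kappa>) s - fdiff N h (ball_vol (d + 2 * N)) s)
        \<le> W * (K * lattice_sum_order k \<alpha> (real M))"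
      by (rule has_sum_le_finite_sums[OF has_sum_uminusI[OF sum]]) (rule order_trans[OF sum_mono fin], auto)
    ultimately have "\<bar>fdiff N h (lattice_ball_vol (d - k + 2 * N) k \<kappa>) s - fdiff N h (ball_vol (d + 2 * N)) s\<bar>
        \<le> W * (K * lattice_sum_order k \<alpha> (real M))" by linarith
    thus ?thesis by (simp add: W_def h_def mult_ac)
  qed
  moreover have "C * K \<ge> 0" using C K by simp
  ultimately show ?thesis unfolding N_def \<alpha>_def by blast
qed

lemma power_diff_le:
  fixes x y :: real
  assumes "0 \<le> y" "y \<le> x"
  shows "x ^ d - y ^ d \<le> real d * (x - y) * x ^ (d - 1)"
proof (induction d)
  case (Suc d)
  have "x ^ Suc d - y ^ Suc d = x * (x ^ d - y ^ d) + (x - y) * y ^ d" by (simp add: algebra_simps)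
  also have "\<dots> \<le> x * (real d * (x - y) * x ^ (d - 1)) + (x - y) * x ^ d"
    using assms by (intro add_mono mult_left_mono Suc power_mono) auto
  also have "\<dots> = real (Suc d) * (x - y) * x ^ (Suc d - 1)"
    by (cases d) (auto simp: algebra_simps)
  finally show ?case .
qed auto

text \<open>
  The lattice sum at \<open>s = \<rho>\<^sup>2\<close> is bounded above by its difference based at \<open>s\<close> and below by
  its difference based at \<open>s - N h\<close>. Comparing these with the differences of the volume of the \<open>d\<close>-ball
  leaves the Fourier error and the volume of a shell of width of order \<open>1 / M\<close>.
\<close>

lemma error_bound_parameter:
  assumes "d \<ge> 1" "k \<le> d"
  shows "\<exists>C\<ge>0. \<forall>\<rho>\<ge>2 * real (Suc k). \<forall>M\<ge>1. \<forall>\<kappa>.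
     \<bar>R d k \<rho> \<kappa>\<bar> \<le> C * (\<rho> ^ (d - 1) / real M
        + \<rho> powr ((real d - 1) / 2) * lattice_sum_order k ((real d + 1) / 2) (real M))"
proof -
  define N where "N = Suc k"
  define \<alpha> where "\<alpha> = (real d + 1) / 2"
  obtain C where C: "C \<ge> 0" "\<And>T M s \<kappa>. \<lbrakk>T > 0; M \<ge> 1; s + real N * (sqrt T / real M) \<le> T\<rbrakk> \<Longrightarrow>
     \<bar>fdiff N (sqrt T / real M) (lattice_ball_vol (d - k + 2 * N) k \<kappa>) s
       - fdiff N (sqrt T / real M) (ball_vol (d + 2 * N)) s\<bar> \<le>
       (pi * (sqrt T / real M)) ^ N * (C * T powr ((real d - 1) / 4) * lattice_sum_order k \<alpha> (real M))"
    using fdiff_lattice_error_bound[OF assms] unfolding N_def \<alpha>_def by blast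
  define D where "D = max (unit_ball_vol (real d) * (real d * (4 * real N) * 2 ^ (d - 1))) (C * 2 powr ((real d - 1) / 2))"
  have "\<bar>R d k \<rho> \<kappa>\<bar> \<le> D * (\<rho> ^ (d - 1) / real M + \<rho> powr ((real d - 1) / 2) * lattice_sum_order k \<alpha> (real M))"
    if \<rho>: "\<rho> \<ge> 2 * real N" and M: "M \<ge> 1" for \<rho> M \<kappa>
  proof -
    have \<rho>0: "\<rho> > 0" using \<rho> by (simp add: N_def)
    \<comment> \<open>All arguments of the transforms lie below \<open>2 \<rho>\<^sup>2\<close>; the larger \<open>T\<close> makes \<open>sqrt T\<close> simple.\<close>
    define T where "T = (2 * \<rho>)\<^sup>2"
    define h where "h = sqrt T / real M"
    have "sqrt T = 2 * \<rho>" unfolding T_def real_sqrt_abs using \<rho>0 by simp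
    hence h_eq: "h = 2 * \<rho> / real M" by (simp add: h_def)
    have T: "T > 0" using \<rho>0 by (simp add: T_def)
    have h: "h > 0" using T M by (simp add: h_def)
    \<comment> \<open>\<open>N h = \<rho> e\<close>, and both \<open>\<rho>\<^sup>2 + \<rho> e\<close> and \<open>\<rho>\<^sup>2 - \<rho> e\<close> lie between the squares of \<open>\<rho> - e\<close> and \<open>\<rho> + e\<close>.\<close>
    define e where "e = 2 * real N / real M"
    have e: "0 < e" "e \<le> \<rho>"
    proof -
      show "0 < e" using M by (simp add: e_def N_def)
      have "e \<le> 2 * real N / 1" unfolding e_def using M by (intro divide_left_mono) auto
      thus "e \<le> \<rho>" using \<rho> by simp
    qed
    have Nh: "real N * h = \<rho> * e" by (simp add: h_eq e_def)
    have \<rho>e: "\<rho> * e \<le> \<rho>\<^sup>2" using e \<rho>0 by (simp add: power2_eq_square)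
    define E where "E = C * T powr ((real d - 1) / 4) * lattice_sum_order k \<alpha> (real M)"
    have bounds: "fdiff N h (G N) s \<in> {(pi * h) ^ N * G 0 s..(pi * h) ^ N * G 0 (s + \<rho> * e)}"
      if "\<And>j a b. a \<le> b \<Longrightarrow> (G j has_integral (G (Suc j) b - G (Suc j) a) / pi) {a..b}" "\<And>u v. u \<le> v \<Longrightarrow> G 0 u \<le> G 0 v" for G s
      unfolding Nh[symmetric] by (rule fdiff_bounds) (use h that in auto)
    have L: "fdiff N h (lattice_ball_vol (d - k + 2 * N) k \<kappa>) s \<in>
        {(pi * h) ^ N * lattice_ball_vol (d - k) k \<kappa> s..(pi * h) ^ N * lattice_ball_vol (d - k) k \<kappa> (s + \<rho> * e)}" for s
      using bounds[of "\<lambda>j. lattice_ball_vol (d - k + 2 * j) k \<kappa>" s] lattice_ball_vol_has_integral lattice_ball_vol_mono by simp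
    have V: "fdiff N h (ball_vol (d + 2 * N)) s \<in>
        {(pi * h) ^ N * ball_vol d s..(pi * h) ^ N * ball_vol d (s + \<rho> * e)}" for s
      using bounds[of "\<lambda>j. ball_vol (d + 2 * j)" s] ball_vol_has_integral[of _ _ _ 0] ball_vol_mono by simp
    have err: "\<bar>fdiff N h (lattice_ball_vol (d - k + 2 * N) k \<kappa>) s - fdiff N h (ball_vol (d + 2 * N)) s\<bar> \<le> (pi * h) ^ N * E"
      if "s \<le> \<rho>\<^sup>2" for s
      unfolding h_def E_def
    proof (rule C(2)[OF T M])
      have "s + real N * h \<le> \<rho>\<^sup>2 + \<rho>\<^sup>2" unfolding Nh using that \<rho>e by linarith
      also have "\<dots> \<le> T" by (simp add: T_def power_mult_distrib)
      finally show "s + real N * (sqrt T / real M) \<le> T" by (simp add: h_def)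
    qed
    have pos: "(pi * h) ^ N > 0" using h by simp
    have upper: "lattice_ball_vol (d - k) k \<kappa> (\<rho>\<^sup>2) \<le> ball_vol d (\<rho>\<^sup>2 + \<rho> * e) + E"
    proof -
      have "(pi * h) ^ N * lattice_ball_vol (d - k) k \<kappa> (\<rho>\<^sup>2) \<le> (pi * h) ^ N * (ball_vol d (\<rho>\<^sup>2 + \<rho> * e) + E)"
        using L[of "\<rho>\<^sup>2"] V[of "\<rho>\<^sup>2"] err[of "\<rho>\<^sup>2"] unfolding distrib_left by auto
      thus ?thesis using pos by simp
    qed
    have lower: "lattice_ball_vol (d - k) k \<kappa> (\<rho>\<^sup>2) \<ge> ball_vol d (\<rho>\<^sup>2 - \<rho> * e) - E"
    proof -
      have "(pi * h) ^ N * (ball_vol d (\<rho>\<^sup>2 - \<rho> * e) - E) \<le> (pi * h) ^ N * lattice_ball_vol (d - k) k \<kappa> (\<rho>\<^sup>2)"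
        using L[of "\<rho>\<^sup>2 - \<rho> * e"] V[of "\<rho>\<^sup>2 - \<rho> * e"] err[of "\<rho>\<^sup>2 - \<rho> * e"] e \<rho>0 unfolding right_diff_distrib by auto
      thus ?thesis using pos by simp
    qed
    have vol: "ball_vol d (x\<^sup>2) = unit_ball_vol (real d) * x ^ d" if "x \<ge> 0" for x
      using that assms by (auto simp: ball_vol_def)
    have "\<rho>\<^sup>2 + \<rho> * e \<le> (\<rho> + e)\<^sup>2" using e \<rho>0 by (simp add: power2_eq_square algebra_simps)
    hence vol_up: "ball_vol d (\<rho>\<^sup>2 + \<rho> * e) \<le> unit_ball_vol (real d) * (\<rho> + e) ^ d"
      using e \<rho>0 by (subst vol[symmetric]) (auto intro: ball_vol_mono)
    have "(\<rho> - e)\<^sup>2 \<le> \<rho>\<^sup>2 - \<rho> * e"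
      using e \<rho>0 mult_right_mono[of e \<rho> e] by (simp add: power2_eq_square algebra_simps)
    hence vol_lo: "ball_vol d (\<rho>\<^sup>2 - \<rho> * e) \<ge> unit_ball_vol (real d) * (\<rho> - e) ^ d"
      using e \<rho>0 by (subst vol[symmetric]) (auto intro: ball_vol_mono)
    have mono_pw: "(\<rho> - e) ^ d \<le> \<rho> ^ d" "\<rho> ^ d \<le> (\<rho> + e) ^ d"
      using e \<rho>0 by (auto intro!: power_mono)
    hence mono_vol: "unit_ball_vol (real d) * (\<rho> - e) ^ d \<le> unit_ball_vol (real d) * \<rho> ^ d"
       "unit_ball_vol (real d) * \<rho> ^ d \<le> unit_ball_vol (real d) * (\<rho> + e) ^ d"
      by (auto intro!: mult_left_mono)
    have "R d k \<rho> \<kappa> = lattice_ball_vol (d - k) k \<kappa> (\<rho>\<^sup>2) - unit_ball_vol (real d) * \<rho> ^ d"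
      by (simp add: R_def S_eq_lattice_ball_vol[OF \<rho>0])
    hence "\<bar>R d k \<rho> \<kappa>\<bar> \<le> (unit_ball_vol (real d) * (\<rho> + e) ^ d - unit_ball_vol (real d) * (\<rho> - e) ^ d) + E"
      using upper lower vol_up vol_lo mono_vol by linarith
    also have "unit_ball_vol (real d) * (\<rho> + e) ^ d - unit_ball_vol (real d) * (\<rho> - e) ^ d
        = unit_ball_vol (real d) * ((\<rho> + e) ^ d - (\<rho> - e) ^ d)" by (simp add: right_diff_distrib)
    also have "\<dots> \<le> unit_ball_vol (real d) * (real d * ((\<rho> + e) - (\<rho> - e)) * (\<rho> + e) ^ (d - 1))"
      using e by (intro mult_left_mono power_diff_le) auto
    also have "\<dots> \<le> unit_ball_vol (real d) * (real d * ((\<rho> + e) - (\<rho> - e)) * (2 * \<rho>) ^ (d - 1))"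
      using e \<rho>0 by (intro mult_left_mono power_mono) auto
    also have "\<dots> = unit_ball_vol (real d) * (real d * (4 * real N) * 2 ^ (d - 1)) * (\<rho> ^ (d - 1) / real M)"
      by (simp add: e_def power_mult_distrib)
    also have "\<dots> \<le> D * (\<rho> ^ (d - 1) / real M)"
      using \<rho>0 by (intro mult_right_mono) (auto simp: D_def)
    also have "E = C * 2 powr ((real d - 1) / 2) * (\<rho> powr ((real d - 1) / 2) * lattice_sum_order k \<alpha> (real M))"
    proof -
      have "T powr ((real d - 1) / 4) = (2 * \<rho>) powr ((real d - 1) / 2)"
      proof -
        have "T = (2 * \<rho>) powr 2" using \<rho>0 by (simp add: T_def)
        moreover have "2 * ((real d - 1) / 4) = (real d - 1) / 2" by simp
        ultimately show ?thesis by (simp only: powr_powr)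
      qed
      thus ?thesis using \<rho>0 by (simp add: E_def powr_mult)
    qed
    also have "\<dots> \<le> D * (\<rho> powr ((real d - 1) / 2) * lattice_sum_order k \<alpha> (real M))"
      using M by (intro mult_right_mono) (auto simp: D_def lattice_sum_order_def)
    finally show ?thesis by (simp add: distrib_left)
  qed
  moreover have "D \<ge> 0" using C(1) by (simp add: D_def le_max_iff_disj)
  ultimately show ?thesis unfolding N_def \<alpha>_def by blast
qed

text \<open>
  With \<open>M\<close> of order \<open>\<rho>^\<theta>\<close> the two parts of the error balance for \<open>\<theta> = (d-1)/2\<close> if
  \<open>k \<le> (d+1)/2\<close>, up to the logarithm in the case of equality, and for
  \<open>\<theta> = (d-1)/(1-d+2k)\<close> if \<open>k > (d+1)/2\<close>.
\<close>

theorem theorem1p1: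
  fixes d k :: nat
  assumes "d \<ge> 1" and "k \<le> d"
  shows "\<exists>C. \<forall>\<^sub>F \<rho> in at_top. \<forall>\<kappa> \<in> real_space k.
    \<bar>R d k \<rho> \<kappa>\<bar> \<le> C *
      (if real k < (real d + 1) / 2 then \<rho> powr ((real d - 1) / 2)
       else if real k = (real d + 1) / 2 then \<rho> powr ((real d - 1) / 2) * ln \<rho>
       else \<rho> powr (real d - 2 * real k / (1 - real d + 2 * real k)))"
proof -
  obtain C where C: "C \<ge> 0" "\<And>\<rho> M \<kappa>. \<lbrakk>\<rho> \<ge> 2 * real (Suc k); M \<ge> 1\<rbrakk> \<Longrightarrow>
     \<bar>R d k \<rho> \<kappa>\<bar> \<le> C * (\<rho> ^ (d - 1) / real M
        + \<rho> powr ((real d - 1) / 2) * lattice_sum_order k ((real d + 1) / 2) (real M))"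
    using error_bound_parameter[OF assms] by blast
  have bound: "\<bar>R d k \<rho> \<kappa>\<bar> \<le> C * (\<rho> powr (real d - 1 - \<theta>) +
      \<rho> powr ((real d - 1) / 2) * lattice_sum_order k ((real d + 1) / 2) (2 * \<rho> powr \<theta>))"
    if \<rho>: "\<rho> \<ge> 2 * real (Suc k)" and \<theta>: "\<theta> \<ge> 0" for \<rho> \<kappa> \<theta>
  proof -
    define M where "M = nat \<lceil>\<rho> powr \<theta>\<rceil>"
    have "\<rho> \<ge> 1" using \<rho> by simp
    hence "\<rho> powr \<theta> \<ge> 1" using \<theta> by (rule ge_one_powr_ge_zero)
    hence M: "M \<ge> 1" "\<rho> powr \<theta> \<le> real M" "real M \<le> 2 * \<rho> powr \<theta>"
      unfolding M_def by linarith+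
    have "\<bar>R d k \<rho> \<kappa>\<bar> \<le> C * (\<rho> ^ (d - 1) / real M
        + \<rho> powr ((real d - 1) / 2) * lattice_sum_order k ((real d + 1) / 2) (real M))"
      by (rule C(2)[OF \<rho> M(1)])
    also have "\<dots> \<le> C * (\<rho> powr (real d - 1 - \<theta>) +
      \<rho> powr ((real d - 1) / 2) * lattice_sum_order k ((real d + 1) / 2) (2 * \<rho> powr \<theta>))"
    proof (intro mult_left_mono add_mono C(1))
      have pw: "\<rho> ^ (d - 1) = \<rho> powr (real d - 1)"
        using \<open>\<rho> \<ge> 1\<close> assms by (simp add: powr_realpow[symmetric] of_nat_diff)
      show "\<rho> ^ (d - 1) / real M \<le> \<rho> powr (real d - 1 - \<theta>)"
        unfolding pw powr_diff[of \<rho> "real d - 1" \<theta>]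
        using M \<open>\<rho> \<ge> 1\<close> by (intro divide_left_mono) auto
      show "lattice_sum_order k ((real d + 1) / 2) (real M) \<le> lattice_sum_order k ((real d + 1) / 2) (2 * \<rho> powr \<theta>)"
        using M \<open>\<rho> \<ge> 1\<close> by (auto simp: lattice_sum_order_def intro!: powr_mono2)
    qed auto
    finally show ?thesis .
  qed
  have ev: "\<forall>\<^sub>F \<rho> in at_top. \<rho> \<ge> 2 * real (Suc k) \<and> \<rho> \<ge> exp 1"
    by (intro eventually_conj eventually_ge_at_top)
  consider (lt) "real k < (real d + 1) / 2" | (eq) "real k = (real d + 1) / 2" | (gt) "real k > (real d + 1) / 2"
    by linarith
  thus ?thesis
  proof cases
    case lt
    show ?thesis
    proof (rule exI[of _ "C * 2"], rule eventually_mono[OF ev], intro ballI)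
      fix \<rho> \<kappa> assume "\<rho> \<ge> 2 * real (Suc k) \<and> \<rho> \<ge> exp 1"
      hence "\<bar>R d k \<rho> \<kappa>\<bar> \<le> C * (\<rho> powr (real d - 1 - (real d - 1) / 2) + \<rho> powr ((real d - 1) / 2) * 1)"
        using bound[of \<rho> "(real d - 1) / 2" \<kappa>] lt assms by (simp add: lattice_sum_order_def)
      also have "real d - 1 - (real d - 1) / 2 = (real d - 1) / 2" by (simp add: field_simps)
      finally show "\<bar>R d k \<rho> \<kappa>\<bar> \<le> C * 2 * (if real k < (real d + 1) / 2 then \<rho> powr ((real d - 1) / 2)
         else if real k = (real d + 1) / 2 then \<rho> powr ((real d - 1) / 2) * ln \<rho>
         else \<rho> powr (real d - 2 * real k / (1 - real d + 2 * real k)))" using lt by simp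
    qed
  next
    case eq
    define \<theta> where "\<theta> = (real d - 1) / 2"
    have \<theta>: "\<theta> \<ge> 0" using assms by (simp add: \<theta>_def)
    show ?thesis
    proof (rule exI[of _ "C * (4 + \<theta>)"], rule eventually_mono[OF ev], intro ballI)
      fix \<rho> \<kappa> assume \<rho>: "\<rho> \<ge> 2 * real (Suc k) \<and> \<rho> \<ge> exp 1"
      have \<rho>0: "\<rho> > 0" using \<rho> by simp
      have ln_ge: "ln \<rho> \<ge> 1" using \<rho> \<rho>0 by (subst ln_ge_iff) auto
      have "1 + ln (2 * \<rho> powr \<theta>) = 1 + ln 2 + \<theta> * ln \<rho>"
        using \<rho>0 by (simp add: ln_mult ln_powr)
      also have "\<dots> \<le> 2 + \<theta> * ln \<rho>" using ln_2_less_1 by simp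
      finally have *: "1 + (1 + ln (2 * \<rho> powr \<theta>)) \<le> (4 + \<theta>) * ln \<rho>"
        using ln_ge by (simp add: distrib_right)
      have "\<bar>R d k \<rho> \<kappa>\<bar> \<le> C * (\<rho> powr (real d - 1 - \<theta>) + \<rho> powr \<theta> * (1 + ln (2 * \<rho> powr \<theta>)))"
        using bound[of \<rho> \<theta> \<kappa>] \<rho> \<theta> eq by (simp add: lattice_sum_order_def \<theta>_def)
      also have "real d - 1 - \<theta> = \<theta>" by (simp add: \<theta>_def field_simps)
      also have "C * (\<rho> powr \<theta> + \<rho> powr \<theta> * (1 + ln (2 * \<rho> powr \<theta>))) = C * \<rho> powr \<theta> * (1 + (1 + ln (2 * \<rho> powr \<theta>)))"
        by (simp add: algebra_simps)
      also have "\<dots> \<le> C * \<rho> powr \<theta> * ((4 + \<theta>) * ln \<rho>)"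
        using * C(1) by (intro mult_left_mono) auto
      finally show "\<bar>R d k \<rho> \<kappa>\<bar> \<le> C * (4 + \<theta>) * (if real k < (real d + 1) / 2 then \<rho> powr ((real d - 1) / 2)
         else if real k = (real d + 1) / 2 then \<rho> powr ((real d - 1) / 2) * ln \<rho>
         else \<rho> powr (real d - 2 * real k / (1 - real d + 2 * real k)))"
        using eq by (simp add: \<theta>_def mult_ac)
    qed
  next
    case gt
    define D where "D = 1 - real d + 2 * real k"
    define \<theta> where "\<theta> = (real d - 1) / D"
    define \<eta> where "\<eta> = real k - (real d + 1) / 2"
    have D: "D > 2" using gt by (simp add: D_def)
    have \<theta>: "\<theta> \<ge> 0" using assms D by (simp add: \<theta>_def)
    show ?thesis
    proof (rule exI[of _ "C * (1 + 2 powr \<eta>)"], rule eventually_mono[OF ev], intro ballI)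
      fix \<rho> \<kappa> assume \<rho>: "\<rho> \<ge> 2 * real (Suc k) \<and> \<rho> \<ge> exp 1"
      have \<rho>0: "\<rho> > 0" using \<rho> by simp
      have \<eta>: "\<eta> = (D - 2) / 2" by (simp add: D_def \<eta>_def field_simps)
      have e1: "real d - 1 - \<theta> = real d - 2 * real k / D"
      proof -
        have "2 * real k = D + (real d - 1)" by (simp add: D_def)
        thus ?thesis using D by (simp add: \<theta>_def add_divide_distrib)
      qed
      have e2: "(real d - 1) / 2 + \<theta> * \<eta> = real d - 1 - \<theta>"
        unfolding \<theta>_def \<eta> using D by (simp add: field_simps)
      have "\<bar>R d k \<rho> \<kappa>\<bar> \<le> C * (\<rho> powr (real d - 1 - \<theta>) + \<rho> powr ((real d - 1) / 2) * (2 * \<rho> powr \<theta>) powr \<eta>)"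
        using bound[of \<rho> \<theta> \<kappa>] \<rho> \<theta> gt by (simp add: lattice_sum_order_def \<eta>_def)
      also have "(2 * \<rho> powr \<theta>) powr \<eta> = 2 powr \<eta> * \<rho> powr (\<theta> * \<eta>)"
        using \<rho>0 by (simp add: powr_mult powr_powr)
      also have "\<rho> powr ((real d - 1) / 2) * (2 powr \<eta> * \<rho> powr (\<theta> * \<eta>)) = 2 powr \<eta> * \<rho> powr (real d - 1 - \<theta>)"
        unfolding e2[symmetric] by (simp add: powr_add mult_ac)
      finally show "\<bar>R d k \<rho> \<kappa>\<bar> \<le> C * (1 + 2 powr \<eta>) * (if real k < (real d + 1) / 2 then \<rho> powr ((real d - 1) / 2)
         else if real k = (real d + 1) / 2 then \<rho> powr ((real d - 1) / 2) * ln \<rho>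
         else \<rho> powr (real d - 2 * real k / (1 - real d + 2 * real k)))"
        using gt unfolding e1 D_def[symmetric] by (simp add: algebra_simps)
    qed
  qed
qed

end
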